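(* Let $k$ be a field, let $G$ be a finite group and let $\mathcal{C}\to\mathcal{B}$ be a Galois covering of $k$-categories with group $G$. Let $\mathcal{B}\# k^G\to(\mathcal{B}\# k^G)\# kG$ be the associated smash extension. Then $\mathcal{B}\# k^G$ is Morita equivalent to $\mathcal{C}$, and $(\mathcal{B}\# k^G)\# kG$ is Morita equivalent to $\mathcal{B}$.
   Context: A $k$-category is a category whose objects form a set, whose morphism sets ${}_y\mathcal{C}_x$ (from $x$ to $y$) are $k$-vector spaces, and whose composition is $k$-bilinear. Functors and equivalences between $k$-linear categories are understood to be $k$-linear. A left $\mathcal{C}$-module is a $k$-linear covariant functor from $\mathcal{C}$ to $k$-vector spaces, with natural transformations as morphisms; two $k$-categories are Morita equivalent if their categories of left modules are equivalent. A $G$-$k$-category is a $k$-category $\mathcal{C}$ with an action of $G$ on its set of objects and $k$-linear maps $s:{}_y\mathcal{C}_x\to{}_{sy}\mathcal{C}_{sx}$ for $s\in G$ such that $s(gf)=s(g)s(f)$, $t(sf)=(ts)f$ and $1f=f$. It is free if $sx=x$ for an object $x$ implies $s=1$. For a free $G$-$k$-category $\mathcal{C}$, the quotient category $\mathcal{C}/G$ has as objects the $G$-orbits of objects, with morphisms ${}_\beta(\mathcal{C}/G)_\alpha=\left(\bigoplus_{b\in\beta,a\in\alpha}{}_b\mathcal{C}_a\right)/G$, where $X/G$ denotes the coinvariants of a $kG$-module $X$. For $g\in{}_d\mathcal{C}_c$ and $f\in{}_b\mathcal{C}_a$ with $c=sb$ ($s\in G$), composition is $[g][f]=[g\,(sf)]$.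 A Galois covering with group $G$ is the projection functor $\mathcal{C}\to\mathcal{B}=\mathcal{C}/G$, where $\mathcal{C}$ is a free $G$-$k$-category. Associated grading: choose an object $x_\alpha$ in each orbit $\alpha$. Then ${}_\beta\mathcal{B}_\alpha\cong\bigoplus_{g\in G}{}_{x_\beta}\mathcal{C}_{gx_\alpha}$, and $\mathcal{B}$ is $G$-graded by letting the degree $g$ component ${}_\beta\mathcal{B}_\alpha^g$ be the image of ${}_{x_\beta}\mathcal{C}_{gx_\alpha}$. Smash categories: if $H$ is a Hopf algebra and $\mathcal{D}$ is an $H$-module category (each morphism space is an $H$-module, composition maps are $H$-module maps for the diagonal action, and $h\,1_x=\epsilon(h)1_x$ for each object $x$), then $\mathcal{D}\# H$ has the same objects as $\mathcal{D}$, morphisms ${}_y(\mathcal{D}\# H)_x={}_y\mathcal{D}_x\otimes_k H$, and composition $(\varphi\otimes h)(\psi\otimes h')=\sum\varphi\,(h_1\psi)\otimes h_2h'$. The smash extension is the functor $\mathcal{D}\to\mathcal{D}\# H$ that is the identity on objects and $f\mapsto f\otimes 1$ on morphisms. The $G$-graded category $\mathcal{B}$ is a $k^G$-module category, where $k^G=(kG)^*$ has basis $(\delta_s)_{s\in G}$ dual to $G$ and $\delta_s$ acts as projection onto the degree $s$ component; this defines $\mathcal{B}\# k^G$. In turn $\mathcal{B}\# k^G$ is a $kG$-module category via $t(f\otimes\delta_s)=f\otimes\delta_{st^{-1}}$ for $s,t\in G$; this defines $(\mathcal{B}\# k^G)\# kG$. *)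

theory Defs
  imports "HOL-Algebra.Module" "HOL-Algebra.Group_Action" "HOL-Algebra.AbelCoset"
begin

text \<open>
  Over a field \<open>K\<close>, a vector space is a record \<open>V\<close> with \<open>module K V\<close>. Such records inherit the
  fields \<open>mult\<close> and \<open>one\<close> from rings; the locale \<open>module\<close> ignores them and they are left
  unspecified in the constructions below.
\<close>

definition linear_maps ::
    "('k, 'r) ring_scheme \<Rightarrow> ('k, 'v) module \<Rightarrow> ('k, 'w) module \<Rightarrow> ('v \<Rightarrow> 'w) set" where
  "linear_maps K V W = {f \<in> carrier V \<rightarrow> carrier W.
     (\<forall>u\<in>carrier V. \<forall>v\<in>carrier V. f (u \<oplus>\<^bsub>V\<^esub> v) = f u \<oplus>\<^bsub>W\<^esub> f v) \<and>
     (\<forall>c\<in>carrier K. \<forall>v\<in>carrier V. f (c \<odot>\<^bsub>V\<^esub> v) = c \<odot>\<^bsub>W\<^esub> f v)}"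

definition direct_sum :: "'i set \<Rightarrow> ('i \<Rightarrow> ('k, 'v) module) \<Rightarrow> ('k, 'i \<Rightarrow> 'v) module" where
  "direct_sum I V =
     \<lparr>carrier = {f \<in> (\<Pi>\<^sub>E i\<in>I. carrier (V i)). finite {i \<in> I. f i \<noteq> \<zero>\<^bsub>V i\<^esub>}},
      mult = undefined, one = undefined,
      zero = (\<lambda>i\<in>I. \<zero>\<^bsub>V i\<^esub>),
      add = (\<lambda>f g. \<lambda>i\<in>I. f i \<oplus>\<^bsub>V i\<^esub> g i),
      smult = (\<lambda>c f. \<lambda>i\<in>I. c \<odot>\<^bsub>V i\<^esub> f i)\<rparr>"

definition direct_sum_incl ::
    "'i set \<Rightarrow> ('i \<Rightarrow> ('k, 'v) module) \<Rightarrow> 'i \<Rightarrow> 'v \<Rightarrow> 'i \<Rightarrow> 'v" where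
  "direct_sum_incl I V i v = (\<lambda>j\<in>I. if j = i then v else \<zero>\<^bsub>V j\<^esub>)"

definition spanned_submodule ::
    "('k, 'r) ring_scheme \<Rightarrow> ('k, 'v) module \<Rightarrow> 'v set \<Rightarrow> 'v set" where
  "spanned_submodule K V S = \<Inter>{N. submodule N K V \<and> S \<subseteq> N}"

definition quotient_module :: "('k, 'v) module \<Rightarrow> 'v set \<Rightarrow> ('k, 'v set) module" where
  "quotient_module V N =
     \<lparr>carrier = a_rcosets\<^bsub>V\<^esub> N,
      mult = undefined, one = undefined,
      zero = N,
      add = set_add V,
      smult = (\<lambda>c A. \<Union>a\<in>A. N +>\<^bsub>V\<^esub> (c \<odot>\<^bsub>V\<^esub> a))\<rparr>"

definition coinvariant_relations ::
    "('k, 'r) ring_scheme \<Rightarrow> ('g, 'q) monoid_scheme \<Rightarrow> ('k, 'v) module \<Rightarrow> ('g \<Rightarrow> 'v \<Rightarrow> 'v) \<Rightarrow> 'v set"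
  where
  "coinvariant_relations K G V act =
     spanned_submodule K V {act s v \<ominus>\<^bsub>V\<^esub> v | s v. s \<in> carrier G \<and> v \<in> carrier V}"

definition coinvariants ::
    "('k, 'r) ring_scheme \<Rightarrow> ('g, 'q) monoid_scheme \<Rightarrow> ('k, 'v) module \<Rightarrow> ('g \<Rightarrow> 'v \<Rightarrow> 'v)
      \<Rightarrow> ('k, 'v set) module" where
  "coinvariants K G V act = quotient_module V (coinvariant_relations K G V act)"

text \<open>
  \<open>Mor C y x\<close> is the space of morphisms from \<open>x\<close> to \<open>y\<close>, and \<open>Cmp C z y x g f\<close> is the composite
  of \<open>f\<close> from \<open>x\<close> to \<open>y\<close> with \<open>g\<close> from \<open>y\<close> to \<open>z\<close>. Different morphism spaces may overlap as sets,
  which is why composition is indexed by the objects.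
\<close>

record ('k, 'o, 'm) kcat =
  Obj :: "'o set"
  Mor :: "'o \<Rightarrow> 'o \<Rightarrow> ('k, 'm) module"
  Cmp :: "'o \<Rightarrow> 'o \<Rightarrow> 'o \<Rightarrow> 'm \<Rightarrow> 'm \<Rightarrow> 'm"
  Idt :: "'o \<Rightarrow> 'm"

locale k_category = field K
  for K :: "('k, 'r) ring_scheme" and C :: "('k, 'o, 'm) kcat" +
  assumes Mor_module: "\<lbrakk>x \<in> Obj C; y \<in> Obj C\<rbrakk> \<Longrightarrow> module K (Mor C y x)"
    and Cmp_linear_right: "\<lbrakk>x \<in> Obj C; y \<in> Obj C; z \<in> Obj C; g \<in> carrier (Mor C z y)\<rbrakk>
      \<Longrightarrow> (\<lambda>f. Cmp C z y x g f) \<in> linear_maps K (Mor C y x) (Mor C z x)"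
    and Cmp_linear_left: "\<lbrakk>x \<in> Obj C; y \<in> Obj C; z \<in> Obj C; f \<in> carrier (Mor C y x)\<rbrakk>
      \<Longrightarrow> (\<lambda>g. Cmp C z y x g f) \<in> linear_maps K (Mor C z y) (Mor C z x)"
    and Cmp_assoc: "\<lbrakk>w \<in> Obj C; x \<in> Obj C; y \<in> Obj C; z \<in> Obj C; h \<in> carrier (Mor C z y);
        g \<in> carrier (Mor C y x); f \<in> carrier (Mor C x w)\<rbrakk>
      \<Longrightarrow> Cmp C z x w (Cmp C z y x h g) f = Cmp C z y w h (Cmp C y x w g f)"
    and Idt_closed: "x \<in> Obj C \<Longrightarrow> Idt C x \<in> carrier (Mor C x x)"
    and Idt_left: "\<lbrakk>x \<in> Obj C; y \<in> Obj C; f \<in> carrier (Mor C y x)\<rbrakk>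
      \<Longrightarrow> Cmp C y y x (Idt C y) f = f"
    and Idt_right: "\<lbrakk>x \<in> Obj C; y \<in> Obj C; f \<in> carrier (Mor C y x)\<rbrakk>
      \<Longrightarrow> Cmp C y x x f (Idt C x) = f"

record ('o, 'm, 'p, 'n) kfun =
  FObj :: "'o \<Rightarrow> 'p"
  FMor :: "'o \<Rightarrow> 'o \<Rightarrow> 'm \<Rightarrow> 'n"

definition k_functor ::
    "('k, 'r) ring_scheme \<Rightarrow> ('k, 'o, 'm) kcat \<Rightarrow> ('k, 'p, 'n) kcat \<Rightarrow> ('o, 'm, 'p, 'n) kfun \<Rightarrow> bool"
  where
  "k_functor K C D F \<longleftrightarrow>
     (\<forall>x\<in>Obj C. FObj F x \<in> Obj D) \<and>
     (\<forall>x\<in>Obj C. \<forall>y\<in>Obj C.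
        FMor F y x \<in> linear_maps K (Mor C y x) (Mor D (FObj F y) (FObj F x))) \<and>
     (\<forall>x\<in>Obj C. FMor F x x (Idt C x) = Idt D (FObj F x)) \<and>
     (\<forall>x\<in>Obj C. \<forall>y\<in>Obj C. \<forall>z\<in>Obj C. \<forall>g\<in>carrier (Mor C z y). \<forall>f\<in>carrier (Mor C y x).
        FMor F z x (Cmp C z y x g f) =
        Cmp D (FObj F z) (FObj F y) (FObj F x) (FMor F z y g) (FMor F y x f))"

definition id_functor :: "('o, 'm, 'o, 'm) kfun" where
  "id_functor = \<lparr>FObj = (\<lambda>x. x), FMor = (\<lambda>y x f. f)\<rparr>"

definition comp_functor ::
    "('p, 'n, 'q, 'l) kfun \<Rightarrow> ('o, 'm, 'p, 'n) kfun \<Rightarrow> ('o, 'm, 'q, 'l) kfun" where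
  "comp_functor E F =
     \<lparr>FObj = (\<lambda>x. FObj E (FObj F x)),
      FMor = (\<lambda>y x f. FMor E (FObj F y) (FObj F x) (FMor F y x f))\<rparr>"

definition natural_transformations ::
    "('k, 'o, 'm) kcat \<Rightarrow> ('k, 'p, 'n) kcat \<Rightarrow> ('o, 'm, 'p, 'n) kfun \<Rightarrow> ('o, 'm, 'p, 'n) kfun
      \<Rightarrow> ('o \<Rightarrow> 'n) set" where
  "natural_transformations C D F E =
     {\<tau> \<in> (\<Pi>\<^sub>E x\<in>Obj C. carrier (Mor D (FObj E x) (FObj F x))).
        \<forall>x\<in>Obj C. \<forall>y\<in>Obj C. \<forall>f\<in>carrier (Mor C y x).
          Cmp D (FObj E y) (FObj F y) (FObj F x) (\<tau> y) (FMor F y x f) =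
          Cmp D (FObj E y) (FObj E x) (FObj F x) (FMor E y x f) (\<tau> x)}"

definition functor_category ::
    "('k, 'r) ring_scheme \<Rightarrow> ('k, 'o, 'm) kcat \<Rightarrow> ('k, 'p, 'n) kcat
      \<Rightarrow> ('k, ('o, 'm, 'p, 'n) kfun, 'o \<Rightarrow> 'n) kcat" where
  "functor_category K C D =
     \<lparr>Obj = {F. k_functor K C D F},
      Mor = (\<lambda>E F.
        \<lparr>carrier = natural_transformations C D F E,
         mult = undefined, one = undefined,
         zero = (\<lambda>x\<in>Obj C. \<zero>\<^bsub>Mor D (FObj E x) (FObj F x)\<^esub>),
         add = (\<lambda>\<sigma> \<tau>. \<lambda>x\<in>Obj C. \<sigma> x \<oplus>\<^bsub>Mor D (FObj E x) (FObj F x)\<^esub> \<tau> x),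
         smult = (\<lambda>c \<tau>. \<lambda>x\<in>Obj C. c \<odot>\<^bsub>Mor D (FObj E x) (FObj F x)\<^esub> \<tau> x)\<rparr>),
      Cmp = (\<lambda>H E F \<sigma> \<tau>. \<lambda>x\<in>Obj C. Cmp D (FObj H x) (FObj E x) (FObj F x) (\<sigma> x) (\<tau> x)),
      Idt = (\<lambda>F. \<lambda>x\<in>Obj C. Idt D (FObj F x))\<rparr>"

definition isomorphic_in :: "('k, 'o, 'm) kcat \<Rightarrow> 'o \<Rightarrow> 'o \<Rightarrow> bool" where
  "isomorphic_in C x y \<longleftrightarrow> x \<in> Obj C \<and> y \<in> Obj C \<and>
     (\<exists>f\<in>carrier (Mor C y x). \<exists>g\<in>carrier (Mor C x y).
        Cmp C x y x g f = Idt C x \<and> Cmp C y x y f g = Idt C y)"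

definition k_equivalent ::
    "('k, 'r) ring_scheme \<Rightarrow> ('k, 'o, 'm) kcat \<Rightarrow> ('k, 'p, 'n) kcat \<Rightarrow> bool" where
  "k_equivalent K C D \<longleftrightarrow> (\<exists>F E. k_functor K C D F \<and> k_functor K D C E \<and>
     isomorphic_in (functor_category K C C) (comp_functor E F) id_functor \<and>
     isomorphic_in (functor_category K D D) (comp_functor F E) id_functor)"

text \<open>
  The type \<open>'v\<close> plays the role of a universe: the objects of \<open>vector_spaces K\<close> are the vector
  spaces whose underlying set is a set of elements of \<open>'v\<close>.
\<close>

definition vector_spaces ::
    "('k, 'r) ring_scheme \<Rightarrow> ('k, ('k, 'v) module, 'v \<Rightarrow> 'v) kcat" where
  "vector_spaces K =
     \<lparr>Obj = {V. module K V},
      Mor = (\<lambda>W V.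
        \<lparr>carrier = linear_maps K V W \<inter> extensional (carrier V),
         mult = undefined, one = undefined,
         zero = (\<lambda>v\<in>carrier V. \<zero>\<^bsub>W\<^esub>),
         add = (\<lambda>f g. \<lambda>v\<in>carrier V. f v \<oplus>\<^bsub>W\<^esub> g v),
         smult = (\<lambda>c f. \<lambda>v\<in>carrier V. c \<odot>\<^bsub>W\<^esub> f v)\<rparr>),
      Cmp = (\<lambda>W V U g f. compose (carrier U) g f),
      Idt = (\<lambda>V. \<lambda>v\<in>carrier V. v)\<rparr>"

definition left_modules ::
    "('k, 'r) ring_scheme \<Rightarrow> ('k, 'o, 'm) kcat
      \<Rightarrow> ('k, ('o, 'm, ('k, 'v) module, 'v \<Rightarrow> 'v) kfun, 'o \<Rightarrow> 'v \<Rightarrow> 'v) kcat" where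
  "left_modules K C = functor_category K C (vector_spaces K)"

definition morita_equivalent ::
    "'v itself \<Rightarrow> ('k, 'r) ring_scheme \<Rightarrow> ('k, 'o, 'm) kcat \<Rightarrow> ('k, 'p, 'n) kcat \<Rightarrow> bool" where
  "morita_equivalent _ K C D \<longleftrightarrow> k_category K C \<and> k_category K D \<and>
     k_equivalent K
       (left_modules K C :: ('k, ('o, 'm, ('k, 'v) module, 'v \<Rightarrow> 'v) kfun, 'o \<Rightarrow> 'v \<Rightarrow> 'v) kcat)
       (left_modules K D :: ('k, ('p, 'n, ('k, 'v) module, 'v \<Rightarrow> 'v) kfun, 'p \<Rightarrow> 'v \<Rightarrow> 'v) kcat)"

text \<open>
  \<open>\<phi> s x\<close> is the object \<open>s x\<close>, and \<open>\<psi> s y x f\<close> is the morphism \<open>s f\<close> from \<open>s x\<close> to \<open>s y\<close>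
  for \<open>f\<close> from \<open>x\<close> to \<open>y\<close>.
\<close>

locale G_k_category = k_category K C + group_action G "Obj C" \<phi>
  for K :: "('k, 'r) ring_scheme" and G :: "('g, 'q) monoid_scheme"
    and C :: "('k, 'o, 'm) kcat" and \<phi> :: "'g \<Rightarrow> 'o \<Rightarrow> 'o"
    and \<psi> :: "'g \<Rightarrow> 'o \<Rightarrow> 'o \<Rightarrow> 'm \<Rightarrow> 'm" +
  assumes act_linear: "\<lbrakk>s \<in> carrier G; x \<in> Obj C; y \<in> Obj C\<rbrakk>
      \<Longrightarrow> \<psi> s y x \<in> linear_maps K (Mor C y x) (Mor C (\<phi> s y) (\<phi> s x))"
    and act_Cmp: "\<lbrakk>s \<in> carrier G; x \<in> Obj C; y \<in> Obj C; z \<in> Obj C;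
        g \<in> carrier (Mor C z y); f \<in> carrier (Mor C y x)\<rbrakk>
      \<Longrightarrow> \<psi> s z x (Cmp C z y x g f) = Cmp C (\<phi> s z) (\<phi> s y) (\<phi> s x) (\<psi> s z y g) (\<psi> s y x f)"
    and act_mult: "\<lbrakk>s \<in> carrier G; t \<in> carrier G; x \<in> Obj C; y \<in> Obj C; f \<in> carrier (Mor C y x)\<rbrakk>
      \<Longrightarrow> \<psi> t (\<phi> s y) (\<phi> s x) (\<psi> s y x f) = \<psi> (t \<otimes>\<^bsub>G\<^esub> s) y x f"
    and act_one: "\<lbrakk>x \<in> Obj C; y \<in> Obj C; f \<in> carrier (Mor C y x)\<rbrakk> \<Longrightarrow> \<psi> \<one>\<^bsub>G\<^esub> y x f = f"

locale free_G_k_category = G_k_category +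
  assumes free: "\<lbrakk>s \<in> carrier G; x \<in> Obj C; \<phi> s x = x\<rbrakk> \<Longrightarrow> s = \<one>\<^bsub>G\<^esub>"

definition orbit_sum :: "('k, 'o, 'm) kcat \<Rightarrow> 'o set \<Rightarrow> 'o set \<Rightarrow> ('k, 'o \<times> 'o \<Rightarrow> 'm) module" where
  "orbit_sum C \<beta> \<alpha> = direct_sum (\<beta> \<times> \<alpha>) (\<lambda>(b, a). Mor C b a)"

definition orbit_incl ::
    "('k, 'o, 'm) kcat \<Rightarrow> 'o set \<Rightarrow> 'o set \<Rightarrow> 'o \<Rightarrow> 'o \<Rightarrow> 'm \<Rightarrow> 'o \<times> 'o \<Rightarrow> 'm" where
  "orbit_incl C \<beta> \<alpha> b a f = direct_sum_incl (\<beta> \<times> \<alpha>) (\<lambda>(b, a). Mor C b a) (b, a) f"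

text \<open>The component of \<open>s F\<close> at \<open>(b, a)\<close> is \<open>s\<close> applied to that of \<open>F\<close> at \<open>(s\<inverse> b, s\<inverse> a)\<close>.\<close>

definition orbit_sum_act ::
    "('g, 'q) monoid_scheme \<Rightarrow> ('g \<Rightarrow> 'o \<Rightarrow> 'o) \<Rightarrow> ('g \<Rightarrow> 'o \<Rightarrow> 'o \<Rightarrow> 'm \<Rightarrow> 'm) \<Rightarrow> 'o set \<Rightarrow> 'o set
      \<Rightarrow> 'g \<Rightarrow> ('o \<times> 'o \<Rightarrow> 'm) \<Rightarrow> 'o \<times> 'o \<Rightarrow> 'm" where
  "orbit_sum_act G \<phi> \<psi> \<beta> \<alpha> s F =
     (\<lambda>(b, a)\<in>\<beta> \<times> \<alpha>. \<psi> s (\<phi> (inv\<^bsub>G\<^esub> s) b) (\<phi> (inv\<^bsub>G\<^esub> s) a) (F (\<phi> (inv\<^bsub>G\<^esub> s) b, \<phi> (inv\<^bsub>G\<^esub> s) a)))"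

definition orbit_class ::
    "('k, 'r) ring_scheme \<Rightarrow> ('g, 'q) monoid_scheme \<Rightarrow> ('k, 'o, 'm) kcat \<Rightarrow> ('g \<Rightarrow> 'o \<Rightarrow> 'o)
      \<Rightarrow> ('g \<Rightarrow> 'o \<Rightarrow> 'o \<Rightarrow> 'm \<Rightarrow> 'm) \<Rightarrow> 'o set \<Rightarrow> 'o set \<Rightarrow> ('o \<times> 'o \<Rightarrow> 'm) \<Rightarrow> ('o \<times> 'o \<Rightarrow> 'm) set"
  where
  "orbit_class K G C \<phi> \<psi> \<beta> \<alpha> F =
     coinvariant_relations K G (orbit_sum C \<beta> \<alpha>) (orbit_sum_act G \<phi> \<psi> \<beta> \<alpha>) +>\<^bsub>orbit_sum C \<beta> \<alpha>\<^esub> F"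

text \<open>
  Bilinear extension of the rule \<open>[g][f] = [g (s f)]\<close> for \<open>g\<close> from \<open>c\<close> to \<open>d\<close> and \<open>f\<close> from \<open>a\<close>
  to \<open>b\<close> with \<open>c = s b\<close>: the product \<open>g (s f)\<close> is a morphism from \<open>a' = s a\<close> to \<open>d\<close>. As the action
  is free, the pairs \<open>(c, b)\<close> are parametrised by the pairs \<open>(c, s)\<close> via \<open>b = s\<inverse> c\<close>. The sum is
  meaningful for finite \<open>G\<close> only.
\<close>

definition orbit_sum_Cmp ::
    "('g, 'q) monoid_scheme \<Rightarrow> ('k, 'o, 'm) kcat \<Rightarrow> ('g \<Rightarrow> 'o \<Rightarrow> 'o) \<Rightarrow> ('g \<Rightarrow> 'o \<Rightarrow> 'o \<Rightarrow> 'm \<Rightarrow> 'm)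
      \<Rightarrow> 'o set \<Rightarrow> 'o set \<Rightarrow> 'o set \<Rightarrow> ('o \<times> 'o \<Rightarrow> 'm) \<Rightarrow> ('o \<times> 'o \<Rightarrow> 'm) \<Rightarrow> 'o \<times> 'o \<Rightarrow> 'm" where
  "orbit_sum_Cmp G C \<phi> \<psi> \<gamma> \<beta> \<alpha> g f =
     (\<lambda>(d, a')\<in>\<gamma> \<times> \<alpha>. \<Oplus>\<^bsub>Mor C d a'\<^esub>c\<in>\<beta>. \<Oplus>\<^bsub>Mor C d a'\<^esub>s\<in>carrier G.
        Cmp C d c a' (g (d, c))
          (\<psi> s (\<phi> (inv\<^bsub>G\<^esub> s) c) (\<phi> (inv\<^bsub>G\<^esub> s) a') (f (\<phi> (inv\<^bsub>G\<^esub> s) c, \<phi> (inv\<^bsub>G\<^esub> s) a'))))"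

definition quotient_category ::
    "('k, 'r) ring_scheme \<Rightarrow> ('g, 'q) monoid_scheme \<Rightarrow> ('k, 'o, 'm) kcat \<Rightarrow> ('g \<Rightarrow> 'o \<Rightarrow> 'o)
      \<Rightarrow> ('g \<Rightarrow> 'o \<Rightarrow> 'o \<Rightarrow> 'm \<Rightarrow> 'm) \<Rightarrow> ('k, 'o set, ('o \<times> 'o \<Rightarrow> 'm) set) kcat" where
  "quotient_category K G C \<phi> \<psi> =
     \<lparr>Obj = orbits G (Obj C) \<phi>,
      Mor = (\<lambda>\<beta> \<alpha>. coinvariants K G (orbit_sum C \<beta> \<alpha>) (orbit_sum_act G \<phi> \<psi> \<beta> \<alpha>)),
      Cmp = (\<lambda>\<gamma> \<beta> \<alpha> A B. \<Union>g\<in>A. \<Union>f\<in>B.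
        orbit_class K G C \<phi> \<psi> \<gamma> \<alpha> (orbit_sum_Cmp G C \<phi> \<psi> \<gamma> \<beta> \<alpha> g f)),
      Idt = (\<lambda>\<alpha>. \<Union>a\<in>\<alpha>. orbit_class K G C \<phi> \<psi> \<alpha> \<alpha> (orbit_incl C \<alpha> \<alpha> a a (Idt C a)))\<rparr>"

definition projection_functor ::
    "('k, 'r) ring_scheme \<Rightarrow> ('g, 'q) monoid_scheme \<Rightarrow> ('k, 'o, 'm) kcat \<Rightarrow> ('g \<Rightarrow> 'o \<Rightarrow> 'o)
      \<Rightarrow> ('g \<Rightarrow> 'o \<Rightarrow> 'o \<Rightarrow> 'm \<Rightarrow> 'm) \<Rightarrow> ('o, 'm, 'o set, ('o \<times> 'o \<Rightarrow> 'm) set) kfun" where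
  "projection_functor K G C \<phi> \<psi> =
     \<lparr>FObj = orbit G \<phi>,
      FMor = (\<lambda>y x f. orbit_class K G C \<phi> \<psi> (orbit G \<phi> y) (orbit G \<phi> x)
        (orbit_incl C (orbit G \<phi> y) (orbit G \<phi> x) y x f))\<rparr>"

definition galois_covering ::
    "('k, 'r) ring_scheme \<Rightarrow> ('g, 'q) monoid_scheme \<Rightarrow> ('k, 'o, 'm) kcat \<Rightarrow> ('g \<Rightarrow> 'o \<Rightarrow> 'o)
      \<Rightarrow> ('g \<Rightarrow> 'o \<Rightarrow> 'o \<Rightarrow> 'm \<Rightarrow> 'm) \<Rightarrow> ('k, 'o set, ('o \<times> 'o \<Rightarrow> 'm) set) kcat
      \<Rightarrow> ('o, 'm, 'o set, ('o \<times> 'o \<Rightarrow> 'm) set) kfun \<Rightarrow> bool" where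
  "galois_covering K G C \<phi> \<psi> B P \<longleftrightarrow> free_G_k_category K G C \<phi> \<psi> \<and>
     B = quotient_category K G C \<phi> \<psi> \<and> P = projection_functor K G C \<phi> \<psi>"

text \<open>\<open>x \<alpha>\<close> is the chosen object of the orbit \<open>\<alpha>\<close>.\<close>

definition degree_component ::
    "('k, 'r) ring_scheme \<Rightarrow> ('g, 'q) monoid_scheme \<Rightarrow> ('k, 'o, 'm) kcat \<Rightarrow> ('g \<Rightarrow> 'o \<Rightarrow> 'o)
      \<Rightarrow> ('g \<Rightarrow> 'o \<Rightarrow> 'o \<Rightarrow> 'm \<Rightarrow> 'm) \<Rightarrow> ('o set \<Rightarrow> 'o) \<Rightarrow> 'o set \<Rightarrow> 'o set \<Rightarrow> 'g
      \<Rightarrow> ('o \<times> 'o \<Rightarrow> 'm) set set" where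
  "degree_component K G C \<phi> \<psi> x \<beta> \<alpha> s =
     (\<lambda>f. orbit_class K G C \<phi> \<psi> \<beta> \<alpha> (orbit_incl C \<beta> \<alpha> (x \<beta>) (\<phi> s (x \<alpha>)) f)) `
       carrier (Mor C (x \<beta>) (\<phi> s (x \<alpha>)))"

definition homogeneous_part ::
    "('g, 'q) monoid_scheme \<Rightarrow> ('k, 'v) module \<Rightarrow> ('g \<Rightarrow> 'v set) \<Rightarrow> 'g \<Rightarrow> 'v \<Rightarrow> 'v" where
  "homogeneous_part G V V' s v =
     (THE u. u \<in> (\<Pi>\<^sub>E t\<in>carrier G. V' t) \<and> v = (\<Oplus>\<^bsub>V\<^esub>t\<in>carrier G. u t)) s"

definition grading_act ::
    "('k, 'r) ring_scheme \<Rightarrow> ('g, 'q) monoid_scheme \<Rightarrow> ('k, 'o, 'm) kcat \<Rightarrow> ('g \<Rightarrow> 'o \<Rightarrow> 'o)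
      \<Rightarrow> ('g \<Rightarrow> 'o \<Rightarrow> 'o \<Rightarrow> 'm \<Rightarrow> 'm) \<Rightarrow> ('o set \<Rightarrow> 'o)
      \<Rightarrow> 'g \<Rightarrow> 'o set \<Rightarrow> 'o set \<Rightarrow> ('o \<times> 'o \<Rightarrow> 'm) set \<Rightarrow> ('o \<times> 'o \<Rightarrow> 'm) set" where
  "grading_act K G C \<phi> \<psi> x s \<beta> \<alpha> =
     homogeneous_part G (Mor (quotient_category K G C \<phi> \<psi>) \<beta> \<alpha>) (degree_component K G C \<phi> \<psi> x \<beta> \<alpha>) s"

text \<open>
  A Hopf algebra \<open>H\<close> with a finite basis \<open>(e a)\<close>, \<open>a \<in> hbasis H\<close>, is given by structure constants:
  \<open>hmult H a b d\<close> is the coefficient of \<open>e d\<close> in \<open>e a e b\<close>, \<open>hunit H d\<close> that of \<open>e d\<close> in \<open>1\<close>, and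
  \<open>hcomult H b a a'\<close> that of \<open>e a \<otimes> e a'\<close> in \<open>\<Delta> (e b)\<close>. The counit and the antipode do not enter
  the construction of a smash category and are not recorded.

  The space \<open>V \<otimes> H\<close> is the direct sum of copies of \<open>V\<close> indexed by the basis: \<open>F\<close> stands for the
  sum of the \<open>F b \<otimes> e b\<close>. An action of \<open>H\<close> is given on basis elements.
\<close>

record ('k, 'h) hopf_data =
  hbasis :: "'h set"
  hmult :: "'h \<Rightarrow> 'h \<Rightarrow> 'h \<Rightarrow> 'k"
  hunit :: "'h \<Rightarrow> 'k"
  hcomult :: "'h \<Rightarrow> 'h \<Rightarrow> 'h \<Rightarrow> 'k"

definition pure_tensor ::
    "('k, 'h) hopf_data \<Rightarrow> ('k, 'v) module \<Rightarrow> 'v \<Rightarrow> ('h \<Rightarrow> 'k) \<Rightarrow> 'h \<Rightarrow> 'v" where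
  "pure_tensor H V v h = (\<lambda>b\<in>hbasis H. h b \<odot>\<^bsub>V\<^esub> v)"

definition smash_category ::
    "('k, 'r) ring_scheme \<Rightarrow> ('k, 'h) hopf_data \<Rightarrow> ('h \<Rightarrow> 'o \<Rightarrow> 'o \<Rightarrow> 'm \<Rightarrow> 'm)
      \<Rightarrow> ('k, 'o, 'm) kcat \<Rightarrow> ('k, 'o, 'h \<Rightarrow> 'm) kcat" where
  "smash_category K H act D =
     \<lparr>Obj = Obj D,
      Mor = (\<lambda>y x. direct_sum (hbasis H) (\<lambda>_. Mor D y x)),
      Cmp = (\<lambda>z y x F E. \<lambda>d\<in>hbasis H.
        \<Oplus>\<^bsub>Mor D z x\<^esub>b\<in>hbasis H. \<Oplus>\<^bsub>Mor D z x\<^esub>c\<in>hbasis H.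
        \<Oplus>\<^bsub>Mor D z x\<^esub>a\<in>hbasis H. \<Oplus>\<^bsub>Mor D z x\<^esub>a'\<in>hbasis H.
          (hcomult H b a a' \<otimes>\<^bsub>K\<^esub> hmult H a' c d) \<odot>\<^bsub>Mor D z x\<^esub> Cmp D z y x (F b) (act a y x (E c))),
      Idt = (\<lambda>x. pure_tensor H (Mor D x x) (Idt D x) (hunit H))\<rparr>"

definition smash_extension ::
    "('k, 'r) ring_scheme \<Rightarrow> ('k, 'h) hopf_data \<Rightarrow> ('h \<Rightarrow> 'o \<Rightarrow> 'o \<Rightarrow> 'm \<Rightarrow> 'm)
      \<Rightarrow> ('k, 'o, 'm) kcat \<Rightarrow> ('k, 'o, 'h \<Rightarrow> 'm) kcat \<Rightarrow> ('o, 'm, 'o, 'h \<Rightarrow> 'm) kfun \<Rightarrow> bool" where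
  "smash_extension K H act D S E \<longleftrightarrow> S = smash_category K H act D \<and>
     E = \<lparr>FObj = (\<lambda>x. x), FMor = (\<lambda>y x f. pure_tensor H (Mor D y x) f (hunit H))\<rparr>"

definition group_algebra ::
    "('k, 'r) ring_scheme \<Rightarrow> ('g, 'q) monoid_scheme \<Rightarrow> ('k, 'g) hopf_data" where
  "group_algebra K G =
     \<lparr>hbasis = carrier G,
      hmult = (\<lambda>s t d. if s \<otimes>\<^bsub>G\<^esub> t = d then \<one>\<^bsub>K\<^esub> else \<zero>\<^bsub>K\<^esub>),
      hunit = (\<lambda>d. if d = \<one>\<^bsub>G\<^esub> then \<one>\<^bsub>K\<^esub> else \<zero>\<^bsub>K\<^esub>),
      hcomult = (\<lambda>s u v. if u = s \<and> v = s then \<one>\<^bsub>K\<^esub> else \<zero>\<^bsub>K\<^esub>)\<rparr>"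

text \<open>Here the basis element indexed by \<open>s\<close> is \<open>\<delta> s\<close>; \<open>\<Delta> (\<delta> s)\<close> is the sum of the
  \<open>\<delta> u \<otimes> \<delta> v\<close> with \<open>u v = s\<close>.\<close>

definition dual_group_algebra ::
    "('k, 'r) ring_scheme \<Rightarrow> ('g, 'q) monoid_scheme \<Rightarrow> ('k, 'g) hopf_data" where
  "dual_group_algebra K G =
     \<lparr>hbasis = carrier G,
      hmult = (\<lambda>s t d. if s = t \<and> d = s then \<one>\<^bsub>K\<^esub> else \<zero>\<^bsub>K\<^esub>),
      hunit = (\<lambda>d. \<one>\<^bsub>K\<^esub>),
      hcomult = (\<lambda>s u v. if u \<otimes>\<^bsub>G\<^esub> v = s then \<one>\<^bsub>K\<^esub> else \<zero>\<^bsub>K\<^esub>)\<rparr>"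

text \<open>
  Since \<open>t (f \<otimes> \<delta> s) = f \<otimes> \<delta> (s t\<inverse>)\<close>, the coefficient of \<open>t F\<close> at \<open>\<delta> u\<close> is that of \<open>F\<close> at
  \<open>\<delta> (u t)\<close>.
\<close>

definition translation_act ::
    "('g, 'q) monoid_scheme \<Rightarrow> 'g \<Rightarrow> 'p \<Rightarrow> 'p \<Rightarrow> ('g \<Rightarrow> 'n) \<Rightarrow> 'g \<Rightarrow> 'n" where
  "translation_act G t y x F = (\<lambda>u\<in>carrier G. F (u \<otimes>\<^bsub>G\<^esub> t))"

end

theory Submission
  imports Defs
begin

text \<open>
  A category \<open>D\<close> is presented by matrices over \<open>C\<close> if every object \<open>X\<close> of \<open>D\<close> comes with a finite
  family of objects \<open>ob X i\<close> of \<open>C\<close> such that the morphisms from \<open>X\<close> to \<open>Y\<close> are the matrices of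
  morphisms from \<open>ob X i\<close> to \<open>ob Y j\<close>, composed by the matrix product. If every object of \<open>C\<close> occurs
  among the \<open>ob X i\<close>, then \<open>C\<close> and \<open>D\<close> have equivalent module categories: a \<open>D\<close>-module \<open>M\<close>
  restricts to a \<open>C\<close>-module whose value at \<open>ob X i\<close> is the image of the \<open>i\<close>-th diagonal idempotent
  in \<open>M X\<close>, and a \<open>C\<close>-module \<open>N\<close> induces the \<open>D\<close>-module sending \<open>X\<close> to the sum of the \<open>N (ob X i)\<close>.

  Both claims are instances of this. As the action is free and \<open>G\<close> is finite, the norm \<open>F \<mapsto> \<Sum>r. r F\<close>
  identifies the coinvariants that form the morphism spaces of \<open>B = C/G\<close> with \<open>G\<close>-invariant matrices
  of morphisms of \<open>C\<close>, and composition in \<open>B\<close> with the matrix product. If rows and columns are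
  indexed by \<open>G\<close> via \<open>t \<mapsto> t\<inverse> x\<^sub>\<alpha>\<close>, the component of degree \<open>u\<close> consists of the matrices
  supported on the positions \<open>(s, t)\<close> with \<open>s t\<inverse> = u\<close>. An invariant matrix is determined by
  any of its columns, so taking the \<open>t\<close>-th column of the coefficient of \<open>\<delta> t\<close> presents
  \<open>B # k\<^sup>G\<close> by matrices over \<open>C\<close>. Likewise \<open>(B # k\<^sup>G) # kG\<close> is presented by matrices over \<open>B\<close>
  with rows and columns in \<open>G\<close>.
\<close>

section \<open>Modules\<close>

text \<open>Freeness of the action, not invertibility of |G| in k, makes the norm injective on
  coinvariants: G permutes the rows of a matrix simply transitively, so modulo the relations every
  row can be moved to one fixed row. The argument therefore works in every characteristic.

  Two obstacles shape the Morita part. Modules live in a fixed universe \<open>'v\<close>, while an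
  induced module consists of tuples of vectors. Only restriction is therefore made into a functor;
  it takes subspaces and stays inside \<open>'v\<close>. Induction is applied to objects alone, to
  show that restriction is essentially surjective, and its values are copied back into
  \<open>'v\<close>, which is possible because \<open>'v\<close> is infinite and the tuples are
  finite. Secondly, Morita equivalence includes the claim that both sides are k-categories, and for
  the smash categories this has to be proved. It is not derived from the axioms of a Hopf module
  category but read off the presentation: entries determine a morphism, so the axioms are inherited
  from matrix multiplication.\<close>

context abelian_monoid
begin

section \<open>Finite sums in abelian monoids\<close>

lemma finsum_single:
  assumes "finite A" "i \<in> A" "f i \<in> carrier G" "\<And>j. \<lbrakk>j \<in> A; j \<noteq> i\<rbrakk> \<Longrightarrow> f j = \<zero>"
  shows "(\<Oplus>j\<in>A. f j) = f i"
proof -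
  have "(\<Oplus>j\<in>A. f j) = (\<Oplus>j\<in>A. if i = j then f i else \<zero>)"
    using assms by (intro finsum_cong') auto
  then show ?thesis
    using finsum_singleton[of i A "\<lambda>_. f i"] assms by simp
qed

lemma finsum_swap:
  assumes "finite A" "finite B" "\<And>i j. \<lbrakk>i \<in> A; j \<in> B\<rbrakk> \<Longrightarrow> f i j \<in> carrier G"
  shows "(\<Oplus>i\<in>A. \<Oplus>j\<in>B. f i j) = (\<Oplus>j\<in>B. \<Oplus>i\<in>A. f i j)"
  using assms(1,3)
proof (induction A rule: finite_induct)
  case empty
  then show ?case by simp
next
  case (insert a A)
  have "(\<Oplus>i\<in>insert a A. \<Oplus>j\<in>B. f i j) = (\<Oplus>j\<in>B. f a j) \<oplus> (\<Oplus>j\<in>B. \<Oplus>i\<in>A. f i j)"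
    using insert by (subst finsum_insert) (auto intro!: finsum_closed)
  also have "\<dots> = (\<Oplus>j\<in>B. f a j \<oplus> (\<Oplus>i\<in>A. f i j))"
    using insert by (subst finsum_addf) (auto intro!: finsum_closed)
  also have "\<dots> = (\<Oplus>j\<in>B. \<Oplus>i\<in>insert a A. f i j)"
    using insert by (intro finsum_cong') (auto intro!: finsum_closed a_closed simp: Pi_def)
  finally show ?case .
qed

text \<open>The composite in a smash category is a fourfold sum over basis elements. The structure
  constants of \<open>kG\<close> and of its dual leave, for each \<open>b\<close>, at most one
  nonzero term; \<open>p\<close>, \<open>q\<close> and \<open>r\<close> name its position.\<close>

lemma finsum_collapse:
  assumes "finite A" and k: "\<And>b c d e. \<lbrakk>b \<in> A; c \<in> A; d \<in> A; e \<in> A\<rbrakk> \<Longrightarrow> k b c d e \<in> carrier G"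
    and pqr: "\<And>b. b \<in> A \<Longrightarrow> p b \<in> A \<and> q b \<in> A \<and> r b \<in> A"
    and 0: "\<And>b c d e. \<lbrakk>b \<in> A; c \<in> A; d \<in> A; e \<in> A; \<not> (c = p b \<and> d = q b \<and> e = r b)\<rbrakk> \<Longrightarrow> k b c d e = \<zero>"
  shows "(\<Oplus>b\<in>A. \<Oplus>c\<in>A. \<Oplus>d\<in>A. \<Oplus>e\<in>A. k b c d e) = (\<Oplus>b\<in>A. k b (p b) (q b) (r b))"
proof (rule finsum_cong'[OF refl])
  fix b assume b: "b \<in> A"
  note [simp] = conjunct1[OF pqr[OF b]] conjunct1[OF conjunct2[OF pqr[OF b]]]
      conjunct2[OF conjunct2[OF pqr[OF b]]]
    b assms(1) k
  have "(\<Oplus>c\<in>A. \<Oplus>d\<in>A. \<Oplus>e\<in>A. k b c d e) = (\<Oplus>d\<in>A. \<Oplus>e\<in>A. k b (p b) d e)"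
    by (rule finsum_single) (auto intro!: add.finprod_one_eqI 0)
  also have "\<dots> = (\<Oplus>e\<in>A. k b (p b) (q b) e)"
    by (rule finsum_single) (auto intro!: add.finprod_one_eqI 0)
  also have "\<dots> = k b (p b) (q b) (r b)"
    by (rule finsum_single) (auto intro!: 0)
  finally show "(\<Oplus>c\<in>A. \<Oplus>d\<in>A. \<Oplus>e\<in>A. k b c d e) = k b (p b) (q b) (r b)" .
qed (use k pqr in auto)

lemma finsum_bij:
  assumes "bij_betw h A B" "\<And>b. b \<in> B \<Longrightarrow> f b \<in> carrier G"
  shows "(\<Oplus>b\<in>B. f b) = (\<Oplus>a\<in>A. f (h a))"
  using assms finsum_reindex[of f h A] by (auto simp: bij_betw_def)

end

section \<open>Linear maps and constructions of vector spaces\<close>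

lemma linear_maps_closed: "f \<in> linear_maps K V W \<Longrightarrow> v \<in> carrier V \<Longrightarrow> f v \<in> carrier W"
  by (auto simp: linear_maps_def)

lemma linear_maps_add:
  "f \<in> linear_maps K V W \<Longrightarrow> u \<in> carrier V \<Longrightarrow> v \<in> carrier V \<Longrightarrow> f (u \<oplus>\<^bsub>V\<^esub> v) = f u \<oplus>\<^bsub>W\<^esub> f v"
  by (auto simp: linear_maps_def)

lemma linear_maps_smult:
  "f \<in> linear_maps K V W \<Longrightarrow> c \<in> carrier K \<Longrightarrow> v \<in> carrier V \<Longrightarrow> f (c \<odot>\<^bsub>V\<^esub> v) = c \<odot>\<^bsub>W\<^esub> f v"
  by (auto simp: linear_maps_def)

lemma linear_mapsI:
  assumes "\<And>v. v \<in> carrier V \<Longrightarrow> f v \<in> carrier W"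
    and "\<And>u v. \<lbrakk>u \<in> carrier V; v \<in> carrier V\<rbrakk> \<Longrightarrow> f (u \<oplus>\<^bsub>V\<^esub> v) = f u \<oplus>\<^bsub>W\<^esub> f v"
    and "\<And>c v. \<lbrakk>c \<in> carrier K; v \<in> carrier V\<rbrakk> \<Longrightarrow> f (c \<odot>\<^bsub>V\<^esub> v) = c \<odot>\<^bsub>W\<^esub> f v"
  shows "f \<in> linear_maps K V W"
  using assms by (auto simp: linear_maps_def)

lemma module_abelian_group: "module K V \<Longrightarrow> abelian_group V"
  by (simp add: module_def)

lemma module_abelian_monoid: "module K V \<Longrightarrow> abelian_monoid V"
  by (simp add: module_def abelian_group_def)

lemma linear_maps_zero:
  assumes "f \<in> linear_maps K V W" "abelian_group V" "abelian_group W"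
  shows "f \<zero>\<^bsub>V\<^esub> = \<zero>\<^bsub>W\<^esub>"
proof -
  interpret V: abelian_group V by fact
  interpret W: abelian_group W by fact
  have "f \<zero>\<^bsub>V\<^esub> \<oplus>\<^bsub>W\<^esub> f \<zero>\<^bsub>V\<^esub> = f \<zero>\<^bsub>V\<^esub>"
    using linear_maps_add[OF assms(1), of "\<zero>\<^bsub>V\<^esub>" "\<zero>\<^bsub>V\<^esub>"] by simp
  then show ?thesis
    using linear_maps_closed[OF assms(1), of "\<zero>\<^bsub>V\<^esub>"] by simp
qed

lemma linear_maps_finsum:
  assumes "f \<in> linear_maps K V W" "abelian_group V" "abelian_group W" "finite A"
    and "\<And>i. i \<in> A \<Longrightarrow> g i \<in> carrier V"
  shows "f (\<Oplus>\<^bsub>V\<^esub>i\<in>A. g i) = (\<Oplus>\<^bsub>W\<^esub>i\<in>A. f (g i))"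
proof -
  interpret V: abelian_group V by fact
  interpret W: abelian_group W by fact
  show ?thesis
    using assms(4,5)
  proof (induction A rule: finite_induct)
    case empty
    then show ?case using linear_maps_zero[OF assms(1-3)] by simp
  next
    case (insert a A)
    then show ?case
      using linear_maps_closed[OF assms(1)]
      by (simp add: Pi_def linear_maps_add[OF assms(1)])
  qed
qed

lemma linear_maps_neg:
  assumes f: "f \<in> linear_maps K V W" and V: "module K V" and W: "module K W" and v: "v \<in> carrier V"
  shows "f (\<ominus>\<^bsub>V\<^esub> v) = \<ominus>\<^bsub>W\<^esub> f v"
proof -
  interpret V: module K V by fact
  interpret W: module K W by fact
  have "f (\<ominus>\<^bsub>V\<^esub> v) \<oplus>\<^bsub>W\<^esub> f v = \<zero>\<^bsub>W\<^esub>"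
    using linear_maps_add[OF f, of "\<ominus>\<^bsub>V\<^esub> v" v] v
    by (simp add: V.l_neg linear_maps_zero[OF f V.abelian_group_axioms W.abelian_group_axioms])
  then show ?thesis
    using v by (intro W.minus_equality[symmetric]) (simp_all add: linear_maps_closed[OF f])
qed

lemma linear_maps_comp:
  assumes "f \<in> linear_maps K U V" "g \<in> linear_maps K V W"
  shows "(\<lambda>v. g (f v)) \<in> linear_maps K U W"
  using linear_maps_closed[OF assms(1)] linear_maps_closed[OF assms(2)] linear_maps_add[OF assms(1)]
    linear_maps_add[OF assms(2)] linear_maps_smult[OF assms(1)] linear_maps_smult[OF assms(2)]
  by (intro linear_mapsI) simp_all

lemma linear_maps_cong:
  assumes "f \<in> linear_maps K V W" "module K V" "\<And>v. v \<in> carrier V \<Longrightarrow> g v = f v"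
  shows "g \<in> linear_maps K V W"
proof -
  interpret module K V by fact
  show ?thesis
    using assms(1)
    by (intro linear_mapsI) (simp_all add: assms(3) linear_maps_closed linear_maps_add
        linear_maps_smult)
qed

lemma linear_maps_restrict:
  assumes "f \<in> linear_maps K V W" "module K V"
  shows "restrict f (carrier V) \<in> linear_maps K V W"
  using assms by (rule linear_maps_cong) simp

lemma linear_maps_sum:
  assumes "module K W" "finite A" and f: "\<And>i. i \<in> A \<Longrightarrow> f i \<in> linear_maps K V W"
  shows "(\<lambda>v. \<Oplus>\<^bsub>W\<^esub>i\<in>A. f i v) \<in> linear_maps K V W"
proof -
  interpret W: module K W by fact
  note c = linear_maps_closed[OF f]
  show ?thesis
  proof (rule linear_mapsI)
    show "(\<Oplus>\<^bsub>W\<^esub>i\<in>A. f i (u \<oplus>\<^bsub>V\<^esub> v)) = (\<Oplus>\<^bsub>W\<^esub>i\<in>A. f i u) \<oplus>\<^bsub>W\<^esub> (\<Oplus>\<^bsub>W\<^esub>i\<in>A. f i v)"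
      if "u \<in> carrier V" "v \<in> carrier V" for u v
      by (rule trans[OF W.finsum_cong'[OF refl] W.finsum_addf])
          (use that c in \<open>auto simp: linear_maps_add[OF f]\<close>)
    show "(\<Oplus>\<^bsub>W\<^esub>i\<in>A. f i (k \<odot>\<^bsub>V\<^esub> v)) = k \<odot>\<^bsub>W\<^esub> (\<Oplus>\<^bsub>W\<^esub>i\<in>A. f i v)"
      if "k \<in> carrier K" "v \<in> carrier V" for k v
      by (rule trans[OF W.finsum_cong'[OF refl] W.finsum_smult_ldistr[symmetric]])
        (use that c assms(2) in \<open>auto simp: linear_maps_smult[OF f]\<close>)
  qed (use c in auto)
qed

text \<open>Meant for the family of norm maps: their joint kernel is a submodule, hence one of those
  whose intersection defines the coinvariant relations.\<close>

lemma submodule_kernel: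
  assumes V: "module K V" and W: "\<And>i. i \<in> I \<Longrightarrow> module K (W i)"
    and f: "\<And>i. i \<in> I \<Longrightarrow> f i \<in> linear_maps K V (W i)"
  shows "submodule {v \<in> carrier V. \<forall>i\<in>I. f i v = \<zero>\<^bsub>W i\<^esub>} K V"
proof -
  interpret V: module K V by fact
  note AG = module_abelian_group[OF W]
  have AM: "abelian_monoid (W i)" if "i \<in> I" for i using AG[OF that] by (simp add: abelian_group_def)
  have "\<ominus>\<^bsub>W i\<^esub> \<zero>\<^bsub>W i\<^esub> = \<zero>\<^bsub>W i\<^esub>" if "i \<in> I" for i
  proof -
    interpret W: abelian_group "W i" by (rule AG[OF that])
    show ?thesis by simp
  qed
  then show ?thesis
    by (intro V.submoduleI)
      (auto simp: linear_maps_zero[OF f V.abelian_group_axioms AG] linear_maps_neg[OF f V W]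
          linear_maps_add[OF f]
        linear_maps_smult[OF f] abelian_monoid.l_zero[OF AM] abelian_monoid.zero_closed[OF AM]
        module.smult_r_null[OF W])
qed

text \<open>Direct sums, spaces of linear maps and spaces of natural transformations all carry
  pointwise operations, so the axioms hold index by index and closure is what has to be supplied.
  Negatives arise as multiples by -1, and membership in the extensional product turns pointwise
  equality into equality.\<close>

lemma module_pointwise:
  fixes W :: "('k, 'i \<Rightarrow> 'v) module"
  assumes K: "cring K"
    and V: "\<And>i. i \<in> I \<Longrightarrow> module K (V i)"
    and sub: "carrier W \<subseteq> (\<Pi>\<^sub>E i\<in>I. carrier (V i))"
    and zero: "zero W = (\<lambda>i\<in>I. \<zero>\<^bsub>V i\<^esub>)"
    and add: "add W = (\<lambda>f g. \<lambda>i\<in>I. f i \<oplus>\<^bsub>V i\<^esub> g i)"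
    and smult: "smult W = (\<lambda>c f. \<lambda>i\<in>I. c \<odot>\<^bsub>V i\<^esub> f i)"
    and zero_closed: "\<zero>\<^bsub>W\<^esub> \<in> carrier W"
    and add_closed: "\<And>f g. \<lbrakk>f \<in> carrier W; g \<in> carrier W\<rbrakk> \<Longrightarrow> f \<oplus>\<^bsub>W\<^esub> g \<in> carrier W"
    and smult_closed: "\<And>c f. \<lbrakk>c \<in> carrier K; f \<in> carrier W\<rbrakk> \<Longrightarrow> c \<odot>\<^bsub>W\<^esub> f \<in> carrier W"
  shows "module K W"
proof -
  interpret K: cring K by fact
  have ext: "f = g" if "f \<in> carrier W" "g \<in> carrier W" "\<And>i. i \<in> I \<Longrightarrow> f i = g i" for f g
    using that sub by (intro PiE_ext[of f I "\<lambda>i. carrier (V i)" g]) auto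
  have pt: "f i \<in> carrier (V i)" if "f \<in> carrier W" "i \<in> I" for f i
    using that sub by auto
  note AG = module_abelian_group[OF V]
  have AM: "\<And>i. i \<in> I \<Longrightarrow> abelian_monoid (V i)"
    using AG by (simp add: abelian_group_def)
  show ?thesis
  proof (rule moduleI)
    show "abelian_group W"
    proof (rule abelian_groupI)
      fix f assume f: "f \<in> carrier W"
      have m1: "\<ominus>\<^bsub>K\<^esub> \<one>\<^bsub>K\<^esub> \<in> carrier K" by simp
      have "(\<ominus>\<^bsub>K\<^esub> \<one>\<^bsub>K\<^esub>) \<odot>\<^bsub>W\<^esub> f \<oplus>\<^bsub>W\<^esub> f = \<zero>\<^bsub>W\<^esub>"
      proof (rule ext)
        fix i assume i: "i \<in> I"
        interpret Vi: module K "V i" using V i by simp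
        show "((\<ominus>\<^bsub>K\<^esub> \<one>\<^bsub>K\<^esub>) \<odot>\<^bsub>W\<^esub> f \<oplus>\<^bsub>W\<^esub> f) i = \<zero>\<^bsub>W\<^esub> i"
          using i pt[OF f i] by (simp add: zero add smult Vi.smult_l_minus Vi.l_neg)
      qed (use f m1 in \<open>auto intro!: add_closed smult_closed zero_closed\<close>)
      then show "\<exists>g\<in>carrier W. g \<oplus>\<^bsub>W\<^esub> f = \<zero>\<^bsub>W\<^esub>"
        using smult_closed[OF m1 f] by blast
    next
      fix f g h assume *: "f \<in> carrier W" "g \<in> carrier W" "h \<in> carrier W"
      show "f \<oplus>\<^bsub>W\<^esub> g \<oplus>\<^bsub>W\<^esub> h = f \<oplus>\<^bsub>W\<^esub> (g \<oplus>\<^bsub>W\<^esub> h)"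
        using * by (intro ext add_closed smult_closed zero_closed K.add.m_closed K.m_closed
            K.one_closed) (auto simp: add pt abelian_monoid.a_assoc[OF AM])
      show "f \<oplus>\<^bsub>W\<^esub> g = g \<oplus>\<^bsub>W\<^esub> f"
        using * by (intro ext add_closed smult_closed zero_closed K.add.m_closed K.m_closed
            K.one_closed) (auto simp: add pt abelian_monoid.a_comm[OF AM])
      show "\<zero>\<^bsub>W\<^esub> \<oplus>\<^bsub>W\<^esub> f = f"
        using * by (intro ext add_closed smult_closed zero_closed K.add.m_closed K.m_closed
            K.one_closed) (auto simp: add zero pt abelian_monoid.l_zero[OF AM])
    qed (use add_closed zero_closed in auto)
  next
    fix a b f assume *: "a \<in> carrier K" "b \<in> carrier K" "f \<in> carrier W"
    show "(a \<oplus>\<^bsub>K\<^esub> b) \<odot>\<^bsub>W\<^esub> f = a \<odot>\<^bsub>W\<^esub> f \<oplus>\<^bsub>W\<^esub> b \<odot>\<^bsub>W\<^esub> f"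
      using * by (intro ext add_closed smult_closed zero_closed K.add.m_closed K.m_closed K.one_closed)
          (auto simp: add smult pt module.smult_l_distr[OF V])
    show "(a \<otimes>\<^bsub>K\<^esub> b) \<odot>\<^bsub>W\<^esub> f = a \<odot>\<^bsub>W\<^esub> (b \<odot>\<^bsub>W\<^esub> f)"
      using * by (intro ext add_closed smult_closed zero_closed K.add.m_closed K.m_closed K.one_closed)
          (auto simp: add smult pt module.smult_assoc1[OF V])
  next
    fix a f g assume *: "a \<in> carrier K" "f \<in> carrier W" "g \<in> carrier W"
    show "a \<odot>\<^bsub>W\<^esub> (f \<oplus>\<^bsub>W\<^esub> g) = a \<odot>\<^bsub>W\<^esub> f \<oplus>\<^bsub>W\<^esub> a \<odot>\<^bsub>W\<^esub> g"
      using * by (intro ext add_closed smult_closed zero_closed K.add.m_closed K.m_closed K.one_closed)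
          (auto simp: add smult pt module.smult_r_distr[OF V])
  next
    fix f assume *: "f \<in> carrier W"
    show "\<one>\<^bsub>K\<^esub> \<odot>\<^bsub>W\<^esub> f = f"
      using * by (intro ext add_closed smult_closed zero_closed K.add.m_closed K.m_closed K.one_closed)
          (auto simp: smult pt module.smult_one[OF V])
  qed (use K smult_closed in auto)
qed

text \<open>\<open>W\<close> is a bare record here: its axioms are pushed forward along the
  surjection \<open>h\<close>. Both the quotient by a submodule and the transport of structure along
  an injective encoding arise in this way.\<close>

lemma module_surj_image:
  fixes V :: "('k, 'v) module" and W :: "('k, 'w) module"
  assumes V: "module K V"
    and img: "carrier W = h ` carrier V"
    and zero: "h \<zero>\<^bsub>V\<^esub> = \<zero>\<^bsub>W\<^esub>"
    and add: "\<And>u v. \<lbrakk>u \<in> carrier V; v \<in> carrier V\<rbrakk> \<Longrightarrow> h u \<oplus>\<^bsub>W\<^esub> h v = h (u \<oplus>\<^bsub>V\<^esub> v)"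
    and smult: "\<And>c v. \<lbrakk>c \<in> carrier K; v \<in> carrier V\<rbrakk> \<Longrightarrow> c \<odot>\<^bsub>W\<^esub> h v = h (c \<odot>\<^bsub>V\<^esub> v)"
  shows "module K W"
proof -
  interpret V: module K V by fact
  show ?thesis
  proof (rule moduleI)
    show "cring K" by (rule V.is_cring)
    show "abelian_group W"
    proof (rule abelian_groupI)
      fix a assume "a \<in> carrier W"
      then obtain v where v: "v \<in> carrier V" "a = h v" by (auto simp: img)
      have "h (\<ominus>\<^bsub>V\<^esub> v) \<oplus>\<^bsub>W\<^esub> a = \<zero>\<^bsub>W\<^esub>"
        using v by (simp add: add V.l_neg zero)
      then show "\<exists>b\<in>carrier W. b \<oplus>\<^bsub>W\<^esub> a = \<zero>\<^bsub>W\<^esub>"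
        using v by (auto simp: img)
      show "\<zero>\<^bsub>W\<^esub> \<oplus>\<^bsub>W\<^esub> a = a"
        using v add[of "\<zero>\<^bsub>V\<^esub>" v] by (simp add: zero)
    next
      show "\<zero>\<^bsub>W\<^esub> \<in> carrier W" unfolding img zero[symmetric] by simp
    qed (auto simp: img add V.a_ac)
  qed (auto simp: img add smult V.smult_l_distr V.smult_r_distr V.smult_assoc1)
qed

section \<open>Direct sums and quotient spaces\<close>

lemma direct_sum_simps:
  "carrier (direct_sum I V) = {f \<in> (\<Pi>\<^sub>E i\<in>I. carrier (V i)). finite {i \<in> I. f i \<noteq> \<zero>\<^bsub>V i\<^esub>}}"
  "\<zero>\<^bsub>direct_sum I V\<^esub> = (\<lambda>i\<in>I. \<zero>\<^bsub>V i\<^esub>)"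
  "f \<oplus>\<^bsub>direct_sum I V\<^esub> g = (\<lambda>i\<in>I. f i \<oplus>\<^bsub>V i\<^esub> g i)"
  "c \<odot>\<^bsub>direct_sum I V\<^esub> f = (\<lambda>i\<in>I. c \<odot>\<^bsub>V i\<^esub> f i)"
  by (simp_all add: direct_sum_def)

lemma carrier_direct_sum_finite:
  "finite I \<Longrightarrow> carrier (direct_sum I V) = (\<Pi>\<^sub>E i\<in>I. carrier (V i))"
  by (auto simp: direct_sum_simps)

lemma direct_sum_module:
  assumes "cring K" "finite I" "\<And>i. i \<in> I \<Longrightarrow> module K (V i)"
  shows "module K (direct_sum I V)"
proof (rule module_pointwise[of K I V])
  note AM = module_abelian_monoid[OF assms(3)]
  show "\<zero>\<^bsub>direct_sum I V\<^esub> \<in> carrier (direct_sum I V)"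
    using assms(2) by (auto simp: carrier_direct_sum_finite direct_sum_simps(2)
        abelian_monoid.zero_closed[OF AM])
  show "f \<oplus>\<^bsub>direct_sum I V\<^esub> g \<in> carrier (direct_sum I V)"
    if "f \<in> carrier (direct_sum I V)" "g \<in> carrier (direct_sum I V)" for f g
    using assms(2) that
    by (auto simp: carrier_direct_sum_finite direct_sum_simps(3) intro!: abelian_monoid.a_closed[OF AM])
  show "c \<odot>\<^bsub>direct_sum I V\<^esub> f \<in> carrier (direct_sum I V)"
    if "c \<in> carrier K" "f \<in> carrier (direct_sum I V)" for c f
    using assms(2) that
    by (auto simp: carrier_direct_sum_finite direct_sum_simps(4) intro!:
        module.smult_closed[OF assms(3)])
qed (use assms in \<open>auto simp: direct_sum_def\<close>)

lemma direct_sum_proj_linear: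
  "i \<in> I \<Longrightarrow> (\<lambda>f. f i) \<in> linear_maps K (direct_sum I V) (V i)"
  by (rule linear_mapsI) (auto simp: direct_sum_simps)

lemma direct_sum_tuple_linear:
  assumes "finite I" "\<And>i. i \<in> I \<Longrightarrow> f i \<in> linear_maps K U (V i)"
  shows "(\<lambda>u. \<lambda>i\<in>I. f i u) \<in> linear_maps K U (direct_sum I V)"
  using assms(1)
  by (intro linear_mapsI)
    (auto simp: carrier_direct_sum_finite linear_maps_closed[OF assms(2)] direct_sum_simps(3,4)
      linear_maps_add[OF assms(2)] linear_maps_smult[OF assms(2)])

lemma quotient_module_module:
  fixes V :: "('k, 'v) module"
  assumes V: "module K V" and N: "submodule N K V"
  shows "module K (quotient_module V N)"
    and "(\<lambda>v. N +>\<^bsub>V\<^esub> v) \<in> linear_maps K V (quotient_module V N)"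
    and "carrier (quotient_module V N) = (\<lambda>v. N +>\<^bsub>V\<^esub> v) ` carrier V"
proof -
  interpret V: module K V by fact
  interpret N: submodule N K V by fact
  have "additive_subgroup N V"
    using N.subgroup_axioms by (simp add: additive_subgroup_def)
  then interpret A: abelian_subgroup N V
    using V.abelian_group_axioms by (rule abelian_subgroupI3)
  show img: "carrier (quotient_module V N) = (\<lambda>v. N +>\<^bsub>V\<^esub> v) ` carrier V"
    by (auto simp: quotient_module_def A_RCOSETS_def')
  have zero: "N +>\<^bsub>V\<^esub> \<zero>\<^bsub>V\<^esub> = \<zero>\<^bsub>quotient_module V N\<^esub>"
    using V.a_coset_join2[OF V.zero_closed A.a_subgroup] A.zero_closed by
        (simp add: quotient_module_def)
  have add: "(N +>\<^bsub>V\<^esub> u) \<oplus>\<^bsub>quotient_module V N\<^esub> (N +>\<^bsub>V\<^esub> v) = N +>\<^bsub>V\<^esub> (u \<oplus>\<^bsub>V\<^esub> v)"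
    if "u \<in> carrier V" "v \<in> carrier V" for u v
    using that by (simp add: quotient_module_def A.a_rcos_sum)
  have smult: "c \<odot>\<^bsub>quotient_module V N\<^esub> (N +>\<^bsub>V\<^esub> v) = N +>\<^bsub>V\<^esub> (c \<odot>\<^bsub>V\<^esub> v)"
    if c: "c \<in> carrier K" and v: "v \<in> carrier V" for c v
  proof -
    \<comment> \<open>Scalar multiplication of cosets is defined as a union over all
      representatives, so the coset of \<open>c a\<close> must not depend on the representative
      \<open>a\<close>. As a coset is nonempty, the union is then this common coset.\<close>
    have "N +>\<^bsub>V\<^esub> (c \<odot>\<^bsub>V\<^esub> a) = N +>\<^bsub>V\<^esub> (c \<odot>\<^bsub>V\<^esub> v)" if a: "a \<in> N +>\<^bsub>V\<^esub> v" for a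
    proof -
      obtain n where n: "n \<in> N" "a = n \<oplus>\<^bsub>V\<^esub> v"
        using a by (auto simp: a_r_coset_def')
      have nV: "n \<in> carrier V" using n A.a_subset by auto
      have "c \<odot>\<^bsub>V\<^esub> a = c \<odot>\<^bsub>V\<^esub> n \<oplus>\<^bsub>V\<^esub> c \<odot>\<^bsub>V\<^esub> v"
        using n nV c v by (simp add: V.smult_r_distr)
      moreover have "c \<odot>\<^bsub>V\<^esub> n \<in> N" using N.smult_closed c n by blast
      ultimately have "c \<odot>\<^bsub>V\<^esub> a \<in> N +>\<^bsub>V\<^esub> (c \<odot>\<^bsub>V\<^esub> v)"
        using c v A.a_subset V.a_rcosI[of "c \<odot>\<^bsub>V\<^esub> n" N "c \<odot>\<^bsub>V\<^esub> v"] by simp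
      then show ?thesis
        using A.a_repr_independence'[of "c \<odot>\<^bsub>V\<^esub> a" "c \<odot>\<^bsub>V\<^esub> v"] c v by simp
    qed
    moreover have "v \<in> N +>\<^bsub>V\<^esub> v" using A.a_rcos_self[OF v] .
    ultimately have "(\<Union>a\<in>N +>\<^bsub>V\<^esub> v. N +>\<^bsub>V\<^esub> (c \<odot>\<^bsub>V\<^esub> a)) = N +>\<^bsub>V\<^esub> (c \<odot>\<^bsub>V\<^esub> v)"
      by (intro UN_constant_eq ballI)
    then show ?thesis by (simp add: quotient_module_def)
  qed
  show "module K (quotient_module V N)"
    by (rule module_surj_image[OF V img zero add smult])
  show "(\<lambda>v. N +>\<^bsub>V\<^esub> v) \<in> linear_maps K V (quotient_module V N)"
    by (rule linear_mapsI) (auto simp: add smult img)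
qed

section \<open>Linear categories and functor categories\<close>

context k_category
begin

lemma Mor_ag: "\<lbrakk>x \<in> Obj C; y \<in> Obj C\<rbrakk> \<Longrightarrow> abelian_group (Mor C y x)"
  using Mor_module module_abelian_group by blast

lemma Mor_am: "\<lbrakk>x \<in> Obj C; y \<in> Obj C\<rbrakk> \<Longrightarrow> abelian_monoid (Mor C y x)"
  using Mor_module module_abelian_monoid by blast

lemma Mor_zero: "\<lbrakk>x \<in> Obj C; y \<in> Obj C\<rbrakk> \<Longrightarrow> \<zero>\<^bsub>Mor C y x\<^esub> \<in> carrier (Mor C y x)"
  using Mor_am abelian_monoid.zero_closed by blast

lemma Mor_add: "\<lbrakk>x \<in> Obj C; y \<in> Obj C; f \<in> carrier (Mor C y x); g \<in> carrier (Mor C y x)\<rbrakk>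
    \<Longrightarrow> f \<oplus>\<^bsub>Mor C y x\<^esub> g \<in> carrier (Mor C y x)"
  using Mor_am abelian_monoid.a_closed by metis

lemma Mor_smult: "\<lbrakk>x \<in> Obj C; y \<in> Obj C; c \<in> carrier K; g \<in> carrier (Mor C y x)\<rbrakk>
    \<Longrightarrow> c \<odot>\<^bsub>Mor C y x\<^esub> g \<in> carrier (Mor C y x)"
  using Mor_module module.smult_closed by metis

lemma Mor_finsum: "\<lbrakk>x \<in> Obj C; y \<in> Obj C; \<And>i. i \<in> A \<Longrightarrow> f i \<in> carrier (Mor C y x)\<rbrakk>
    \<Longrightarrow> (\<Oplus>\<^bsub>Mor C y x\<^esub>i\<in>A. f i) \<in> carrier (Mor C y x)"
  by (rule abelian_monoid.finsum_closed[OF Mor_am]) auto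

lemma Cmp_closed: "\<lbrakk>x \<in> Obj C; y \<in> Obj C; z \<in> Obj C; g \<in> carrier (Mor C z y);
    f \<in> carrier (Mor C y x)\<rbrakk> \<Longrightarrow> Cmp C z y x g f \<in> carrier (Mor C z x)"
  using Cmp_linear_left linear_maps_closed by fast

lemma Cmp_add_left: "\<lbrakk>x \<in> Obj C; y \<in> Obj C; z \<in> Obj C; g \<in> carrier (Mor C z y);
    g' \<in> carrier (Mor C z y); f \<in> carrier (Mor C y x)\<rbrakk>
    \<Longrightarrow> Cmp C z y x (g \<oplus>\<^bsub>Mor C z y\<^esub> g') f = Cmp C z y x g f \<oplus>\<^bsub>Mor C z x\<^esub> Cmp C z y x g' f"
  using linear_maps_add[OF Cmp_linear_left] by fast

lemma Cmp_add_right: "\<lbrakk>x \<in> Obj C; y \<in> Obj C; z \<in> Obj C; g \<in> carrier (Mor C z y);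
    f \<in> carrier (Mor C y x); f' \<in> carrier (Mor C y x)\<rbrakk>
    \<Longrightarrow> Cmp C z y x g (f \<oplus>\<^bsub>Mor C y x\<^esub> f') = Cmp C z y x g f \<oplus>\<^bsub>Mor C z x\<^esub> Cmp C z y x g f'"
  using linear_maps_add[OF Cmp_linear_right] by fast

lemma Cmp_smult_left: "\<lbrakk>x \<in> Obj C; y \<in> Obj C; z \<in> Obj C; c \<in> carrier K; g \<in> carrier (Mor C z y);
    f \<in> carrier (Mor C y x)\<rbrakk>
    \<Longrightarrow> Cmp C z y x (c \<odot>\<^bsub>Mor C z y\<^esub> g) f = c \<odot>\<^bsub>Mor C z x\<^esub> Cmp C z y x g f"
  using linear_maps_smult[OF Cmp_linear_left] by fast

lemma Cmp_smult_right: "\<lbrakk>x \<in> Obj C; y \<in> Obj C; z \<in> Obj C; c \<in> carrier K; g \<in> carrier (Mor C z y);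
    f \<in> carrier (Mor C y x)\<rbrakk>
    \<Longrightarrow> Cmp C z y x g (c \<odot>\<^bsub>Mor C y x\<^esub> f) = c \<odot>\<^bsub>Mor C z x\<^esub> Cmp C z y x g f"
  using linear_maps_smult[OF Cmp_linear_right] by fast

lemma Cmp_zero_left: "\<lbrakk>x \<in> Obj C; y \<in> Obj C; z \<in> Obj C; f \<in> carrier (Mor C y x)\<rbrakk>
    \<Longrightarrow> Cmp C z y x \<zero>\<^bsub>Mor C z y\<^esub> f = \<zero>\<^bsub>Mor C z x\<^esub>"
  using linear_maps_zero[OF Cmp_linear_left] Mor_ag by meson

lemma Cmp_zero_right: "\<lbrakk>x \<in> Obj C; y \<in> Obj C; z \<in> Obj C; g \<in> carrier (Mor C z y)\<rbrakk>
    \<Longrightarrow> Cmp C z y x g \<zero>\<^bsub>Mor C y x\<^esub> = \<zero>\<^bsub>Mor C z x\<^esub>"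
  using linear_maps_zero[OF Cmp_linear_right] Mor_ag by meson

lemma Cmp_finsum_left: "\<lbrakk>x \<in> Obj C; y \<in> Obj C; z \<in> Obj C; finite A;
    \<And>i. i \<in> A \<Longrightarrow> g i \<in> carrier (Mor C z y); f \<in> carrier (Mor C y x)\<rbrakk>
    \<Longrightarrow> Cmp C z y x (\<Oplus>\<^bsub>Mor C z y\<^esub>i\<in>A. g i) f = (\<Oplus>\<^bsub>Mor C z x\<^esub>i\<in>A. Cmp C z y x (g i) f)"
  using linear_maps_finsum[OF Cmp_linear_left Mor_ag Mor_ag, of x y z f A g] by auto

lemma Cmp_finsum_right: "\<lbrakk>x \<in> Obj C; y \<in> Obj C; z \<in> Obj C; finite A;
    \<And>i. i \<in> A \<Longrightarrow> f i \<in> carrier (Mor C y x); g \<in> carrier (Mor C z y)\<rbrakk>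
    \<Longrightarrow> Cmp C z y x g (\<Oplus>\<^bsub>Mor C y x\<^esub>i\<in>A. f i) = (\<Oplus>\<^bsub>Mor C z x\<^esub>i\<in>A. Cmp C z y x g (f i))"
  using linear_maps_finsum[OF Cmp_linear_right Mor_ag Mor_ag, of x y z g A f] by auto

end

section \<open>Functors into a linear category\<close>

lemma k_functorD:
  assumes "k_functor K C D F"
  shows "x \<in> Obj C \<Longrightarrow> FObj F x \<in> Obj D"
    and "\<lbrakk>x \<in> Obj C; y \<in> Obj C\<rbrakk> \<Longrightarrow> FMor F y x \<in> linear_maps K (Mor C y x) (Mor D (FObj F y) (FObj F x))"
    and "x \<in> Obj C \<Longrightarrow> FMor F x x (Idt C x) = Idt D (FObj F x)"
    and "\<lbrakk>x \<in> Obj C; y \<in> Obj C; z \<in> Obj C; g \<in> carrier (Mor C z y); f \<in> carrier (Mor C y x)\<rbrakk>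
      \<Longrightarrow> FMor F z x (Cmp C z y x g f) =
          Cmp D (FObj F z) (FObj F y) (FObj F x) (FMor F z y g) (FMor F y x f)"
    and "\<lbrakk>x \<in> Obj C; y \<in> Obj C; f \<in> carrier (Mor C y x)\<rbrakk>
      \<Longrightarrow> FMor F y x f \<in> carrier (Mor D (FObj F y) (FObj F x))"
  using assms unfolding k_functor_def by (auto intro: linear_maps_closed)

lemma functor_category_simps:
  "Obj (functor_category K C D) = {F. k_functor K C D F}"
  "carrier (Mor (functor_category K C D) E F) = natural_transformations C D F E"
  "\<zero>\<^bsub>Mor (functor_category K C D) E F\<^esub> = (\<lambda>x\<in>Obj C. \<zero>\<^bsub>Mor D (FObj E x) (FObj F x)\<^esub>)"
  "\<sigma> \<oplus>\<^bsub>Mor (functor_category K C D) E F\<^esub> \<tau> = (\<lambda>x\<in>Obj C. \<sigma> x \<oplus>\<^bsub>Mor D (FObj E x) (FObj F x)\<^esub> \<tau> x)"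
  "c \<odot>\<^bsub>Mor (functor_category K C D) E F\<^esub> \<tau> = (\<lambda>x\<in>Obj C. c \<odot>\<^bsub>Mor D (FObj E x) (FObj F x)\<^esub> \<tau> x)"
  "Cmp (functor_category K C D) H E F \<sigma> \<tau> =
     (\<lambda>x\<in>Obj C. Cmp D (FObj H x) (FObj E x) (FObj F x) (\<sigma> x) (\<tau> x))"
  "Idt (functor_category K C D) F = (\<lambda>x\<in>Obj C. Idt D (FObj F x))"
  by (simp_all add: functor_category_def)

lemma natural_transformationsD:
  assumes "\<tau> \<in> natural_transformations C D F E"
  shows "x \<in> Obj C \<Longrightarrow> \<tau> x \<in> carrier (Mor D (FObj E x) (FObj F x))"
    and "\<lbrakk>x \<in> Obj C; y \<in> Obj C; f \<in> carrier (Mor C y x)\<rbrakk>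
      \<Longrightarrow> Cmp D (FObj E y) (FObj F y) (FObj F x) (\<tau> y) (FMor F y x f) =
          Cmp D (FObj E y) (FObj E x) (FObj F x) (FMor E y x f) (\<tau> x)"
  using assms unfolding natural_transformations_def by auto

lemma natural_transformations_eqI:
  assumes "\<sigma> \<in> natural_transformations C D F E" "\<tau> \<in> natural_transformations C D F E"
    and "\<And>x. x \<in> Obj C \<Longrightarrow> \<sigma> x = \<tau> x"
  shows "\<sigma> = \<tau>"
  using assms unfolding natural_transformations_def
  by (intro PiE_ext[of \<sigma> "Obj C" _ \<tau>]) auto

lemma natural_transformationsI:
  assumes "\<tau> \<in> extensional (Obj C)"
    and "\<And>x. x \<in> Obj C \<Longrightarrow> \<tau> x \<in> carrier (Mor D (FObj E x) (FObj F x))"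
    and "\<And>x y f. \<lbrakk>x \<in> Obj C; y \<in> Obj C; f \<in> carrier (Mor C y x)\<rbrakk>
      \<Longrightarrow> Cmp D (FObj E y) (FObj F y) (FObj F x) (\<tau> y) (FMor F y x f) =
          Cmp D (FObj E y) (FObj E x) (FObj F x) (FMor E y x f) (\<tau> x)"
  shows "\<tau> \<in> natural_transformations C D F E"
  using assms unfolding natural_transformations_def by (auto simp: PiE_def)

text \<open>The axioms are inherited objectwise from \<open>D\<close>; what needs proof is that
  composites, sums, multiples, zeros and identities are again natural.\<close>

lemma functor_category_k_category:
  fixes C :: "('k, 'o, 'm) kcat" and D :: "('k, 'p, 'n) kcat"
  assumes "k_category K D"
  shows "k_category K (functor_category K C D)"
proof -
  interpret D: k_category K D by fact
  let ?N = "natural_transformations C D"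
  have obj: "FObj F x \<in> Obj D" if "k_functor K C D F" "x \<in> Obj C" for F x
    using k_functorD(1) that by metis
  note fm = k_functorD(5)
  note nt = natural_transformationsD
  have cmp: "(\<lambda>x\<in>Obj C. Cmp D (FObj H x) (FObj E x) (FObj F x) (\<sigma> x) (\<tau> x)) \<in> ?N F H"
    if H: "k_functor K C D H" and E: "k_functor K C D E" and F: "k_functor K C D F"
      and \<sigma>: "\<sigma> \<in> ?N E H" and \<tau>: "\<tau> \<in> ?N F E" for H E F \<sigma> \<tau>
  proof (rule natural_transformationsI)
    fix x y f assume x: "x \<in> Obj C" and y: "y \<in> Obj C" and f: "f \<in> carrier (Mor C y x)"
    note [simp] = obj[OF H] obj[OF E] obj[OF F] x y f fm[OF H] fm[OF E] fm[OF F] nt(1)[OF \<sigma>] nt(1)[OF \<tau>]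
    have "Cmp D (FObj H y) (FObj F y) (FObj F x) (Cmp D (FObj H y) (FObj E y) (FObj F y) (\<sigma> y) (\<tau> y))
        (FMor F y x f)
      = Cmp D (FObj H y) (FObj E y) (FObj F x) (\<sigma> y)
          (Cmp D (FObj E y) (FObj F y) (FObj F x) (\<tau> y) (FMor F y x f))"
      by (simp add: D.Cmp_assoc)
    also have "\<dots> = Cmp D (FObj H y) (FObj E x) (FObj F x)
        (Cmp D (FObj H y) (FObj E y) (FObj E x) (\<sigma> y) (FMor E y x f)) (\<tau> x)"
      by (simp add: nt(2)[OF \<tau>] D.Cmp_assoc)
    also have "\<dots> = Cmp D (FObj H y) (FObj H x) (FObj F x) (FMor H y x f)
        (Cmp D (FObj H x) (FObj E x) (FObj F x) (\<sigma> x) (\<tau> x))"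
      by (simp add: nt(2)[OF \<sigma>] D.Cmp_assoc)
    finally show "Cmp D (FObj H y) (FObj F y) (FObj F x)
        ((\<lambda>x\<in>Obj C. Cmp D (FObj H x) (FObj E x) (FObj F x) (\<sigma> x) (\<tau> x)) y) (FMor F y x f)
      = Cmp D (FObj H y) (FObj H x) (FObj F x) (FMor H y x f)
          ((\<lambda>x\<in>Obj C. Cmp D (FObj H x) (FObj E x) (FObj F x) (\<sigma> x) (\<tau> x)) x)"
      by simp
  qed (use H E F in \<open>auto simp: D.Cmp_closed obj nt(1)[OF \<sigma>] nt(1)[OF \<tau>]\<close>)
  have add: "(\<lambda>x\<in>Obj C. \<sigma> x \<oplus>\<^bsub>Mor D (FObj E x) (FObj F x)\<^esub> \<tau> x) \<in> ?N F E"
    if E: "k_functor K C D E" and F: "k_functor K C D F" and \<sigma>: "\<sigma> \<in> ?N F E" and \<tau>: "\<tau> \<in> ?N F E" for E F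
        \<sigma> \<tau>
    by (rule natural_transformationsI)
      (auto simp: D.Mor_add D.Cmp_add_left D.Cmp_add_right obj[OF E] obj[OF F] fm[OF E] fm[OF F]
          nt[OF \<sigma>] nt[OF \<tau>])
  have smult: "(\<lambda>x\<in>Obj C. c \<odot>\<^bsub>Mor D (FObj E x) (FObj F x)\<^esub> \<tau> x) \<in> ?N F E"
    if c: "c \<in> carrier K" and E: "k_functor K C D E" and F: "k_functor K C D F" and \<tau>: "\<tau> \<in> ?N F E" for
        c E F \<tau>
    by (rule natural_transformationsI)
      (auto simp: D.Mor_smult D.Cmp_smult_left D.Cmp_smult_right obj[OF E] obj[OF F] fm[OF E] fm[OF F]
          nt[OF \<tau>] c)
  have zero: "(\<lambda>x\<in>Obj C. \<zero>\<^bsub>Mor D (FObj E x) (FObj F x)\<^esub>) \<in> ?N F E"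
    if E: "k_functor K C D E" and F: "k_functor K C D F" for E F
    by (rule natural_transformationsI)
      (auto simp: D.Mor_zero D.Cmp_zero_left D.Cmp_zero_right obj[OF E] obj[OF F] fm[OF E] fm[OF F])
  have idt: "(\<lambda>x\<in>Obj C. Idt D (FObj F x)) \<in> ?N F F"
    if F: "k_functor K C D F" for F
    by (rule natural_transformationsI)
      (auto simp: D.Idt_closed D.Idt_left D.Idt_right obj[OF F] fm[OF F])
  have md: "module K (Mor (functor_category K C D) E F)" if E: "k_functor K C D E" and F: "k_functor K C
      D F" for E F
  proof (rule module_pointwise[of K "Obj C" "\<lambda>x. Mor D (FObj E x) (FObj F x)"])
    show "cring K" by (rule D.is_cring)
    show "carrier (Mor (functor_category K C D) E F) \<subseteq>
        (\<Pi>\<^sub>E x\<in>Obj C. carrier (Mor D (FObj E x) (FObj F x)))"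
      by (auto simp: functor_category_simps natural_transformations_def)
  qed (use E F in \<open>auto simp: functor_category_simps zero add smult D.Mor_module obj\<close>,
      auto simp: functor_category_def)
  show ?thesis
  proof (rule k_category.intro[OF D.field_axioms k_category_axioms.intro], goal_cases)
    case (1 F E)
    then show ?case by (simp add: md functor_category_simps)
  next
    case (2 F E H g)
    then show ?case
      by (intro linear_mapsI)
        (auto simp: functor_category_simps cmp D.Cmp_add_right D.Cmp_smult_right obj nt(1) intro!:
            restrict_ext)
  next
    case (3 F E H f)
    then show ?case
      by (intro linear_mapsI)
        (auto simp: functor_category_simps cmp D.Cmp_add_left D.Cmp_smult_left obj nt(1) intro!:
            restrict_ext)
  next
    case (4 w x y z h g f)
    then show ?case
      by (auto simp: functor_category_simps D.Cmp_assoc obj nt(1) intro!: restrict_ext)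
  next
    case (5 x)
    then show ?case by (simp add: functor_category_simps idt)
  next
    case (6 x y f)
    then have *: "k_functor K C D x" "k_functor K C D y" "f \<in> ?N x y"
      by (simp_all add: functor_category_simps)
    show ?case
      unfolding functor_category_simps
      by (rule natural_transformations_eqI[OF cmp[OF *(2,2,1) idt[OF *(2)] *(3)] *(3)])
         (simp add: D.Idt_left obj[OF *(1)] obj[OF *(2)] nt(1)[OF *(3)])
  next
    case (7 x y f)
    then have *: "k_functor K C D x" "k_functor K C D y" "f \<in> ?N x y"
      by (simp_all add: functor_category_simps)
    show ?case
      unfolding functor_category_simps
      by (rule natural_transformations_eqI[OF cmp[OF *(2,1,1) *(3) idt[OF *(1)]] *(3)])
         (simp add: D.Idt_right obj[OF *(1)] obj[OF *(2)] nt(1)[OF *(3)])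
  qed
qed

section \<open>Vector spaces as a linear category\<close>

lemma vector_spaces_simps:
  "Obj (vector_spaces K) = {V. module K V}"
  "carrier (Mor (vector_spaces K) W V) = linear_maps K V W \<inter> extensional (carrier V)"
  "\<zero>\<^bsub>Mor (vector_spaces K) W V\<^esub> = (\<lambda>v\<in>carrier V. \<zero>\<^bsub>W\<^esub>)"
  "f \<oplus>\<^bsub>Mor (vector_spaces K) W V\<^esub> g = (\<lambda>v\<in>carrier V. f v \<oplus>\<^bsub>W\<^esub> g v)"
  "c \<odot>\<^bsub>Mor (vector_spaces K) W V\<^esub> f = (\<lambda>v\<in>carrier V. c \<odot>\<^bsub>W\<^esub> f v)"
  "Cmp (vector_spaces K) W V U g f = compose (carrier U) g f"
  "Idt (vector_spaces K) V = (\<lambda>v\<in>carrier V. v)"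
  by (simp_all add: vector_spaces_def)

lemma vector_spaces_k_category:
  assumes "field K"
  shows "k_category K (vector_spaces K)"
proof -
  interpret field K by fact
  note simps = vector_spaces_simps
  have lin_add: "(\<lambda>v\<in>carrier V. f v \<oplus>\<^bsub>W\<^esub> g v) \<in> linear_maps K V W"
    if V: "module K V" and W: "module K W" and f: "f \<in> linear_maps K V W" and g: "g \<in> linear_maps K V W"
    for V W :: "('a, 'v) module" and f g
  proof -
    interpret V: module K V by fact
    interpret W: module K W by fact
    note [simp] = linear_maps_closed[OF f] linear_maps_closed[OF g] linear_maps_add[OF f]
      linear_maps_add[OF g] linear_maps_smult[OF f] linear_maps_smult[OF g]
    show ?thesis
      by (rule linear_mapsI) (simp_all add: W.a_ac W.smult_r_distr)
  qed
  have lin_smult: "(\<lambda>v\<in>carrier V. c \<odot>\<^bsub>W\<^esub> f v) \<in> linear_maps K V W"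
    if V: "module K V" and W: "module K W" and f: "f \<in> linear_maps K V W" and c: "c \<in> carrier K"
    for V W :: "('a, 'v) module" and f c
  proof -
    interpret V: module K V by fact
    interpret W: module K W by fact
    note [simp] = linear_maps_closed[OF f] linear_maps_add[OF f] linear_maps_smult[OF f] c
    show ?thesis
      by (rule linear_mapsI) (simp_all add: W.smult_r_distr W.smult_assoc1[symmetric] m_comm[OF c])
  qed
  have lin_comp: "compose (carrier U) g f \<in> linear_maps K U W"
    if "module K U" "g \<in> linear_maps K V W" "f \<in> linear_maps K U V"
    for U V W :: "('a, 'v) module" and f g
    unfolding compose_def using linear_maps_restrict[OF linear_maps_comp[OF that(3,2)] that(1)] .
  have md: "module K (Mor (vector_spaces K) W V)" if V: "module K V" and W: "module K W"
    for V W :: "('a, 'v) module"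
  proof (rule module_pointwise[of K "carrier V" "\<lambda>_. W"])
    interpret V: module K V by fact
    interpret W: module K W by fact
    show "cring K" by (rule is_cring)
    show "\<zero>\<^bsub>Mor (vector_spaces K) W V\<^esub> \<in> carrier (Mor (vector_spaces K) W V)"
      by (auto simp: simps intro!: linear_mapsI)
    show "carrier (Mor (vector_spaces K) W V) \<subseteq> (\<Pi>\<^sub>E v\<in>carrier V. carrier W)"
      by (auto simp: simps linear_maps_closed PiE_def)
  qed (use V W in \<open>auto simp: simps lin_add lin_smult\<close>, auto simp: vector_spaces_def)
  show ?thesis
  proof (rule k_category.intro[OF field_axioms k_category_axioms.intro], goal_cases)
    case (1 V W)
    then show ?case by (simp add: md simps)
  next
    case (2 U V W g)
    then have U: "module K U" and g: "g \<in> linear_maps K V W" by (simp_all add: simps)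
    show ?case
      by (rule linear_mapsI)
        (auto simp: simps lin_comp[OF U g, unfolded compose_def] compose_def
            linear_maps_closed[of _ K U V]
          linear_maps_add[OF g] linear_maps_smult[OF g] intro!: restrict_ext)
  next
    case (3 U V W f)
    then have U: "module K U" and f: "f \<in> linear_maps K U V" by (simp_all add: simps)
    show ?case
      by (rule linear_mapsI)
        (auto simp: simps lin_comp[OF U _ f, unfolded compose_def] compose_def linear_maps_closed[OF f]
            intro!: restrict_ext)
  next
    case (4 T U V W h g f)
    then have f: "f \<in> linear_maps K T U" by (simp add: simps)
    show ?case
      by (auto simp: simps compose_def linear_maps_closed[OF f] intro!: restrict_ext)
  next
    case (5 V)
    then interpret V: module K V by (simp_all add: simps)
    show ?case by (auto simp: simps intro!: linear_mapsI)
  next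
    case (6 V W f)
    then have f: "f \<in> linear_maps K V W" "f \<in> extensional (carrier V)" by (simp_all add: simps)
    then show ?case
      by (auto simp: simps compose_def linear_maps_closed[OF f(1)] fun_eq_iff restrict_def
          extensional_def)
  next
    case (7 V W f)
    then have f: "f \<in> linear_maps K V W" "f \<in> extensional (carrier V)" by (simp_all add: simps)
    then show ?case
      by (auto simp: simps compose_def fun_eq_iff restrict_def extensional_def)
  qed
qed

lemma left_modules_k_category: "field K \<Longrightarrow> k_category K (left_modules K C)"
  unfolding left_modules_def by (intro functor_category_k_category vector_spaces_k_category)

section \<open>Natural isomorphisms and equivalences\<close>

lemma k_functorI:
  assumes "\<And>x. x \<in> Obj C \<Longrightarrow> FObj F x \<in> Obj D"
    and "\<And>x y. \<lbrakk>x \<in> Obj C; y \<in> Obj C\<rbrakk>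
      \<Longrightarrow> FMor F y x \<in> linear_maps K (Mor C y x) (Mor D (FObj F y) (FObj F x))"
    and "\<And>x. x \<in> Obj C \<Longrightarrow> FMor F x x (Idt C x) = Idt D (FObj F x)"
    and "\<And>x y z g f. \<lbrakk>x \<in> Obj C; y \<in> Obj C; z \<in> Obj C; g \<in> carrier (Mor C z y); f \<in> carrier (Mor C y x)\<rbrakk>
      \<Longrightarrow> FMor F z x (Cmp C z y x g f) =
          Cmp D (FObj F z) (FObj F y) (FObj F x) (FMor F z y g) (FMor F y x f)"
  shows "k_functor K C D F"
  using assms unfolding k_functor_def by blast

lemma id_functor_k_functor: "k_functor K C C id_functor"
  by (rule k_functorI) (auto simp: id_functor_def linear_maps_def)

lemma comp_functor_k_functor:
  assumes F: "k_functor K C D F" and E: "k_functor K D H E"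
  shows "k_functor K C H (comp_functor E F)"
proof (rule k_functorI)
  fix x y assume xy: "x \<in> Obj C" "y \<in> Obj C"
  note lF = k_functorD(2)[OF F xy]
    and lE = k_functorD(2)[OF E k_functorD(1)[OF F xy(1)] k_functorD(1)[OF F xy(2)]]
  show "FMor (comp_functor E F) y x
    \<in> linear_maps K (Mor C y x) (Mor H (FObj (comp_functor E F) y) (FObj (comp_functor E F) x))"
    by (rule linear_mapsI)
      (simp_all add: comp_functor_def linear_maps_closed[OF lF] linear_maps_closed[OF lE]
        linear_maps_add[OF lF] linear_maps_add[OF lE] linear_maps_smult[OF lF] linear_maps_smult[OF lE])
qed (simp_all add: comp_functor_def k_functorD[OF F] k_functorD[OF E])

text \<open>An objectwise inverse of a natural transformation is natural by itself: insert
  \<open>\<tau> \<sigma>\<close> on the right, slide \<open>f\<close> past \<open>\<tau>\<close>,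
  and cancel \<open>\<sigma> \<tau>\<close>.\<close>

lemma functor_category_isomorphicI:
  assumes D: "k_category K D" and F: "k_functor K C D F" and E: "k_functor K C D E"
    and \<tau>: "\<tau> \<in> natural_transformations C D F E"
    and inv: "\<And>x. x \<in> Obj C \<Longrightarrow> \<sigma> x \<in> carrier (Mor D (FObj F x) (FObj E x)) \<and>
      Cmp D (FObj F x) (FObj E x) (FObj F x) (\<sigma> x) (\<tau> x) = Idt D (FObj F x) \<and>
      Cmp D (FObj E x) (FObj F x) (FObj E x) (\<tau> x) (\<sigma> x) = Idt D (FObj E x)"
  shows "isomorphic_in (functor_category K C D) F E"
proof -
  interpret D: k_category K D by fact
  note \<tau>c = natural_transformationsD(1)[OF \<tau>] and \<tau>n = natural_transformationsD(2)[OF \<tau>]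
  note [simp] = k_functorD(1,5)[OF F] k_functorD(1,5)[OF E] \<tau>c
  have [simp]: "\<sigma> x \<in> carrier (Mor D (FObj F x) (FObj E x))" if "x \<in> Obj C" for x
    using inv that by simp
  have \<sigma>: "restrict \<sigma> (Obj C) \<in> natural_transformations C D E F"
  proof (rule natural_transformationsI)
    fix x y f assume [simp]: "x \<in> Obj C" "y \<in> Obj C" "f \<in> carrier (Mor C y x)"
    let ?Cx = "Cmp D (FObj F y) (FObj E y) (FObj E x) (\<sigma> y) (FMor E y x f)"
    have "?Cx = Cmp D (FObj F y) (FObj E x) (FObj E x) ?Cx
        (Cmp D (FObj E x) (FObj F x) (FObj E x) (\<tau> x) (\<sigma> x))"
      by (simp add: inv D.Idt_right D.Cmp_closed)
    also have "\<dots> = Cmp D (FObj F y) (FObj E y) (FObj E x) (\<sigma> y)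
        (Cmp D (FObj E y) (FObj F x) (FObj E x)
            (Cmp D (FObj E y) (FObj E x) (FObj F x) (FMor E y x f) (\<tau> x)) (\<sigma> x))"
      by (simp add: D.Cmp_assoc D.Cmp_closed)
    also have "\<dots> = Cmp D (FObj F y) (FObj F y) (FObj E x)
        (Cmp D (FObj F y) (FObj E y) (FObj F y) (\<sigma> y) (\<tau> y))
        (Cmp D (FObj F y) (FObj F x) (FObj E x) (FMor F y x f) (\<sigma> x))"
      by (simp add: D.Cmp_assoc D.Cmp_closed \<tau>n[symmetric])
    also have "\<dots> = Cmp D (FObj F y) (FObj F x) (FObj E x) (FMor F y x f) (\<sigma> x)"
      by (simp add: inv D.Idt_left D.Cmp_closed)
    finally show "Cmp D (FObj F y) (FObj E y) (FObj E x) (restrict \<sigma> (Obj C) y) (FMor E y x f) =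
        Cmp D (FObj F y) (FObj F x) (FObj E x) (FMor F y x f) (restrict \<sigma> (Obj C) x)"
      by simp
  qed auto
  show ?thesis
    unfolding isomorphic_in_def
    by (intro conjI bexI[of _ \<tau>] bexI[of _ "restrict \<sigma> (Obj C)"])
       (auto simp: functor_category_simps F E \<sigma> \<tau> inv intro!: restrict_ext)
qed

text \<open>A quasi-inverse of a fully faithful, essentially surjective functor is obtained by
  conjugating with chosen isomorphisms \<open>\<epsilon> q\<close> from \<open>F (r q)\<close> to \<open>q\<close>.\<close>

lemma k_equivalent_if_fully_faithful:
  fixes P :: "('k, 'o, 'm) kcat" and Q :: "('k, 'p, 'n) kcat"
  assumes P: "k_category K P" and Q: "k_category K Q" and F: "k_functor K P Q F"
    and ff: "\<And>x y. \<lbrakk>x \<in> Obj P; y \<in> Obj P\<rbrakk>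
      \<Longrightarrow> bij_betw (FMor F y x) (carrier (Mor P y x)) (carrier (Mor Q (FObj F y) (FObj F x)))"
    and es: "\<And>q. q \<in> Obj Q \<Longrightarrow> \<exists>p\<in>Obj P. isomorphic_in Q (FObj F p) q"
  shows "k_equivalent K P Q"
proof -
  interpret P: k_category K P by fact
  interpret Q: k_category K Q by fact
  \<comment> \<open>Bundles a preimage object with a pair of mutually inverse isomorphisms, so that
    a single choice provides all three.\<close>
  define good where "good = (\<lambda>q (p, e, e'). p \<in> Obj P \<and> e \<in> carrier (Mor Q q (FObj F p)) \<and>
    e' \<in> carrier (Mor Q (FObj F p) q) \<and> Cmp Q (FObj F p) q (FObj F p) e' e = Idt Q (FObj F p) \<and>
    Cmp Q q (FObj F p) q e e' = Idt Q q)"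
  have "\<exists>t. good q t" if "q \<in> Obj Q" for q
    using es[OF that] by (auto simp: isomorphic_in_def good_def)
  then obtain ch where ch: "\<And>q. q \<in> Obj Q \<Longrightarrow> good q (ch q)" by metis
  define r where "r q = fst (ch q)" for q
  define \<epsilon> where "\<epsilon> q = fst (snd (ch q))" for q
  define \<epsilon>' where "\<epsilon>' q = snd (snd (ch q))" for q
  have ch': "r q \<in> Obj P \<and> \<epsilon> q \<in> carrier (Mor Q q (FObj F (r q))) \<and>
    \<epsilon>' q \<in> carrier (Mor Q (FObj F (r q)) q) \<and>
    Cmp Q (FObj F (r q)) q (FObj F (r q)) (\<epsilon>' q) (\<epsilon> q) = Idt Q (FObj F (r q)) \<and>
    Cmp Q q (FObj F (r q)) q (\<epsilon> q) (\<epsilon>' q) = Idt Q q" if "q \<in> Obj Q" for q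
    using ch[OF that] by (cases "ch q") (auto simp: good_def r_def \<epsilon>_def \<epsilon>'_def)
  note [simp] = k_functorD(1,5)[OF F]
  have r[simp]: "q \<in> Obj Q \<Longrightarrow> r q \<in> Obj P" for q using ch' by blast
  have \<epsilon>c[simp]: "q \<in> Obj Q \<Longrightarrow> \<epsilon> q \<in> carrier (Mor Q q (FObj F (r q)))"
    "q \<in> Obj Q \<Longrightarrow> \<epsilon>' q \<in> carrier (Mor Q (FObj F (r q)) q)" for q using ch' by blast+
  have \<epsilon>'\<epsilon>: "q \<in> Obj Q \<Longrightarrow> Cmp Q (FObj F (r q)) q (FObj F (r q)) (\<epsilon>' q) (\<epsilon> q) = Idt Q (FObj F (r q))"
    and \<epsilon>\<epsilon>': "q \<in> Obj Q \<Longrightarrow> Cmp Q q (FObj F (r q)) q (\<epsilon> q) (\<epsilon>' q) = Idt Q q" for q using ch' by blast+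
  have \<epsilon>\<epsilon>'_left: "Cmp Q z (FObj F (r z)) w (\<epsilon> z) (Cmp Q (FObj F (r z)) z w (\<epsilon>' z) f) = f"
    if "z \<in> Obj Q" "w \<in> Obj Q" "f \<in> carrier (Mor Q z w)" for z w f
    using that by (simp add: Q.Cmp_assoc[symmetric] \<epsilon>\<epsilon>' Q.Idt_left)
  have \<epsilon>'\<epsilon>_left: "Cmp Q (FObj F (r z)) z w (\<epsilon>' z) (Cmp Q z (FObj F (r z)) w (\<epsilon> z) f) = f"
    if "z \<in> Obj Q" "w \<in> Obj Q" "f \<in> carrier (Mor Q (FObj F (r z)) w)" for z w f
    using that by (simp add: Q.Cmp_assoc[symmetric] \<epsilon>'\<epsilon> Q.Idt_left)
  define pre where "pre y x g = inv_into (carrier (Mor P y x)) (FMor F y x) g" for y x g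
  have pre[simp]: "pre y x g \<in> carrier (Mor P y x)" "FMor F y x (pre y x g) = g"
    if "x \<in> Obj P" "y \<in> Obj P" "g \<in> carrier (Mor Q (FObj F y) (FObj F x))" for x y g
    using ff[OF that(1,2)] that(3) unfolding pre_def bij_betw_def
    by (auto intro: inv_into_into f_inv_into_f)
  \<comment> \<open>Equations between morphisms of \<open>P\<close> are proved below by applying
    \<open>F\<close>, since only there do the terms built from \<open>pre\<close> become
    explicit.\<close>
  have faithful: "g = g'" if "x \<in> Obj P" "y \<in> Obj P" "g \<in> carrier (Mor P y x)" "g' \<in> carrier
      (Mor P y x)"
    "FMor F y x g = FMor F y x g'" for x y g g'
    using ff[OF that(1,2)] that(3-5) unfolding bij_betw_def inj_on_def by blast
  define L where "L z y f = Cmp Q (FObj F (r z)) z (FObj F (r y)) (\<epsilon>' z)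
      (Cmp Q z y (FObj F (r y)) f (\<epsilon> y))" for z y f
  have L[simp]: "L z y f \<in> carrier (Mor Q (FObj F (r z)) (FObj F (r y)))"
    if "z \<in> Obj Q" "y \<in> Obj Q" "f \<in> carrier (Mor Q z y)" for z y f
    using that by (simp add: L_def Q.Cmp_closed)
  define E where "E = \<lparr>FObj = r, FMor = (\<lambda>z y f. pre (r z) (r y) (L z y f))\<rparr>"
  have E: "k_functor K Q P E"
  proof (rule k_functorI)
    fix x y assume xy: "x \<in> Obj Q" "y \<in> Obj Q"
    note lF = k_functorD(2)[OF F r[OF xy(1)] r[OF xy(2)]]
    show "FMor E y x \<in> linear_maps K (Mor Q y x) (Mor P (FObj E y) (FObj E x))"
    proof (rule linear_mapsI)
      fix u v assume uv: "u \<in> carrier (Mor Q y x)" "v \<in> carrier (Mor Q y x)"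
      have "L y x (u \<oplus>\<^bsub>Mor Q y x\<^esub> v) = L y x u \<oplus>\<^bsub>Mor Q (FObj F (r y)) (FObj F (r x))\<^esub> L y x v"
        using xy uv by (simp add: L_def Q.Cmp_add_left Q.Cmp_add_right Q.Cmp_closed)
      then show "FMor E y x (u \<oplus>\<^bsub>Mor Q y x\<^esub> v) = FMor E y x u \<oplus>\<^bsub>Mor P (FObj E y) (FObj E x)\<^esub> FMor E y x
          v"
        using xy uv by (intro faithful[of "r x" "r y"])
           (simp_all add: E_def P.Mor_add Q.Mor_add linear_maps_add[OF lF])
    next
      fix c v assume cv: "c \<in> carrier K" "v \<in> carrier (Mor Q y x)"
      have "L y x (c \<odot>\<^bsub>Mor Q y x\<^esub> v) = c \<odot>\<^bsub>Mor Q (FObj F (r y)) (FObj F (r x))\<^esub> L y x v"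
        using xy cv by (simp add: L_def Q.Cmp_smult_left Q.Cmp_smult_right Q.Cmp_closed)
      then show "FMor E y x (c \<odot>\<^bsub>Mor Q y x\<^esub> v) = c \<odot>\<^bsub>Mor P (FObj E y) (FObj E x)\<^esub> FMor E y x v"
        using xy cv by (intro faithful[of "r x" "r y"])
           (simp_all add: E_def P.Mor_smult Q.Mor_smult linear_maps_smult[OF lF])
    qed (use xy in \<open>simp add: E_def\<close>)
  next
    fix x assume x: "x \<in> Obj Q"
    have "L x x (Idt Q x) = Idt Q (FObj F (r x))"
      using x by (simp add: L_def Q.Idt_left \<epsilon>'\<epsilon>)
    then show "FMor E x x (Idt Q x) = Idt P (FObj E x)"
      using x by (intro faithful[of "r x" "r x"])
        (simp_all add: E_def P.Idt_closed Q.Idt_closed k_functorD(3)[OF F])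
  next
    fix x y z g f assume *: "x \<in> Obj Q" "y \<in> Obj Q" "z \<in> Obj Q" "g \<in> carrier (Mor Q z y)" "f \<in> carrier
        (Mor Q y x)"
    have "L z x (Cmp Q z y x g f) = Cmp Q (FObj F (r z)) (FObj F (r y)) (FObj F (r x)) (L z y g)
        (L y x f)"
      using * by (simp add: L_def Q.Cmp_assoc Q.Cmp_closed \<epsilon>\<epsilon>'_left)
    then show "FMor E z x (Cmp Q z y x g f) =
      Cmp P (FObj E z) (FObj E y) (FObj E x) (FMor E z y g) (FMor E y x f)"
      using * by (intro faithful[of "r x" "r z"])
        (simp_all add: E_def P.Cmp_closed Q.Cmp_closed k_functorD(4)[OF F])
  qed (simp add: E_def)
  have "isomorphic_in (functor_category K Q Q) (comp_functor F E) id_functor"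
  proof (rule functor_category_isomorphicI[where \<sigma> = \<epsilon>', OF Q comp_functor_k_functor[OF E F]
      id_functor_k_functor])
    show "restrict \<epsilon> (Obj Q) \<in> natural_transformations Q Q (comp_functor F E) id_functor"
      by (rule natural_transformationsI)
        (simp_all add: comp_functor_def id_functor_def E_def L_def \<epsilon>\<epsilon>'_left Q.Cmp_closed)
  qed (simp add: comp_functor_def id_functor_def E_def \<epsilon>'\<epsilon> \<epsilon>\<epsilon>')
  moreover have "isomorphic_in (functor_category K P P) (comp_functor E F) id_functor"
  proof (rule functor_category_isomorphicI[OF P comp_functor_k_functor[OF F E] id_functor_k_functor])
    \<comment> \<open>The isomorphism from \<open>E (F p)\<close> to \<open>p\<close> is the lift
      through \<open>F\<close> of the chosen isomorphism \<open>\<epsilon> (F p)\<close>.\<close>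
    show "(\<lambda>p\<in>Obj P. pre p (r (FObj F p)) (\<epsilon> (FObj F p))) \<in> natural_transformations P P
        (comp_functor E F) id_functor"
    proof (rule natural_transformationsI)
      fix x y f assume *[simp]: "x \<in> Obj P" "y \<in> Obj P" "f \<in> carrier (Mor P y x)"
      show "Cmp P (FObj id_functor y) (FObj (comp_functor E F) y) (FObj (comp_functor E F) x)
           ((\<lambda>p\<in>Obj P. pre p (r (FObj F p)) (\<epsilon> (FObj F p))) y) (FMor (comp_functor E F) y x f) =
          Cmp P (FObj id_functor y) (FObj id_functor x) (FObj (comp_functor E F) x)
              (FMor id_functor y x f)
           ((\<lambda>p\<in>Obj P. pre p (r (FObj F p)) (\<epsilon> (FObj F p))) x)"
        by (rule faithful[of "r (FObj F x)" y])
          (simp_all add: comp_functor_def id_functor_def E_def P.Cmp_closed k_functorD(4)[OF F]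
            L_def \<epsilon>\<epsilon>'_left Q.Cmp_closed)
    qed (simp_all add: comp_functor_def id_functor_def E_def)
  next
    fix x assume [simp]: "x \<in> Obj P"
    let ?e = "pre x (r (FObj F x)) (\<epsilon> (FObj F x))" and ?e' = "pre (r (FObj F x)) x (\<epsilon>' (FObj F x))"
    have "Cmp P (r (FObj F x)) x (r (FObj F x)) ?e' ?e = Idt P (r (FObj F x))"
      by (rule faithful[of "r (FObj F x)" "r (FObj F x)"])
        (simp_all add: P.Cmp_closed P.Idt_closed k_functorD(3,4)[OF F] \<epsilon>'\<epsilon>)
    moreover have "Cmp P x (r (FObj F x)) x ?e ?e' = Idt P x"
      by (rule faithful[of x x])
        (simp_all add: P.Cmp_closed P.Idt_closed k_functorD(3,4)[OF F] \<epsilon>\<epsilon>')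
    ultimately show "pre (r (FObj F x)) x (\<epsilon>' (FObj F x)) \<in> carrier
        (Mor P (FObj (comp_functor E F) x) (FObj id_functor x)) \<and>
         Cmp P (FObj (comp_functor E F) x) (FObj id_functor x) (FObj (comp_functor E F) x)
          (pre (r (FObj F x)) x (\<epsilon>' (FObj F x))) ((\<lambda>p\<in>Obj P. pre p (r (FObj F p)) (\<epsilon> (FObj F p))) x) =
         Idt P (FObj (comp_functor E F) x) \<and>
         Cmp P (FObj id_functor x) (FObj (comp_functor E F) x) (FObj id_functor x)
          ((\<lambda>p\<in>Obj P. pre p (r (FObj F p)) (\<epsilon> (FObj F p))) x) (pre (r (FObj F x)) x (\<epsilon>' (FObj F x))) =
         Idt P (FObj id_functor x)"
      by (simp add: comp_functor_def id_functor_def E_def)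
  qed
  ultimately show ?thesis
    unfolding k_equivalent_def using F E by blast
qed

section \<open>Modules over a linear category\<close>

type_synonym ('k, 'o, 'm, 'v) cmod = "('o, 'm, ('k, 'v) module, 'v \<Rightarrow> 'v) kfun"

type_synonym ('k, 'o, 'm, 'v) cmods = "('k, ('k, 'o, 'm, 'v) cmod, 'o \<Rightarrow> 'v \<Rightarrow> 'v) kcat"

abbreviation left_module ::
    "('k, 'r) ring_scheme \<Rightarrow> ('k, 'o, 'm) kcat \<Rightarrow> ('k, 'o, 'm, 'v) cmod \<Rightarrow> bool" where
  "left_module K C \<equiv> k_functor K C (vector_spaces K)"

locale category_module = k_category K C
  for K :: "('k, 'r) ring_scheme" and C :: "('k, 'o, 'm) kcat" +
  fixes M :: "('k, 'o, 'm, 'v) cmod"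
  assumes M: "left_module K C M"
begin

lemma space: "x \<in> Obj C \<Longrightarrow> module K (FObj M x)"
  using k_functorD(1)[OF M] by (simp add: vector_spaces_simps)

lemma space_ag: "x \<in> Obj C \<Longrightarrow> abelian_group (FObj M x)"
  using space module_abelian_group by blast

lemma space_am: "x \<in> Obj C \<Longrightarrow> abelian_monoid (FObj M x)"
  using space module_abelian_monoid by blast

lemma act_linear_ext: "\<lbrakk>x \<in> Obj C; y \<in> Obj C; f \<in> carrier (Mor C y x)\<rbrakk>
    \<Longrightarrow> FMor M y x f \<in> linear_maps K (FObj M x) (FObj M y) \<and> FMor M y x f \<in> extensional
        (carrier (FObj M x))"
  using k_functorD(5)[OF M] by (simp add: vector_spaces_simps)

lemma act_linear: "\<lbrakk>x \<in> Obj C; y \<in> Obj C; f \<in> carrier (Mor C y x)\<rbrakk>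
    \<Longrightarrow> FMor M y x f \<in> linear_maps K (FObj M x) (FObj M y)"
  using act_linear_ext by blast

lemma act_closed: "\<lbrakk>x \<in> Obj C; y \<in> Obj C; f \<in> carrier (Mor C y x); v \<in> carrier (FObj M x)\<rbrakk>
    \<Longrightarrow> FMor M y x f v \<in> carrier (FObj M y)"
  using act_linear linear_maps_closed by metis

lemma act_linear_Mor: "\<lbrakk>x \<in> Obj C; y \<in> Obj C; v \<in> carrier (FObj M x)\<rbrakk>
    \<Longrightarrow> (\<lambda>f. FMor M y x f v) \<in> linear_maps K (Mor C y x) (FObj M y)"
  using k_functorD(2)[OF M, of x y]
  by (intro linear_mapsI) (simp_all add: act_closed linear_maps_add linear_maps_smult
      vector_spaces_simps)

lemma act_add: "\<lbrakk>x \<in> Obj C; y \<in> Obj C; f \<in> carrier (Mor C y x); u \<in> carrier (FObj M x); v \<in> carrier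
    (FObj M x)\<rbrakk>
    \<Longrightarrow> FMor M y x f (u \<oplus>\<^bsub>FObj M x\<^esub> v) = FMor M y x f u \<oplus>\<^bsub>FObj M y\<^esub> FMor M y x f v"
  using linear_maps_add[OF act_linear] by metis

lemma act_smult: "\<lbrakk>x \<in> Obj C; y \<in> Obj C; f \<in> carrier (Mor C y x); c \<in> carrier K; v \<in> carrier (FObj M x)\<rbrakk>
    \<Longrightarrow> FMor M y x f (c \<odot>\<^bsub>FObj M x\<^esub> v) = c \<odot>\<^bsub>FObj M y\<^esub> FMor M y x f v"
  using linear_maps_smult[OF act_linear] by metis

lemma act_zero: "\<lbrakk>x \<in> Obj C; y \<in> Obj C; f \<in> carrier (Mor C y x)\<rbrakk>
    \<Longrightarrow> FMor M y x f \<zero>\<^bsub>FObj M x\<^esub> = \<zero>\<^bsub>FObj M y\<^esub>"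
  using linear_maps_zero[OF act_linear] space_ag by metis

lemma act_finsum: "\<lbrakk>x \<in> Obj C; y \<in> Obj C; f \<in> carrier (Mor C y x); finite A; \<And>i. i \<in> A \<Longrightarrow> v i \<in> carrier
    (FObj M x)\<rbrakk>
    \<Longrightarrow> FMor M y x f (\<Oplus>\<^bsub>FObj M x\<^esub>i\<in>A. v i) = (\<Oplus>\<^bsub>FObj M y\<^esub>i\<in>A. FMor M y x f (v i))"
  using linear_maps_finsum[OF act_linear space_ag space_ag, of x y f A v] by simp

lemma act_Mor_add: "\<lbrakk>x \<in> Obj C; y \<in> Obj C; f \<in> carrier (Mor C y x); g \<in> carrier (Mor C y x); v \<in> carrier
    (FObj M x)\<rbrakk>
    \<Longrightarrow> FMor M y x (f \<oplus>\<^bsub>Mor C y x\<^esub> g) v = FMor M y x f v \<oplus>\<^bsub>FObj M y\<^esub> FMor M y x g v"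
  using linear_maps_add[OF act_linear_Mor] by fast

lemma act_Mor_smult: "\<lbrakk>x \<in> Obj C; y \<in> Obj C; f \<in> carrier (Mor C y x); c \<in> carrier K; v \<in> carrier
    (FObj M x)\<rbrakk>
    \<Longrightarrow> FMor M y x (c \<odot>\<^bsub>Mor C y x\<^esub> f) v = c \<odot>\<^bsub>FObj M y\<^esub> FMor M y x f v"
  using linear_maps_smult[OF act_linear_Mor] by fast

lemma act_Mor_zero: "\<lbrakk>x \<in> Obj C; y \<in> Obj C; v \<in> carrier (FObj M x)\<rbrakk>
    \<Longrightarrow> FMor M y x \<zero>\<^bsub>Mor C y x\<^esub> v = \<zero>\<^bsub>FObj M y\<^esub>"
  using linear_maps_zero[OF act_linear_Mor Mor_ag space_ag] by simp

lemma act_Mor_finsum: "\<lbrakk>x \<in> Obj C; y \<in> Obj C; finite A; \<And>i. i \<in> A \<Longrightarrow> f i \<in> carrier (Mor C y x); v \<in>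
    carrier (FObj M x)\<rbrakk>
    \<Longrightarrow> FMor M y x (\<Oplus>\<^bsub>Mor C y x\<^esub>i\<in>A. f i) v = (\<Oplus>\<^bsub>FObj M y\<^esub>i\<in>A. FMor M y x (f i) v)"
  using linear_maps_finsum[OF act_linear_Mor Mor_ag space_ag, of x y v A f] by simp

lemma act_Cmp: "\<lbrakk>x \<in> Obj C; y \<in> Obj C; z \<in> Obj C; g \<in> carrier (Mor C z y); f \<in> carrier (Mor C y x); v \<in>
    carrier (FObj M x)\<rbrakk>
    \<Longrightarrow> FMor M z x (Cmp C z y x g f) v = FMor M z y g (FMor M y x f v)"
  using k_functorD(4)[OF M] by (simp add: vector_spaces_simps compose_def)

lemma act_Idt: "\<lbrakk>x \<in> Obj C; v \<in> carrier (FObj M x)\<rbrakk> \<Longrightarrow> FMor M x x (Idt C x) v = v"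
  using k_functorD(3)[OF M] by (simp add: vector_spaces_simps)

end

lemma (in k_category) category_moduleI: "left_module K C M \<Longrightarrow> category_module K C M"
  by (intro category_module.intro k_category_axioms category_module_axioms.intro)

text \<open>Morphisms of \<open>vector_spaces\<close> are linear maps that take the value
  \<open>undefined\<close> off the carrier. Equations between them reduce to equations on vectors
  only in the presence of extensionality, hence the separate premise.\<close>

lemma left_moduleI:
  assumes "\<And>x. x \<in> Obj C \<Longrightarrow> module K (FObj M x)"
    and "\<And>x y f. \<lbrakk>x \<in> Obj C; y \<in> Obj C; f \<in> carrier (Mor C y x)\<rbrakk>
      \<Longrightarrow> FMor M y x f \<in> linear_maps K (FObj M x) (FObj M y)"
    and "\<And>x y f. \<lbrakk>x \<in> Obj C; y \<in> Obj C; f \<in> carrier (Mor C y x)\<rbrakk>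
      \<Longrightarrow> FMor M y x f \<in> extensional (carrier (FObj M x))"
    and "\<And>x y v. \<lbrakk>x \<in> Obj C; y \<in> Obj C; v \<in> carrier (FObj M x)\<rbrakk>
      \<Longrightarrow> (\<lambda>f. FMor M y x f v) \<in> linear_maps K (Mor C y x) (FObj M y)"
    and "\<And>x v. \<lbrakk>x \<in> Obj C; v \<in> carrier (FObj M x)\<rbrakk> \<Longrightarrow> FMor M x x (Idt C x) v = v"
    and "\<And>x y z g f v. \<lbrakk>x \<in> Obj C; y \<in> Obj C; z \<in> Obj C; g \<in> carrier (Mor C z y);
        f \<in> carrier (Mor C y x); v \<in> carrier (FObj M x)\<rbrakk>
      \<Longrightarrow> FMor M z x (Cmp C z y x g f) v = FMor M z y g (FMor M y x f v)"
    and C: "k_category K C"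
  shows "left_module K C M"
proof -
  interpret C: k_category K C by fact
  have eq: "f = restrict g A" if "f \<in> extensional A" "\<And>v. v \<in> A \<Longrightarrow> f v = g v" for f g :: "'v \<Rightarrow> 'v" and A
    using that by (auto simp: fun_eq_iff extensional_def)
  show ?thesis
  proof (rule k_functorI)
    fix x y assume xy: "x \<in> Obj C" "y \<in> Obj C"
    show "FMor M y x \<in> linear_maps K (Mor C y x) (Mor (vector_spaces K) (FObj M y) (FObj M x))"
      by (rule linear_mapsI)
        (auto simp: vector_spaces_simps xy assms(2,3) C.Mor_add C.Mor_smult
          linear_maps_add[OF assms(4)] linear_maps_smult[OF assms(4)] intro!: eq)
  next
    fix x assume x: "x \<in> Obj C"
    show "FMor M x x (Idt C x) = Idt (vector_spaces K) (FObj M x)"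
      using x by (auto simp: vector_spaces_simps assms(3,5) C.Idt_closed intro!: eq)
  next
    fix x y z g f
    assume *: "x \<in> Obj C" "y \<in> Obj C" "z \<in> Obj C" "g \<in> carrier (Mor C z y)" "f \<in> carrier (Mor C y x)"
    show "FMor M z x (Cmp C z y x g f) =
       Cmp (vector_spaces K) (FObj M z) (FObj M y) (FObj M x) (FMor M z y g) (FMor M y x f)"
      using * by (auto simp: vector_spaces_simps compose_def assms(3,6) C.Cmp_closed intro!: eq)
  qed (simp add: vector_spaces_simps assms)
qed

section \<open>Homomorphisms and isomorphisms of modules over a category\<close>

definition module_homs ::
    "('k, 'r) ring_scheme \<Rightarrow> ('k, 'o, 'm) kcat \<Rightarrow> ('k, 'o, 'm, 'v) cmod
      \<Rightarrow> ('k, 'o, 'm, 'v) cmod \<Rightarrow> ('o \<Rightarrow> 'v \<Rightarrow> 'v) set" where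
  "module_homs K C M N = natural_transformations C (vector_spaces K) M N"

lemma module_homsD:
  assumes "\<tau> \<in> module_homs K C M N" "left_module K C M"
  shows "x \<in> Obj C \<Longrightarrow> \<tau> x \<in> linear_maps K (FObj M x) (FObj N x)"
    and "x \<in> Obj C \<Longrightarrow> \<tau> x \<in> extensional (carrier (FObj M x))"
    and "\<lbrakk>x \<in> Obj C; y \<in> Obj C; f \<in> carrier (Mor C y x); v \<in> carrier (FObj M x)\<rbrakk>
      \<Longrightarrow> \<tau> y (FMor M y x f v) = FMor N y x f (\<tau> x v)"
    and "\<lbrakk>x \<in> Obj C; v \<in> carrier (FObj M x)\<rbrakk> \<Longrightarrow> \<tau> x v \<in> carrier (FObj N x)"
proof -
  show 1: "\<tau> x \<in> linear_maps K (FObj M x) (FObj N x)" if "x \<in> Obj C" for x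
    using natural_transformationsD(1)[OF assms(1)[unfolded module_homs_def] that] by
        (simp add: vector_spaces_simps)
  show "\<tau> x \<in> extensional (carrier (FObj M x))" if "x \<in> Obj C"
    using natural_transformationsD(1)[OF assms(1)[unfolded module_homs_def] that] by
        (simp add: vector_spaces_simps)
  show "\<tau> y (FMor M y x f v) = FMor N y x f (\<tau> x v)"
    if "x \<in> Obj C" "y \<in> Obj C" "f \<in> carrier (Mor C y x)" "v \<in> carrier (FObj M x)"
    using natural_transformationsD(2)[OF assms(1)[unfolded module_homs_def] that(1-3), THEN fun_cong, of
        v] that(4)
    by (simp add: vector_spaces_simps compose_def)
  show "\<tau> x v \<in> carrier (FObj N x)" if "x \<in> Obj C" "v \<in> carrier (FObj M x)"
    using linear_maps_closed[OF 1] that by blast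
qed

lemma module_homsI:
  assumes "\<tau> \<in> extensional (Obj C)"
    and "\<And>x. x \<in> Obj C \<Longrightarrow> \<tau> x \<in> linear_maps K (FObj M x) (FObj N x)"
    and "\<And>x. x \<in> Obj C \<Longrightarrow> \<tau> x \<in> extensional (carrier (FObj M x))"
    and "\<And>x y f v. \<lbrakk>x \<in> Obj C; y \<in> Obj C; f \<in> carrier (Mor C y x); v \<in> carrier (FObj M x)\<rbrakk>
      \<Longrightarrow> \<tau> y (FMor M y x f v) = FMor N y x f (\<tau> x v)"
  shows "\<tau> \<in> module_homs K C M N"
  unfolding module_homs_def
  by (rule natural_transformationsI) (use assms in \<open>auto simp: vector_spaces_simps compose_def intro!:
      restrict_ext\<close>)

lemma module_homs_eqI:
  assumes "\<sigma> \<in> module_homs K C M N" "\<tau> \<in> module_homs K C M N" "left_module K C M"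
    and "\<And>x v. \<lbrakk>x \<in> Obj C; v \<in> carrier (FObj M x)\<rbrakk> \<Longrightarrow> \<sigma> x v = \<tau> x v"
  shows "\<sigma> = \<tau>"
proof (rule natural_transformations_eqI[OF assms(1,2)[unfolded module_homs_def]])
  fix x assume x: "x \<in> Obj C"
  show "\<sigma> x = \<tau> x"
    by (rule extensionalityI[OF module_homsD(2)[OF assms(1,3) x] module_homsD(2)[OF assms(2,3) x]
        assms(4)[OF x]])
qed

lemma left_modules_simps:
  "Obj (left_modules K C) = {M. left_module K C M}"
  "carrier (Mor (left_modules K C) N M) = module_homs K C M N"
  "\<sigma> \<oplus>\<^bsub>Mor (left_modules K C) N M\<^esub> \<tau> = (\<lambda>x\<in>Obj C. \<lambda>v\<in>carrier (FObj M x). \<sigma> x v \<oplus>\<^bsub>FObj N x\<^esub> \<tau> x v)"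
  "c \<odot>\<^bsub>Mor (left_modules K C) N M\<^esub> \<tau> = (\<lambda>x\<in>Obj C. \<lambda>v\<in>carrier (FObj M x). c \<odot>\<^bsub>FObj N x\<^esub> \<tau> x v)"
  "Cmp (left_modules K C) P N M \<sigma> \<tau> = (\<lambda>x\<in>Obj C. compose (carrier (FObj M x)) (\<sigma> x) (\<tau> x))"
  "Idt (left_modules K C) M = (\<lambda>x\<in>Obj C. \<lambda>v\<in>carrier (FObj M x). v)"
  by (simp_all add: left_modules_def functor_category_simps vector_spaces_simps module_homs_def)

text \<open>Objectwise bijectivity suffices: the inverse of a bijective linear map is linear, and
  its naturality is automatic.\<close>

lemma left_modules_isomorphicI:
  assumes K: "field K" and M: "left_module K C M" and N: "left_module K C N"
    and \<tau>: "\<tau> \<in> module_homs K C M N"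
    and bij: "\<And>x. x \<in> Obj C \<Longrightarrow> bij_betw (\<tau> x) (carrier (FObj M x)) (carrier (FObj N x))"
  shows "isomorphic_in (left_modules K C) M N"
  unfolding left_modules_def
proof (rule functor_category_isomorphicI[OF vector_spaces_k_category[OF K] M N
    \<tau>[unfolded module_homs_def]])
  fix x assume x: "x \<in> Obj C"
  interpret Mx: module K "FObj M x" using k_functorD(1)[OF M x] by (simp add: vector_spaces_simps)
  interpret Nx: module K "FObj N x" using k_functorD(1)[OF N x] by (simp add: vector_spaces_simps)
  let ?\<sigma> = "\<lambda>w\<in>carrier (FObj N x). inv_into (carrier (FObj M x)) (\<tau> x) w"
  note lin = module_homsD(1)[OF \<tau> M x]
  have \<sigma>c: "?\<sigma> w \<in> carrier (FObj M x)" and \<tau>\<sigma>: "\<tau> x (?\<sigma> w) = w" if "w \<in> carrier (FObj N x)" for w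
    using bij[OF x] that by (auto simp: bij_betw_def intro: inv_into_into f_inv_into_f)
  have \<sigma>\<tau>: "?\<sigma> (\<tau> x v) = v" if "v \<in> carrier (FObj M x)" for v
    using bij[OF x] that linear_maps_closed[OF lin that] by (auto simp: bij_betw_def)
  have inj: "u = v" if "u \<in> carrier (FObj M x)" "v \<in> carrier (FObj M x)" "\<tau> x u = \<tau> x v" for u v
    using bij[OF x] that by (auto simp: bij_betw_def inj_on_def)
  have "?\<sigma> \<in> linear_maps K (FObj N x) (FObj M x)"
  proof (rule linear_mapsI)
    fix u v assume uv: "u \<in> carrier (FObj N x)" "v \<in> carrier (FObj N x)"
    show "?\<sigma> (u \<oplus>\<^bsub>FObj N x\<^esub> v) = ?\<sigma> u \<oplus>\<^bsub>FObj M x\<^esub> ?\<sigma> v"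
      by (rule inj) (use uv \<sigma>c \<tau>\<sigma> in \<open>simp_all add: linear_maps_add[OF lin] del: restrict_apply
          restrict_apply'\<close>)
  next
    fix c v assume cv: "c \<in> carrier K" "v \<in> carrier (FObj N x)"
    show "?\<sigma> (c \<odot>\<^bsub>FObj N x\<^esub> v) = c \<odot>\<^bsub>FObj M x\<^esub> ?\<sigma> v"
      by (rule inj) (use cv \<sigma>c \<tau>\<sigma> in \<open>simp_all add: linear_maps_smult[OF lin] del: restrict_apply
          restrict_apply'\<close>)
  qed (rule \<sigma>c)
  then show "?\<sigma> \<in> carrier (Mor (vector_spaces K) (FObj M x) (FObj N x)) \<and>
    Cmp (vector_spaces K) (FObj M x) (FObj N x) (FObj M x) ?\<sigma> (\<tau> x) = Idt (vector_spaces K) (FObj M x) \<and>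
    Cmp (vector_spaces K) (FObj N x) (FObj M x) (FObj N x) (\<tau> x) ?\<sigma> = Idt (vector_spaces K) (FObj N x)"
    using \<sigma>\<tau> \<tau>\<sigma> by (auto simp: vector_spaces_simps compose_def fun_eq_iff simp del: restrict_apply'
        cong: restrict_cong)
qed

section \<open>Matrix presentations\<close>

text \<open>For \<open>D\<close> only linear structure and closure under composition and identities
  are assumed; its category axioms follow in \<open>k_category_D\<close>. Entries must determine a
  morphism but may be subject to constraints, so that the quotient category, whose matrices are the
  invariant ones, is covered as well.\<close>

locale matrix_presentation = k_category K C
  for K :: "('k, 'r) ring_scheme" and C :: "('k, 'o, 'm) kcat" +
  fixes D :: "('k, 'p, 'n) kcat" and J :: "'j set" and ob :: "'p \<Rightarrow> 'j \<Rightarrow> 'o"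
    and ent :: "'p \<Rightarrow> 'p \<Rightarrow> 'j \<Rightarrow> 'j \<Rightarrow> 'n \<Rightarrow> 'm"
  assumes finite_J: "finite J"
    and ob_closed: "\<lbrakk>X \<in> Obj D; j \<in> J\<rbrakk> \<Longrightarrow> ob X j \<in> Obj C"
    and D_module: "\<lbrakk>X \<in> Obj D; Y \<in> Obj D\<rbrakk> \<Longrightarrow> module K (Mor D Y X)"
    and D_Cmp_closed: "\<lbrakk>X \<in> Obj D; Y \<in> Obj D; Z \<in> Obj D; g \<in> carrier (Mor D Z Y); f \<in> carrier
        (Mor D Y X)\<rbrakk>
      \<Longrightarrow> Cmp D Z Y X g f \<in> carrier (Mor D Z X)"
    and D_Idt_closed: "X \<in> Obj D \<Longrightarrow> Idt D X \<in> carrier (Mor D X X)"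
    and ent_linear: "\<lbrakk>X \<in> Obj D; Y \<in> Obj D; i \<in> J; j \<in> J\<rbrakk>
      \<Longrightarrow> ent Y X j i \<in> linear_maps K (Mor D Y X) (Mor C (ob Y j) (ob X i))"
    and ent_Cmp: "\<lbrakk>X \<in> Obj D; Y \<in> Obj D; Z \<in> Obj D; g \<in> carrier (Mor D Z Y); f \<in> carrier (Mor D Y X);
        i \<in> J; k \<in> J\<rbrakk>
      \<Longrightarrow> ent Z X k i (Cmp D Z Y X g f) = (\<Oplus>\<^bsub>Mor C (ob Z k) (ob X i)\<^esub>j\<in>J.
        Cmp C (ob Z k) (ob Y j) (ob X i) (ent Z Y k j g) (ent Y X j i f))"
    and ent_Idt: "\<lbrakk>X \<in> Obj D; i \<in> J; j \<in> J\<rbrakk>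
      \<Longrightarrow> ent X X j i (Idt D X) = (if j = i then Idt C (ob X i) else \<zero>\<^bsub>Mor C (ob X j) (ob X i)\<^esub>)"
    and ent_inj: "\<lbrakk>X \<in> Obj D; Y \<in> Obj D; f \<in> carrier (Mor D Y X); f' \<in> carrier (Mor D Y X);
        \<And>j i. \<lbrakk>j \<in> J; i \<in> J\<rbrakk> \<Longrightarrow> ent Y X j i f = ent Y X j i f'\<rbrakk> \<Longrightarrow> f = f'"
begin

lemma ent_closed: "\<lbrakk>X \<in> Obj D; Y \<in> Obj D; i \<in> J; j \<in> J; f \<in> carrier (Mor D Y X)\<rbrakk>
    \<Longrightarrow> ent Y X j i f \<in> carrier (Mor C (ob Y j) (ob X i))"
  by (rule linear_maps_closed[OF ent_linear])

lemma ent_add: "\<lbrakk>X \<in> Obj D; Y \<in> Obj D; i \<in> J; j \<in> J; f \<in> carrier (Mor D Y X); g \<in> carrier (Mor D Y X)\<rbrakk>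
    \<Longrightarrow> ent Y X j i (f \<oplus>\<^bsub>Mor D Y X\<^esub> g) = ent Y X j i f \<oplus>\<^bsub>Mor C (ob Y j) (ob X i)\<^esub> ent Y X j i g"
  by (rule linear_maps_add[OF ent_linear])

lemma ent_smult: "\<lbrakk>X \<in> Obj D; Y \<in> Obj D; i \<in> J; j \<in> J; c \<in> carrier K; f \<in> carrier (Mor D Y X)\<rbrakk>
    \<Longrightarrow> ent Y X j i (c \<odot>\<^bsub>Mor D Y X\<^esub> f) = c \<odot>\<^bsub>Mor C (ob Y j) (ob X i)\<^esub> ent Y X j i f"
  by (rule linear_maps_smult[OF ent_linear])

text \<open>The source of linearity for maps into \<open>D\<close>: it reduces bilinearity of
  composition in \<open>D\<close> to bilinearity in \<open>C\<close> and linearity of the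
  entries.\<close>

lemma linear_if_ent_linear:
  assumes V: "module K V" and XY: "X \<in> Obj D" "Y \<in> Obj D" and h: "\<And>v. v \<in> carrier V \<Longrightarrow> h v \<in> carrier
      (Mor D Y X)"
    and l: "\<And>j i. \<lbrakk>j \<in> J; i \<in> J\<rbrakk> \<Longrightarrow> (\<lambda>v. ent Y X j i (h v)) \<in> linear_maps K V (Mor C (ob Y j) (ob X i))"
  shows "h \<in> linear_maps K V (Mor D Y X)"
proof -
  interpret V: module K V by fact
  interpret M: module K "Mor D Y X" by (rule D_module[OF XY])
  note la = linear_maps_add[OF l] and ls = linear_maps_smult[OF l]
  show ?thesis
    by (rule linear_mapsI; (rule ent_inj[OF XY])?) (simp_all add: h XY ent_add ent_smult la ls)
qed

text \<open>Matrix algebra over a category: associativity is an interchange of two finite sums, the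
  unit laws keep one diagonal term, and \<open>ent_inj\<close> lifts each identity of entries to
  \<open>D\<close>.\<close>

lemma k_category_D: "k_category K D"
proof (rule k_category.intro[OF field_axioms k_category_axioms.intro], goal_cases)
  case (1 X Y)
  then show ?case by (rule D_module)
next
  case (2 X Y Z g)
  show ?case
  proof (rule linear_if_ent_linear[OF D_module[OF 2(1,2)] 2(1,3) D_Cmp_closed[OF 2]])
    fix k i assume ki: "k \<in> J" "i \<in> J"
    show "(\<lambda>f. ent Z X k i (Cmp D Z Y X g f)) \<in> linear_maps K (Mor D Y X) (Mor C (ob Z k) (ob X i))"
      by (rule linear_maps_cong[OF linear_maps_sum[OF Mor_module finite_J
          linear_maps_comp[OF ent_linear Cmp_linear_right]]])
        (use 2 ki in \<open>simp_all add: ob_closed ent_closed D_module ent_Cmp\<close>)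
  qed
next
  case (3 X Y Z f)
  show ?case
  proof (rule linear_if_ent_linear[OF D_module[OF 3(2,3)] 3(1,3) D_Cmp_closed[OF 3(1,2,3) _ 3(4)]])
    fix k i assume ki: "k \<in> J" "i \<in> J"
    show "(\<lambda>g. ent Z X k i (Cmp D Z Y X g f)) \<in> linear_maps K (Mor D Z Y) (Mor C (ob Z k) (ob X i))"
      by (rule linear_maps_cong[OF linear_maps_sum[OF Mor_module finite_J
          linear_maps_comp[OF ent_linear Cmp_linear_left]]])
        (use 3 ki in \<open>simp_all add: ob_closed ent_closed D_module ent_Cmp\<close>)
  qed
next
  case (4 W X Y Z h g f)
  note [simp] = 4 D_Cmp_closed ent_closed ob_closed Cmp_closed
  show ?case
  proof (rule ent_inj[of W Z])
    fix k i assume ki[simp]: "k \<in> J" "i \<in> J"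
    interpret A: abelian_monoid "Mor C (ob Z k) (ob W i)" using ki 4 by (intro Mor_am ob_closed)
    have "ent Z W k i (Cmp D Z X W (Cmp D Z Y X h g) f) =
      (\<Oplus>\<^bsub>Mor C (ob Z k) (ob W i)\<^esub>j\<in>J. \<Oplus>\<^bsub>Mor C (ob Z k) (ob W i)\<^esub>l\<in>J.
        Cmp C (ob Z k) (ob Y l) (ob W i) (ent Z Y k l h)
            (Cmp C (ob Y l) (ob X j) (ob W i) (ent Y X l j g) (ent X W j i f)))"
      by (simp add: ent_Cmp Cmp_finsum_left finite_J Cmp_assoc Pi_def cong: A.finsum_cong)
    also have "\<dots> = (\<Oplus>\<^bsub>Mor C (ob Z k) (ob W i)\<^esub>l\<in>J. \<Oplus>\<^bsub>Mor C (ob Z k) (ob W i)\<^esub>j\<in>J.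
        Cmp C (ob Z k) (ob Y l) (ob W i) (ent Z Y k l h)
            (Cmp C (ob Y l) (ob X j) (ob W i) (ent Y X l j g) (ent X W j i f)))"
      by (rule A.finsum_swap) (simp_all add: finite_J)
    also have "\<dots> = ent Z W k i (Cmp D Z Y W h (Cmp D Y X W g f))"
      by (simp add: ent_Cmp Cmp_finsum_right finite_J Pi_def cong: A.finsum_cong)
    finally show "ent Z W k i (Cmp D Z X W (Cmp D Z Y X h g) f) = ent Z W k i
        (Cmp D Z Y W h (Cmp D Y X W g f))" .
  qed simp_all
next
  case (5 X)
  then show ?case by (rule D_Idt_closed)
next
  case (6 X Y f)
  note [simp] = 6 D_Cmp_closed ent_closed ob_closed Cmp_closed D_Idt_closed Idt_closed
  show ?case
  proof (rule ent_inj[of X Y])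
    fix k i assume ki[simp]: "k \<in> J" "i \<in> J"
    interpret A: abelian_monoid "Mor C (ob Y k) (ob X i)" using ki 6 by (intro Mor_am ob_closed)
    have "ent Y X k i (Cmp D Y Y X (Idt D Y) f) = Cmp C (ob Y k) (ob Y k) (ob X i)
        (ent Y Y k k (Idt D Y)) (ent Y X k i f)"
      unfolding ent_Cmp[OF 6(1,2,2) D_Idt_closed[OF 6(2)] 6(3) ki(2,1)]
      by (rule A.finsum_single) (simp_all add: finite_J ent_Idt Cmp_zero_left)
    then show "ent Y X k i (Cmp D Y Y X (Idt D Y) f) = ent Y X k i f"
      by (simp add: ent_Idt Idt_left)
  qed simp_all
next
  case (7 X Y f)
  note [simp] = 7 D_Cmp_closed ent_closed ob_closed Cmp_closed D_Idt_closed Idt_closed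
  show ?case
  proof (rule ent_inj[of X Y])
    fix k i assume ki[simp]: "k \<in> J" "i \<in> J"
    interpret A: abelian_monoid "Mor C (ob Y k) (ob X i)" using ki 7 by (intro Mor_am ob_closed)
    have "ent Y X k i (Cmp D Y X X f (Idt D X)) = Cmp C (ob Y k) (ob X i) (ob X i) (ent Y X k i f)
        (ent X X i i (Idt D X))"
      unfolding ent_Cmp[OF 7(1,1,2,3) D_Idt_closed[OF 7(1)] ki(2,1)]
      by (rule A.finsum_single) (simp_all add: finite_J ent_Idt Cmp_zero_right)
    then show "ent Y X k i (Cmp D Y X X f (Idt D X)) = ent Y X k i f"
      by (simp add: ent_Idt Idt_right)
  qed simp_all
qed

end

text \<open>That all matrices occur provides matrix units, and with them the diagonal idempotents
  that cut a \<open>D\<close>-module into pieces. That all objects occur provides a piece for every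
  object of \<open>C\<close>.\<close>

locale full_matrix_presentation = matrix_presentation K C D J ob ent
  for K :: "('k, 'r) ring_scheme" and C :: "('k, 'o, 'm) kcat" and D :: "('k, 'p, 'n) kcat"
    and J :: "'j set" and ob :: "'p \<Rightarrow> 'j \<Rightarrow> 'o" and ent :: "'p \<Rightarrow> 'p \<Rightarrow> 'j \<Rightarrow> 'j \<Rightarrow> 'n \<Rightarrow> 'm" +
  assumes ent_surj: "\<lbrakk>X \<in> Obj D; Y \<in> Obj D;
      \<And>j i. \<lbrakk>j \<in> J; i \<in> J\<rbrakk> \<Longrightarrow> m j i \<in> carrier (Mor C (ob Y j) (ob X i))\<rbrakk>
      \<Longrightarrow> \<exists>f\<in>carrier (Mor D Y X). \<forall>j\<in>J. \<forall>i\<in>J. ent Y X j i f = m j i"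
    and ob_surj: "c \<in> Obj C \<Longrightarrow> \<exists>X\<in>Obj D. \<exists>i\<in>J. ob X i = c"
begin

sublocale D: k_category K D by (rule k_category_D)

section \<open>Matrix units\<close>

lemma ent_zero: "\<lbrakk>X \<in> Obj D; Y \<in> Obj D; i \<in> J; j \<in> J\<rbrakk>
    \<Longrightarrow> ent Y X j i \<zero>\<^bsub>Mor D Y X\<^esub> = \<zero>\<^bsub>Mor C (ob Y j) (ob X i)\<^esub>"
  using linear_maps_zero[OF ent_linear D.Mor_ag Mor_ag] ob_closed by simp

lemma ent_finsum: "\<lbrakk>X \<in> Obj D; Y \<in> Obj D; i \<in> J; j \<in> J; finite A; \<And>a. a \<in> A \<Longrightarrow> f a \<in> carrier (Mor D Y X)\<rbrakk>
    \<Longrightarrow> ent Y X j i (\<Oplus>\<^bsub>Mor D Y X\<^esub>a\<in>A. f a) = (\<Oplus>\<^bsub>Mor C (ob Y j) (ob X i)\<^esub>a\<in>A. ent Y X j i (f a))"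
  using linear_maps_finsum[OF ent_linear D.Mor_ag Mor_ag, of X Y i j A f] ob_closed by simp

text \<open>The matrix unit with entry \<open>f\<close> at \<open>(j, i)\<close>: it exists by
  \<open>ent_surj\<close> and is unique by \<open>ent_inj\<close>.\<close>

definition single :: "'p \<Rightarrow> 'j \<Rightarrow> 'p \<Rightarrow> 'j \<Rightarrow> 'm \<Rightarrow> 'n" where
  "single Y j X i f = (SOME u. u \<in> carrier (Mor D Y X) \<and>
     (\<forall>j'\<in>J. \<forall>i'\<in>J. ent Y X j' i' u = (if j' = j \<and> i' = i then f else \<zero>\<^bsub>Mor C (ob Y j') (ob X i')\<^esub>)))"

lemma single_spec:
  assumes "X \<in> Obj D" "Y \<in> Obj D" "i \<in> J" "j \<in> J" "f \<in> carrier (Mor C (ob Y j) (ob X i))"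
  shows "single Y j X i f \<in> carrier (Mor D Y X) \<and>
    (\<forall>j'\<in>J. \<forall>i'\<in>J. ent Y X j' i' (single Y j X i f) =
      (if j' = j \<and> i' = i then f else \<zero>\<^bsub>Mor C (ob Y j') (ob X i')\<^esub>))"
proof -
  let ?m = "\<lambda>j' i'. if j' = j \<and> i' = i then f else \<zero>\<^bsub>Mor C (ob Y j') (ob X i')\<^esub>"
  have "?m j' i' \<in> carrier (Mor C (ob Y j') (ob X i'))" if "j' \<in> J" "i' \<in> J" for j' i'
    using that assms by (simp add: Mor_zero ob_closed)
  from ent_surj[of X Y ?m, OF assms(1,2) this]
  have "\<exists>u. u \<in> carrier (Mor D Y X) \<and> (\<forall>j'\<in>J. \<forall>i'\<in>J. ent Y X j' i' u = ?m j' i')"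
    by (simp only: Bex_def)
  then show ?thesis unfolding single_def by (rule someI_ex)
qed

lemma single_closed:
  "\<lbrakk>X \<in> Obj D; Y \<in> Obj D; i \<in> J; j \<in> J; f \<in> carrier (Mor C (ob Y j) (ob X i))\<rbrakk>
    \<Longrightarrow> single Y j X i f \<in> carrier (Mor D Y X)"
  using single_spec by blast

lemma ent_single:
  "\<lbrakk>X \<in> Obj D; Y \<in> Obj D; i \<in> J; j \<in> J; f \<in> carrier (Mor C (ob Y j) (ob X i)); j' \<in> J; i' \<in> J\<rbrakk>
    \<Longrightarrow> ent Y X j' i' (single Y j X i f) = (if j' = j \<and> i' = i then f else \<zero>\<^bsub>Mor C (ob Y j') (ob X i')\<^esub>)"
  using single_spec by blast

lemma single_linear:
  assumes [simp]: "X \<in> Obj D" "Y \<in> Obj D" "i \<in> J" "j \<in> J"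
  shows "single Y j X i \<in> linear_maps K (Mor C (ob Y j) (ob X i)) (Mor D Y X)"
proof (rule linear_mapsI)
  fix f g assume [simp]: "f \<in> carrier (Mor C (ob Y j) (ob X i))" "g \<in> carrier (Mor C (ob Y j) (ob X i))"
  show "single Y j X i (f \<oplus>\<^bsub>Mor C (ob Y j) (ob X i)\<^esub> g) = single Y j X i f \<oplus>\<^bsub>Mor D Y X\<^esub> single Y j X i
      g"
    by (rule ent_inj[of X Y])
      (auto simp: single_closed ob_closed Mor_add D.Mor_add ent_add ent_single
        abelian_monoid.l_zero[OF Mor_am] Mor_zero)
next
  fix c f assume [simp]: "c \<in> carrier K" "f \<in> carrier (Mor C (ob Y j) (ob X i))"
  show "single Y j X i (c \<odot>\<^bsub>Mor C (ob Y j) (ob X i)\<^esub> f) = c \<odot>\<^bsub>Mor D Y X\<^esub> single Y j X i f"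
    by (rule ent_inj[of X Y])
      (auto simp: single_closed ob_closed Mor_smult D.Mor_smult ent_smult ent_single
        module.smult_r_null[OF Mor_module])
qed (simp add: single_closed)

text \<open>A matrix unit on the right moves column \<open>j\<close> of \<open>h\<close>, multiplied
  by \<open>f\<close>, into column \<open>i\<close> and clears the rest.
  \<open>Cmp_single_left\<close> is the mirror image for rows.\<close>

lemma Cmp_single_right:
  assumes [simp]: "X \<in> Obj D" "Y \<in> Obj D" "Z \<in> Obj D" "h \<in> carrier (Mor D Z Y)" "i \<in> J" "j \<in> J"
    "f \<in> carrier (Mor C (ob Y j) (ob X i))"
  shows "Cmp D Z Y X h (single Y j X i f) =
    (\<Oplus>\<^bsub>Mor D Z X\<^esub>k\<in>J. single Z k X i (Cmp C (ob Z k) (ob Y j) (ob X i) (ent Z Y k j h) f))"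
    (is "_ = (\<Oplus>\<^bsub>_\<^esub>k\<in>J. single Z k X i (?c k))")
proof (rule ent_inj[of X Z])
  note [simp] = single_closed D.Cmp_closed Cmp_closed ob_closed ent_closed finite_J
  have c[simp]: "?c k \<in> carrier (Mor C (ob Z k) (ob X i))" if "k \<in> J" for k
    using that by simp
  fix k' i' assume [simp]: "k' \<in> J" "i' \<in> J"
  interpret A: abelian_monoid "Mor C (ob Z k') (ob X i')" by (intro Mor_am ob_closed) simp_all
  have "ent Z X k' i' (Cmp D Z Y X h (single Y j X i f)) =
    Cmp C (ob Z k') (ob Y j) (ob X i') (ent Z Y k' j h) (ent Y X j i' (single Y j X i f))"
    by (subst ent_Cmp, simp_all) (rule A.finsum_single, simp_all add: ent_single Cmp_zero_right
        Mor_zero)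
  moreover have "ent Z X k' i' (\<Oplus>\<^bsub>Mor D Z X\<^esub>k\<in>J. single Z k X i (?c k)) = ent Z X k' i'
      (single Z k' X i (?c k'))"
    by (subst ent_finsum, simp_all) (rule A.finsum_single, simp_all add: ent_single)
  ultimately show "ent Z X k' i' (Cmp D Z Y X h (single Y j X i f)) =
      ent Z X k' i' (\<Oplus>\<^bsub>Mor D Z X\<^esub>k\<in>J. single Z k X i (?c k))"
    by (auto simp: ent_single Cmp_zero_right)
qed (simp_all add: D.Cmp_closed single_closed Cmp_closed ob_closed ent_closed D.Mor_finsum)

lemma Cmp_single_left:
  assumes [simp]: "X \<in> Obj D" "Y \<in> Obj D" "Z \<in> Obj D" "h \<in> carrier (Mor D Y X)" "k \<in> J" "j \<in> J"
    "g \<in> carrier (Mor C (ob Z k) (ob Y j))"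
  shows "Cmp D Z Y X (single Z k Y j g) h =
    (\<Oplus>\<^bsub>Mor D Z X\<^esub>i\<in>J. single Z k X i (Cmp C (ob Z k) (ob Y j) (ob X i) g (ent Y X j i h)))"
    (is "_ = (\<Oplus>\<^bsub>_\<^esub>i\<in>J. single Z k X i (?c i))")
proof (rule ent_inj[of X Z])
  note [simp] = single_closed D.Cmp_closed Cmp_closed ob_closed ent_closed finite_J
  have c[simp]: "?c i \<in> carrier (Mor C (ob Z k) (ob X i))" if "i \<in> J" for i
    using that by simp
  fix k' i' assume [simp]: "k' \<in> J" "i' \<in> J"
  interpret A: abelian_monoid "Mor C (ob Z k') (ob X i')" by (intro Mor_am ob_closed) simp_all
  have "ent Z X k' i' (Cmp D Z Y X (single Z k Y j g) h) =
    Cmp C (ob Z k') (ob Y j) (ob X i') (ent Z Y k' j (single Z k Y j g)) (ent Y X j i' h)"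
    by (subst ent_Cmp, simp_all) (rule A.finsum_single, simp_all add: ent_single Cmp_zero_left Mor_zero)
  moreover have "ent Z X k' i' (\<Oplus>\<^bsub>Mor D Z X\<^esub>i\<in>J. single Z k X i (?c i)) = ent Z X k' i'
      (single Z k X i' (?c i'))"
    by (subst ent_finsum, simp_all) (rule A.finsum_single, simp_all add: ent_single)
  ultimately show "ent Z X k' i' (Cmp D Z Y X (single Z k Y j g) h) =
      ent Z X k' i' (\<Oplus>\<^bsub>Mor D Z X\<^esub>i\<in>J. single Z k X i (?c i))"
    by (auto simp: ent_single Cmp_zero_left)
qed (simp_all add: D.Cmp_closed single_closed Cmp_closed ob_closed ent_closed D.Mor_finsum)

lemma single_Cmp:
  assumes [simp]: "X \<in> Obj D" "Y \<in> Obj D" "Z \<in> Obj D" "i \<in> J" "j \<in> J" "j' \<in> J" "k \<in> J"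
    and f[simp]: "f \<in> carrier (Mor C (ob Y j) (ob X i))" and g[simp]: "g \<in> carrier
        (Mor C (ob Z k) (ob Y j'))"
  shows "Cmp D Z Y X (single Z k Y j' g) (single Y j X i f) =
    (if j' = j then single Z k X i (Cmp C (ob Z k) (ob Y j) (ob X i) g f) else \<zero>\<^bsub>Mor D Z X\<^esub>)"
proof -
  \<comment> \<open>The composite of \<open>g\<close> and \<open>f\<close> is typed only for
    \<open>j' = j\<close>, so the typing of \<open>g\<close> at \<open>j\<close> is available only
    under this condition.\<close>
  have [simp]: "j' = j \<Longrightarrow> g \<in> carrier (Mor C (ob Z k) (ob Y j))"
    using g by simp
  show ?thesis
  proof (rule ent_inj[of X Z])
    note [simp] = single_closed D.Cmp_closed Cmp_closed ob_closed ent_closed finite_J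
    fix k' i' assume [simp]: "k' \<in> J" "i' \<in> J"
    interpret A: abelian_monoid "Mor C (ob Z k') (ob X i')" by (intro Mor_am ob_closed) simp_all
    have "ent Z X k' i' (Cmp D Z Y X (single Z k Y j' g) (single Y j X i f)) =
      Cmp C (ob Z k') (ob Y j) (ob X i') (ent Z Y k' j (single Z k Y j' g))
          (ent Y X j i' (single Y j X i f))"
      by (subst ent_Cmp, simp_all) (rule A.finsum_single, simp_all add: ent_single Cmp_zero_right
          Mor_zero)
    then show "ent Z X k' i' (Cmp D Z Y X (single Z k Y j' g) (single Y j X i f)) =
        ent Z X k' i' (if j' = j then single Z k X i (Cmp C (ob Z k) (ob Y j) (ob X i) g f) else
            \<zero>\<^bsub>Mor D Z X\<^esub>)"
      by (auto simp: ent_single Cmp_zero_right Cmp_zero_left Mor_zero ent_zero)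
  qed (auto simp: D.Cmp_closed single_closed Cmp_closed ob_closed D.Mor_zero)
qed

lemma Idt_single:
  assumes [simp]: "X \<in> Obj D"
  shows "Idt D X = (\<Oplus>\<^bsub>Mor D X X\<^esub>i\<in>J. single X i X i (Idt C (ob X i)))"
proof (rule ent_inj[of X X])
  note [simp] = single_closed Idt_closed ob_closed ent_closed finite_J
  fix j i assume [simp]: "j \<in> J" "i \<in> J"
  interpret A: abelian_monoid "Mor C (ob X j) (ob X i)" by (intro Mor_am ob_closed) simp_all
  have "ent X X j i (\<Oplus>\<^bsub>Mor D X X\<^esub>l\<in>J. single X l X l (Idt C (ob X l))) =
    ent X X j i (single X i X i (Idt C (ob X i)))"
    by (subst ent_finsum, simp_all) (rule A.finsum_single, auto simp: ent_single)
  then show "ent X X j i (Idt D X) = ent X X j i (\<Oplus>\<^bsub>Mor D X X\<^esub>l\<in>J. single X l X l (Idt C (ob X l)))"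
    by (auto simp: ent_single ent_Idt)
qed (simp_all add: D.Idt_closed Idt_closed ob_closed single_closed D.Mor_finsum)

section \<open>Corners of \<open>D\<close> and the embedding of \<open>C\<close>\<close>

definition rX :: "'o \<Rightarrow> 'p" where
  "rX c = (SOME X. X \<in> Obj D \<and> (\<exists>i\<in>J. ob X i = c))"

text \<open>An object of \<open>C\<close> may occur in many families and repeatedly in one;
  \<open>rX\<close> and \<open>rI\<close> fix the single occurrence at which modules are
  cut.\<close>

definition rI :: "'o \<Rightarrow> 'j" where
  "rI c = (SOME i. i \<in> J \<and> ob (rX c) i = c)"

lemma rX_rI [simp]:
  assumes "c \<in> Obj C"
  shows "rX c \<in> Obj D" "rI c \<in> J" "ob (rX c) (rI c) = c"
proof -
  have 1: "rX c \<in> Obj D \<and> (\<exists>i\<in>J. ob (rX c) i = c)"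
    unfolding rX_def by (rule someI_ex) (use ob_surj[OF assms] in blast)
  then have "\<exists>i. i \<in> J \<and> ob (rX c) i = c" by auto
  then have "rI c \<in> J \<and> ob (rX c) (rI c) = c"
    unfolding rI_def by (rule someI_ex)
  with 1 show "rX c \<in> Obj D" "rI c \<in> J" "ob (rX c) (rI c) = c" by auto
qed

text \<open>
  \<open>corner\<close> embeds \<open>C\<close> into \<open>D\<close> without preserving identities: the object \<open>c\<close> becomes the image
  of the idempotent \<open>corner c c (Idt C c)\<close> of \<open>rX c\<close>, and \<open>out X i\<close> and \<open>inn X i\<close> identify the
  \<open>i\<close>-th summand of \<open>X\<close> with the image of the idempotent belonging to \<open>ob X i\<close>.
\<close>

definition corner :: "'o \<Rightarrow> 'o \<Rightarrow> 'm \<Rightarrow> 'n" where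
  "corner c' c f = single (rX c') (rI c') (rX c) (rI c) f"

definition out :: "'p \<Rightarrow> 'j \<Rightarrow> 'n" where
  "out X i = single (rX (ob X i)) (rI (ob X i)) X i (Idt C (ob X i))"

definition inn :: "'p \<Rightarrow> 'j \<Rightarrow> 'n" where
  "inn X i = single X i (rX (ob X i)) (rI (ob X i)) (Idt C (ob X i))"

lemma corner_linear: "\<lbrakk>c \<in> Obj C; c' \<in> Obj C\<rbrakk>
    \<Longrightarrow> corner c' c \<in> linear_maps K (Mor C c' c) (Mor D (rX c') (rX c))"
  using single_linear[of "rX c" "rX c'" "rI c" "rI c'"] unfolding corner_def by simp

lemma corner_closed: "\<lbrakk>c \<in> Obj C; c' \<in> Obj C; f \<in> carrier (Mor C c' c)\<rbrakk>
    \<Longrightarrow> corner c' c f \<in> carrier (Mor D (rX c') (rX c))"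
  by (rule linear_maps_closed[OF corner_linear])

lemma corner_Cmp: "\<lbrakk>c \<in> Obj C; c' \<in> Obj C; c'' \<in> Obj C; g \<in> carrier (Mor C c'' c'); f \<in> carrier
    (Mor C c' c)\<rbrakk>
    \<Longrightarrow> Cmp D (rX c'') (rX c') (rX c) (corner c'' c' g) (corner c' c f) = corner c'' c
        (Cmp C c'' c' c g f)"
  by (simp add: corner_def single_Cmp)

lemma out_closed: "\<lbrakk>X \<in> Obj D; i \<in> J\<rbrakk> \<Longrightarrow> out X i \<in> carrier (Mor D (rX (ob X i)) X)"
  by (simp add: out_def single_closed ob_closed Idt_closed)

lemma inn_closed: "\<lbrakk>X \<in> Obj D; i \<in> J\<rbrakk> \<Longrightarrow> inn X i \<in> carrier (Mor D X (rX (ob X i)))"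
  by (simp add: inn_def single_closed ob_closed Idt_closed)

text \<open>Ensures that in any module \<open>out X i\<close> acts with values in the corner
  belonging to \<open>ob X i\<close>.\<close>

lemma corner_out: "\<lbrakk>X \<in> Obj D; i \<in> J\<rbrakk>
    \<Longrightarrow> Cmp D (rX (ob X i)) (rX (ob X i)) X (corner (ob X i) (ob X i) (Idt C (ob X i))) (out X i) = out X
        i"
  by (simp add: corner_def out_def single_Cmp ob_closed Idt_closed Idt_left)

text \<open>Each product of \<open>inn X i\<close> and \<open>out X i\<close> is the
  \<open>i\<close>-th diagonal idempotent of \<open>X\<close>. In a \<open>D\<close>-module this
  expands a vector \<open>v\<close> as the sum of the \<open>inn (out v)\<close>, on which full
  faithfulness rests.\<close>

lemma inn_out: "X \<in> Obj D \<Longrightarrow> (\<Oplus>\<^bsub>Mor D X X\<^esub>i\<in>J. Cmp D X (rX (ob X i)) X (inn X i) (out X i)) = Idt D X"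
  unfolding Idt_single
  by (rule abelian_monoid.finsum_cong'[OF D.Mor_am])
    (auto simp: inn_def out_def single_Cmp ob_closed Idt_closed Idt_left single_closed)

text \<open>With \<open>out_Cmp\<close>, this trades an arbitrary morphism of \<open>D\<close> for
  its entries embedded by \<open>corner\<close>, to which the naturality of a homomorphism of
  \<open>C\<close>-modules applies.\<close>

lemma Cmp_inn:
  assumes [simp]: "X \<in> Obj D" "Y \<in> Obj D" "i \<in> J" "f \<in> carrier (Mor D Y X)"
  shows "Cmp D Y X (rX (ob X i)) f (inn X i) = (\<Oplus>\<^bsub>Mor D Y (rX (ob X i))\<^esub>j\<in>J.
    Cmp D Y (rX (ob Y j)) (rX (ob X i)) (inn Y j) (corner (ob Y j) (ob X i) (ent Y X j i f)))"
  unfolding inn_def corner_def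
  by (subst Cmp_single_right, simp_all add: ob_closed Idt_closed)
    (rule abelian_monoid.finsum_cong'[OF D.Mor_am],
      auto simp: single_Cmp ob_closed Idt_closed Idt_left Idt_right single_closed ent_closed)

lemma out_Cmp:
  assumes [simp]: "X \<in> Obj D" "Y \<in> Obj D" "j \<in> J" "f \<in> carrier (Mor D Y X)"
  shows "Cmp D (rX (ob Y j)) Y X (out Y j) f = (\<Oplus>\<^bsub>Mor D (rX (ob Y j)) X\<^esub>i\<in>J.
    Cmp D (rX (ob Y j)) (rX (ob X i)) X (corner (ob Y j) (ob X i) (ent Y X j i f)) (out X i))"
  unfolding out_def corner_def
  by (subst Cmp_single_left, simp_all add: ob_closed Idt_closed)
    (rule abelian_monoid.finsum_cong'[OF D.Mor_am],
      auto simp: single_Cmp ob_closed Idt_closed Idt_left Idt_right single_closed ent_closed)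

text \<open>Orthogonality of distinct diagonal idempotents: on the corner at \<open>c\<close> every
  projection except the one at \<open>rI c\<close> vanishes.\<close>

lemma out_corner: "\<lbrakk>c \<in> Obj C; i \<in> J; i \<noteq> rI c\<rbrakk>
    \<Longrightarrow> Cmp D (rX (ob (rX c) i)) (rX c) (rX c) (out (rX c) i) (corner c c (Idt C c)) =
        \<zero>\<^bsub>Mor D (rX (ob (rX c) i)) (rX c)\<^esub>"
  by (simp add: out_def corner_def single_Cmp ob_closed Idt_closed)

lemma out_inn_rI:
  "c \<in> Obj C \<Longrightarrow> out (rX c) (rI c) = corner c c (Idt C c)"
  "c \<in> Obj C \<Longrightarrow> inn (rX c) (rI c) = corner c c (Idt C c)"
  by (simp_all add: out_def inn_def corner_def)

text \<open>The image of the idempotent, described by its fixed vectors. As a subset of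
  \<open>FObj M (rX c)\<close> it stays in the universe \<open>'v\<close>.\<close>

definition corner_space :: "('k, 'p, 'n, 'v) cmod \<Rightarrow> 'o \<Rightarrow> ('k, 'v) module" where
  "corner_space M c = (FObj M (rX c))\<lparr>carrier :=
     {v \<in> carrier (FObj M (rX c)). FMor M (rX c) (rX c) (corner c c (Idt C c)) v = v}\<rparr>"

definition corner_module ::
    "('k, 'p, 'n, 'v) cmod \<Rightarrow> ('k, 'o, 'm, 'v) cmod" where
  "corner_module M = \<lparr>FObj = corner_space M,
     FMor = (\<lambda>c' c f. \<lambda>v\<in>carrier (corner_space M c). FMor M (rX c') (rX c) (corner c' c f) v)\<rparr>"

definition corner_functor where
  "corner_functor = \<lparr>FObj = corner_module,
     FMor = (\<lambda>N M \<tau>. \<lambda>c\<in>Obj C. \<lambda>v\<in>carrier (corner_space M c). \<tau> (rX c) v)\<rparr>"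

section \<open>Restriction of modules to corners\<close>

lemma corner_space_simps:
  "carrier (corner_space M c) = {v \<in> carrier (FObj M (rX c)). FMor M (rX c) (rX c)
      (corner c c (Idt C c)) v = v}"
  "\<zero>\<^bsub>corner_space M c\<^esub> = \<zero>\<^bsub>FObj M (rX c)\<^esub>"
  "u \<oplus>\<^bsub>corner_space M c\<^esub> v = u \<oplus>\<^bsub>FObj M (rX c)\<^esub> v"
  "a \<odot>\<^bsub>corner_space M c\<^esub> v = a \<odot>\<^bsub>FObj M (rX c)\<^esub> v"
  by (simp_all add: corner_space_def)

lemma corner_module_simps:
  "FObj (corner_module M) = corner_space M"
  "v \<in> carrier (corner_space M c) \<Longrightarrow> FMor (corner_module M) c' c f v = FMor M (rX c') (rX c)
      (corner c' c f) v"
  by (simp_all add: corner_module_def)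

lemma corner_functor_simps:
  "FObj corner_functor = corner_module"
  "FMor corner_functor N M \<tau> = (\<lambda>c\<in>Obj C. \<lambda>v\<in>carrier (corner_space M c). \<tau> (rX c) v)"
  by (simp_all add: corner_functor_def)

context
  fixes M :: "('k, 'p, 'n, 'v) cmod"
  assumes M: "left_module K D M"
begin

interpretation M: category_module K D M
  by (rule D.category_moduleI[OF M])

lemma corner_spaceD: "v \<in> carrier (corner_space M c) \<Longrightarrow> v \<in> carrier (FObj M (rX c))"
  by (simp add: corner_space_simps)

lemma corner_spaceD_fix:
  "v \<in> carrier (corner_space M c) \<Longrightarrow> FMor M (rX c) (rX c) (corner c c (Idt C c)) v = v"
  by (simp add: corner_space_simps)

text \<open>The idempotent of \<open>c'\<close> absorbs every morphism with target \<open>c'\<close>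
  from the left.\<close>

lemma corner_act_closed:
  assumes "c \<in> Obj C" "c' \<in> Obj C" "f \<in> carrier (Mor C c' c)" "v \<in> carrier (FObj M (rX c))"
  shows "FMor M (rX c') (rX c) (corner c' c f) v \<in> carrier (corner_space M c')"
  using assms
  by (simp add: corner_space_simps M.act_closed corner_closed M.act_Cmp[symmetric] corner_Cmp Idt_closed
      Idt_left)

lemma out_act_closed:
  assumes "X \<in> Obj D" "i \<in> J" "v \<in> carrier (FObj M X)"
  shows "FMor M (rX (ob X i)) X (out X i) v \<in> carrier (corner_space M (ob X i))"
  using assms
  by (simp add: corner_space_simps M.act_closed corner_closed out_closed ob_closed M.act_Cmp[symmetric]
      Idt_closed corner_out)

lemma corner_space_module:
  assumes c: "c \<in> Obj C"
  shows "module K (corner_space M c)"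
proof -
  interpret V: module K "FObj M (rX c)" using M.space c by simp
  note e = corner_closed[OF c c Idt_closed[OF c]]
  have "submodule {v \<in> carrier (FObj M (rX c)). FMor M (rX c) (rX c) (corner c c (Idt C c)) v = v} K
      (FObj M (rX c))"
    using c e V.module_axioms linear_maps_neg[OF M.act_linear[OF _ _ e]]
    by (intro V.submoduleI) (auto simp: M.act_zero M.act_add M.act_smult)
  then show ?thesis
    unfolding corner_space_def by (rule submodule.submodule_is_module[OF _ V.module_axioms])
qed

text \<open>Allows a finite sum formed in the corner to be compared with the same sum formed in the
  ambient space.\<close>

lemma corner_space_incl_linear: "(\<lambda>v. v) \<in> linear_maps K (corner_space M c) (FObj M (rX c))"
  by (rule linear_mapsI) (simp_all add: corner_spaceD corner_space_simps(3,4))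

lemma out_act_linear:
  "\<lbrakk>X \<in> Obj D; i \<in> J\<rbrakk>
    \<Longrightarrow> FMor M (rX (ob X i)) X (out X i) \<in> linear_maps K (FObj M X) (corner_space M (ob X i))"
  by (rule linear_mapsI)
    (simp_all add: out_act_closed corner_space_simps(3,4) M.act_add M.act_smult out_closed ob_closed)

lemma corner_module_functor: "left_module K C (corner_module M)"
proof (rule left_moduleI)
  show "k_category K C" ..
next
  fix x y f assume *: "x \<in> Obj C" "y \<in> Obj C" "f \<in> carrier (Mor C y x)"
  interpret V: module K "corner_space M x" by (rule corner_space_module[OF *(1)])
  show "FMor (corner_module M) y x f \<in> linear_maps K (FObj (corner_module M) x)
      (FObj (corner_module M) y)"
    using * V.a_closed V.smult_closed
    by (intro linear_mapsI)
      (simp_all add: corner_module_simps corner_act_closed corner_spaceD corner_space_simps(3,4)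
        M.act_add M.act_smult corner_closed)
next
  fix x y v assume *: "x \<in> Obj C" "y \<in> Obj C" "v \<in> carrier (FObj (corner_module M) x)"
  then show "(\<lambda>f. FMor (corner_module M) y x f v) \<in> linear_maps K (Mor C y x)
      (FObj (corner_module M) y)"
    by (intro linear_mapsI)
      (simp_all add: corner_module_simps corner_act_closed corner_spaceD corner_space_simps(3,4)
          corner_closed
        linear_maps_add[OF corner_linear] linear_maps_smult[OF corner_linear] M.act_Mor_add
            M.act_Mor_smult)
qed (simp_all add: corner_module_simps(1) corner_space_module,
   simp_all add: corner_module_simps corner_spaceD_fix corner_act_closed corner_spaceD
       M.act_Cmp[symmetric] corner_closed corner_Cmp,
   simp add: corner_module_def)

end

lemma corner_functor_functor:
  "k_functor K (left_modules K D) (left_modules K C)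
    (corner_functor :: (('k, 'p, 'n, 'v) cmod, 'p \<Rightarrow> 'v \<Rightarrow> 'v,
      ('k, 'o, 'm, 'v) cmod, 'o \<Rightarrow> 'v \<Rightarrow> 'v) kfun)"
proof -
  let ?F = "corner_functor :: (('k, 'p, 'n, 'v) cmod, 'p \<Rightarrow> 'v \<Rightarrow> 'v,
      ('k, 'o, 'm, 'v) cmod, 'o \<Rightarrow> 'v \<Rightarrow> 'v) kfun"
  \<comment> \<open>A homomorphism commutes with the idempotent, so it preserves the fixed
    vectors.\<close>
  have corner_hom: "\<tau> (rX c) v \<in> carrier (corner_space N c)"
    if M: "left_module K D M" and N: "left_module K D N" and \<tau>: "\<tau> \<in> module_homs K D M N"
      and c: "c \<in> Obj C" and v: "v \<in> carrier (corner_space M c)" for M N \<tau> c v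
    using module_homsD(3)[OF \<tau> M, of "rX c" "rX c" "corner c c (Idt C c)" v] c v
    by (simp add: corner_space_simps corner_closed Idt_closed module_homsD(4)[OF \<tau> M])
  have hom: "FMor ?F N M \<tau> \<in> module_homs K C (corner_module M) (corner_module N)"
    if M: "left_module K D M" and N: "left_module K D N" and \<tau>: "\<tau> \<in> module_homs K D M N" for M N \<tau>
  proof (rule module_homsI)
    fix c assume c: "c \<in> Obj C"
    interpret V: module K "corner_space M c" by (rule corner_space_module[OF M c])
    note lin = module_homsD(1)[OF \<tau> M rX_rI(1)[OF c]]
    show "FMor ?F N M \<tau> c \<in> linear_maps K (FObj (corner_module M) c) (FObj (corner_module N) c)"
      using c V.a_closed V.smult_closed
      by (intro linear_mapsI)
       (simp_all add: corner_functor_simps corner_module_simps corner_hom[OF M N \<tau>] corner_spaceD[OF M]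
          corner_space_simps(3,4) linear_maps_add[OF lin] linear_maps_smult[OF lin])
  qed (simp_all add: corner_functor_simps corner_module_simps corner_act_closed[OF M]
      corner_spaceD[OF M]
      module_homsD(3)[OF \<tau> M] corner_closed corner_hom[OF M N \<tau>])
  interpret L: k_category K "left_modules K D :: ('k, 'p, 'n, 'v) cmods"
    by (rule left_modules_k_category[OF field_axioms])
  have lm: "left_module K D M \<Longrightarrow> M \<in> Obj (left_modules K D)" for M
    by (simp add: left_modules_simps)
  show ?thesis
  proof (rule k_functorI)
    fix M N assume "M \<in> Obj (left_modules K D :: ('k, 'p, 'n, 'v) cmods)"
      and "N \<in> Obj (left_modules K D :: ('k, 'p, 'n, 'v) cmods)"
    then have M: "left_module K D M" and N: "left_module K D N" by (simp_all add: left_modules_simps)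
    show "FMor ?F N M \<in> linear_maps K (Mor (left_modules K D) N M)
        (Mor (left_modules K C) (FObj ?F N) (FObj ?F M))"
      by (rule linear_mapsI)
        (auto simp: left_modules_simps hom[OF M N] corner_functor_simps(1),
         auto simp: corner_functor_simps corner_module_simps corner_spaceD[OF M] corner_space_simps(3,4)
             fun_eq_iff restrict_def)
  next
    fix M assume "M \<in> Obj (left_modules K D :: ('k, 'p, 'n, 'v) cmods)"
    then have M: "left_module K D M" by (simp add: left_modules_simps)
    show "FMor ?F M M (Idt (left_modules K D) M) = Idt (left_modules K C) (FObj ?F M)"
      by (auto simp: left_modules_simps corner_functor_simps corner_module_simps corner_spaceD[OF M]
          fun_eq_iff restrict_def)
  next
    fix M N P \<sigma> \<tau>
    assume "M \<in> Obj (left_modules K D :: ('k, 'p, 'n, 'v) cmods)"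
      and "N \<in> Obj (left_modules K D :: ('k, 'p, 'n, 'v) cmods)"
      and "P \<in> Obj (left_modules K D :: ('k, 'p, 'n, 'v) cmods)"
      and "\<sigma> \<in> carrier (Mor (left_modules K D) P N)" and "\<tau> \<in> carrier (Mor (left_modules K D) N M)"
    then have M: "left_module K D M" and N: "left_module K D N" and \<tau>: "\<tau> \<in> module_homs K D M N"
      by (simp_all add: left_modules_simps)
    show "FMor ?F P M (Cmp (left_modules K D) P N M \<sigma> \<tau>) =
        Cmp (left_modules K C) (FObj ?F P) (FObj ?F N) (FObj ?F M) (FMor ?F P N \<sigma>) (FMor ?F N M \<tau>)"
      by (auto simp: left_modules_simps corner_functor_simps corner_module_simps compose_def
          corner_spaceD[OF M] corner_hom[OF M N \<tau>] fun_eq_iff restrict_def)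
  qed (simp add: left_modules_simps corner_functor_simps corner_module_functor)
qed

text \<open>By \<open>inn_out\<close> and naturality, a homomorphism at \<open>X\<close> is
  determined by its values on the vectors \<open>out v\<close>, and these lie in corners.\<close>

lemma corner_functor_faithful:
  assumes M: "left_module K D M" and N: "left_module K D N"
    and \<sigma>: "\<sigma> \<in> module_homs K D M N" and \<tau>: "\<tau> \<in> module_homs K D M N"
    and eq: "FMor corner_functor N M \<sigma> = FMor corner_functor N M \<tau>"
  shows "\<sigma> = \<tau>"
proof (rule module_homs_eqI[OF \<sigma> \<tau> M])
  interpret M: category_module K D M
    by (rule D.category_moduleI[OF M])
  interpret N: category_module K D N
    by (rule D.category_moduleI[OF N])
  have eq': "\<sigma> (rX c) v = \<tau> (rX c) v" if "c \<in> Obj C" "v \<in> carrier (corner_space M c)" for c v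
    using fun_cong[OF fun_cong[OF eq], of c v] that by (simp add: corner_functor_simps)
  fix X v assume [simp]: "X \<in> Obj D" "v \<in> carrier (FObj M X)"
  have expand: "\<rho> X v = (\<Oplus>\<^bsub>FObj N X\<^esub>i\<in>J. FMor N X (rX (ob X i)) (inn X i)
      (\<rho> (rX (ob X i)) (FMor M (rX (ob X i)) X (out X i) v)))"
    if \<rho>: "\<rho> \<in> module_homs K D M N" for \<rho>
  proof -
    note [simp] = module_homsD(4)[OF \<rho> M] inn_closed out_closed ob_closed D.Cmp_closed
    have "\<rho> X v = FMor N X X (\<Oplus>\<^bsub>Mor D X X\<^esub>i\<in>J. Cmp D X (rX (ob X i)) X (inn X i) (out X i)) (\<rho> X v)"
      by (simp add: inn_out N.act_Idt)
    also have "\<dots> = (\<Oplus>\<^bsub>FObj N X\<^esub>i\<in>J. FMor N X X (Cmp D X (rX (ob X i)) X (inn X i) (out X i)) (\<rho> X v))"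
      by (rule N.act_Mor_finsum) (simp_all add: finite_J)
    also have "\<dots> = (\<Oplus>\<^bsub>FObj N X\<^esub>i\<in>J. FMor N X (rX (ob X i)) (inn X i)
        (\<rho> (rX (ob X i)) (FMor M (rX (ob X i)) X (out X i) v)))"
      by (rule abelian_monoid.finsum_cong'[OF N.space_am])
        (auto simp: N.act_Cmp module_homsD(3)[OF \<rho> M] N.act_closed M.act_closed)
    finally show ?thesis .
  qed
  show "\<sigma> X v = \<tau> X v"
    unfolding expand[OF \<sigma>] expand[OF \<tau>]
    by (rule abelian_monoid.finsum_cong'[OF N.space_am])
      (auto simp: eq' out_act_closed[OF M] ob_closed inn_closed N.act_closed module_homsD(4)[OF \<tau> M]
        M.act_closed out_closed)
qed

text \<open>The expansion that gives uniqueness also serves as the definition of the extension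
  \<open>\<tau>0\<close>: project with \<open>out\<close>, apply \<open>\<sigma>\<close> in the
  corners, and reassemble with \<open>inn\<close>.\<close>

lemma corner_functor_full:
  assumes M: "left_module K D M" and N: "left_module K D N"
    and \<sigma>: "\<sigma> \<in> module_homs K C (corner_module M) (corner_module N)"
  shows "\<exists>\<tau>\<in>module_homs K D M N. FMor corner_functor N M \<tau> = \<sigma>"
proof -
  interpret M: category_module K D M
    by (rule D.category_moduleI[OF M])
  interpret N: category_module K D N
    by (rule D.category_moduleI[OF N])
  note cM = corner_module_functor[OF M]
  define \<tau>0 where "\<tau>0 X v = (\<Oplus>\<^bsub>FObj N X\<^esub>i\<in>J. FMor N X (rX (ob X i)) (inn X i)
    (\<sigma> (ob X i) (FMor M (rX (ob X i)) X (out X i) v)))" for X v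
  define \<tau> where "\<tau> = (\<lambda>X\<in>Obj D. \<lambda>v\<in>carrier (FObj M X). \<tau>0 X v)"
  note [simp] = ob_closed inn_closed out_closed D.Cmp_closed M.act_closed N.act_closed finite_J
    out_act_closed[OF M] corner_act_closed[OF M] corner_closed ent_closed
  have \<sigma>c': "\<sigma> c v \<in> carrier (corner_space N c)" if "c \<in> Obj C" "v \<in> carrier (corner_space M c)" for c v
    using module_homsD(4)[OF \<sigma> cM] that by (simp add: corner_module_simps)
  then have \<sigma>c[simp]: "\<sigma> c v \<in> carrier (FObj N (rX c))" if "c \<in> Obj C" "v \<in> carrier (corner_space M c)"
      for c v
    using corner_spaceD[OF N] that by blast
  have \<sigma>nat: "\<sigma> c' (FMor M (rX c') (rX c) (corner c' c f) v) = FMor N (rX c') (rX c) (corner c' c f)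
      (\<sigma> c v)"
    if "c \<in> Obj C" "c' \<in> Obj C" "f \<in> carrier (Mor C c' c)" "v \<in> carrier (corner_space M c)" for c c' f v
    using module_homsD(3)[OF \<sigma> cM that(1-3), of v] that by (simp add: corner_module_simps \<sigma>c')
  have \<sigma>lin: "\<sigma> c \<in> linear_maps K (corner_space M c) (FObj N (rX c))" if "c \<in> Obj C" for c
    using linear_maps_comp[OF module_homsD(1)[OF \<sigma> cM that, unfolded corner_module_simps]
        corner_space_incl_linear[OF N]] .
  have lin: "\<tau>0 X \<in> linear_maps K (FObj M X) (FObj N X)" if [simp]: "X \<in> Obj D" for X
    unfolding \<tau>0_def
    by (intro linear_maps_sum N.space linear_maps_comp[OF linear_maps_comp[OF out_act_linear[OF M] \<sigma>lin]
        N.act_linear])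
      simp_all
  \<comment> \<open>Both sides equal one double sum over the entries of \<open>f\<close>: on the
    right \<open>f\<close> is moved past \<open>inn\<close> by \<open>Cmp_inn\<close>, on the left
    past \<open>out\<close> by \<open>out_Cmp\<close>, and \<open>\<sigma>\<close> commutes with the
    embedded entries.\<close>
  have nat: "\<tau>0 Y (FMor M Y X f v) = FMor N Y X f (\<tau>0 X v)"
    if [simp]: "X \<in> Obj D" "Y \<in> Obj D" "f \<in> carrier (Mor D Y X)" "v \<in> carrier (FObj M X)" for X Y f v
  proof -
    interpret NY: module K "FObj N Y" by (rule N.space) simp
    let ?w = "\<lambda>i. FMor M (rX (ob X i)) X (out X i) v"
    let ?e = "\<lambda>j i. corner (ob Y j) (ob X i) (ent Y X j i f)"
    let ?t = "\<lambda>i j. FMor N Y (rX (ob Y j)) (inn Y j)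
        (FMor N (rX (ob Y j)) (rX (ob X i)) (?e j i) (\<sigma> (ob X i) (?w i)))"
    have "FMor N Y X f (\<tau>0 X v) = (\<Oplus>\<^bsub>FObj N Y\<^esub>i\<in>J. FMor N Y X f
        (FMor N X (rX (ob X i)) (inn X i) (\<sigma> (ob X i) (?w i))))"
      unfolding \<tau>0_def by (rule N.act_finsum) simp_all
    also have "\<dots> = (\<Oplus>\<^bsub>FObj N Y\<^esub>i\<in>J. \<Oplus>\<^bsub>FObj N Y\<^esub>j\<in>J. ?t i j)"
    proof (rule NY.finsum_cong'[OF refl])
      fix i assume [simp]: "i \<in> J"
      have "FMor N Y X f (FMor N X (rX (ob X i)) (inn X i) (\<sigma> (ob X i) (?w i))) =
        FMor N Y (rX (ob X i)) (Cmp D Y X (rX (ob X i)) f (inn X i)) (\<sigma> (ob X i) (?w i))"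
        by (simp add: N.act_Cmp)
      also have "\<dots> = (\<Oplus>\<^bsub>FObj N Y\<^esub>j\<in>J. FMor N Y (rX (ob X i))
          (Cmp D Y (rX (ob Y j)) (rX (ob X i)) (inn Y j) (?e j i)) (\<sigma> (ob X i) (?w i)))"
        by (subst Cmp_inn, simp_all) (rule N.act_Mor_finsum, simp_all)
      also have "\<dots> = (\<Oplus>\<^bsub>FObj N Y\<^esub>j\<in>J. ?t i j)"
        by (rule NY.finsum_cong') (simp_all add: N.act_Cmp)
      finally show "FMor N Y X f (FMor N X (rX (ob X i)) (inn X i) (\<sigma> (ob X i) (?w i))) =
          (\<Oplus>\<^bsub>FObj N Y\<^esub>j\<in>J. ?t i j)" .
    qed simp
    also have "\<dots> = (\<Oplus>\<^bsub>FObj N Y\<^esub>j\<in>J. \<Oplus>\<^bsub>FObj N Y\<^esub>i\<in>J. ?t i j)"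
      by (rule NY.finsum_swap) simp_all
    also have "\<dots> = \<tau>0 Y (FMor M Y X f v)"
      unfolding \<tau>0_def
    proof (rule NY.finsum_cong'[OF refl])
      fix j assume [simp]: "j \<in> J"
      let ?W = "corner_space M (ob Y j)"
      interpret W: module K ?W by (rule corner_space_module[OF M]) simp
      have "FMor M (rX (ob Y j)) Y (out Y j) (FMor M Y X f v) = FMor M (rX (ob Y j)) X
          (Cmp D (rX (ob Y j)) Y X (out Y j) f) v"
        by (simp add: M.act_Cmp)
      also have "\<dots> = (\<Oplus>\<^bsub>FObj M (rX (ob Y j))\<^esub>i\<in>J. FMor M (rX (ob Y j)) X
          (Cmp D (rX (ob Y j)) (rX (ob X i)) X (?e j i) (out X i)) v)"
        by (subst out_Cmp, simp_all) (rule M.act_Mor_finsum, simp_all)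
      also have "\<dots> = (\<Oplus>\<^bsub>FObj M (rX (ob Y j))\<^esub>i\<in>J. FMor M (rX (ob Y j)) (rX (ob X i)) (?e j i) (?w i))"
        by (rule abelian_monoid.finsum_cong'[OF M.space_am]) (simp_all add: M.act_Cmp)
      \<comment> \<open>\<open>\<sigma>\<close> is linear on the corner only, so the sum has to be
        read there before \<open>\<sigma>\<close> is applied term by term.\<close>
      also have "\<dots> = (\<Oplus>\<^bsub>?W\<^esub>i\<in>J. FMor M (rX (ob Y j)) (rX (ob X i)) (?e j i) (?w i))"
        by (rule linear_maps_finsum[OF corner_space_incl_linear[OF M] W.abelian_group_axioms M.space_ag,
            symmetric])
          simp_all
      finally have 1: "FMor M (rX (ob Y j)) Y (out Y j) (FMor M Y X f v) = \<dots>" .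
      have "\<sigma> (ob Y j) (FMor M (rX (ob Y j)) Y (out Y j) (FMor M Y X f v)) =
        (\<Oplus>\<^bsub>FObj N (rX (ob Y j))\<^esub>i\<in>J. \<sigma> (ob Y j) (FMor M (rX (ob Y j)) (rX (ob X i)) (?e j i) (?w i)))"
        unfolding 1
        by (rule linear_maps_finsum[OF \<sigma>lin W.abelian_group_axioms N.space_ag]) simp_all
      also have "\<dots> = (\<Oplus>\<^bsub>FObj N (rX (ob Y j))\<^esub>i\<in>J. FMor N (rX (ob Y j)) (rX (ob X i)) (?e j i)
          (\<sigma> (ob X i) (?w i)))"
        by (rule abelian_monoid.finsum_cong'[OF N.space_am]) (simp_all add: \<sigma>nat)
      finally show "(\<Oplus>\<^bsub>FObj N Y\<^esub>i\<in>J. ?t i j) = FMor N Y (rX (ob Y j)) (inn Y j)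
          (\<sigma> (ob Y j) (FMor M (rX (ob Y j)) Y (out Y j) (FMor M Y X f v)))"
        by (simp add: N.act_finsum)
    qed simp
    finally show ?thesis by simp
  qed
  have "\<tau> \<in> module_homs K D M N"
  proof (rule module_homsI)
    fix X assume X: "X \<in> Obj D"
    show "\<tau> X \<in> linear_maps K (FObj M X) (FObj N X)"
      using linear_maps_restrict[OF lin[OF X] M.space[OF X]] X by (simp add: \<tau>_def)
  qed (simp_all add: \<tau>_def nat)
  moreover have "FMor corner_functor N M \<tau> = \<sigma>"
  proof -
    \<comment> \<open>On the corner at \<open>c\<close> only the index \<open>rI c\<close>
      contributes; there \<open>out\<close> and \<open>inn\<close> are both the idempotent, which
      fixes \<open>v\<close> and \<open>\<sigma> c v\<close>.\<close>
    have eq: "\<tau>0 (rX c) v = \<sigma> c v" if [simp]: "c \<in> Obj C" and v: "v \<in> carrier (corner_space M c)" for c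
        v
    proof -
      note [simp] = corner_spaceD[OF M v] v
      interpret NX: module K "FObj N (rX c)" by (rule N.space) simp
      have 0: "FMor M (rX (ob (rX c) i)) (rX c) (out (rX c) i) v = \<zero>\<^bsub>FObj M (rX (ob (rX c) i))\<^esub>" if "i \<in>
          J" "i \<noteq> rI c" for i
      proof -
        have "FMor M (rX (ob (rX c) i)) (rX c) (out (rX c) i) v =
          FMor M (rX (ob (rX c) i)) (rX c) (out (rX c) i)
              (FMor M (rX c) (rX c) (corner c c (Idt C c)) v)"
          by (simp add: corner_spaceD_fix[OF M v])
        also have "\<dots> = \<zero>\<^bsub>FObj M (rX (ob (rX c) i))\<^esub>"
          using that by (simp add: M.act_Cmp[symmetric] Idt_closed out_corner M.act_Mor_zero)
        finally show ?thesis .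
      qed
      have \<sigma>0: "\<sigma> c' \<zero>\<^bsub>FObj M (rX c')\<^esub> = \<zero>\<^bsub>FObj N (rX c')\<^esub>" if "c' \<in> Obj C" for c'
        using linear_maps_zero[OF module_homsD(1)[OF \<sigma> cM that]]
          corner_space_module[OF M that] corner_space_module[OF N that]
        by (simp add: corner_module_simps corner_space_simps(2) module_abelian_group)
      have "\<tau>0 (rX c) v = FMor N (rX c) (rX (ob (rX c) (rI c))) (inn (rX c) (rI c))
        (\<sigma> (ob (rX c) (rI c)) (FMor M (rX (ob (rX c) (rI c))) (rX c) (out (rX c) (rI c)) v))"
        unfolding \<tau>0_def
        by (rule NX.finsum_single) (simp_all add: 0 \<sigma>0 N.act_zero out_inn_rI Idt_closed)
      also have "\<dots> = \<sigma> c v"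
        by (simp add: out_inn_rI corner_spaceD_fix[OF M v] corner_spaceD_fix[OF N \<sigma>c'])
      finally show ?thesis .
    qed
    have "FMor corner_functor N M \<tau> \<in> module_homs K C (corner_module M) (corner_module N)"
      using k_functorD(5)[OF corner_functor_functor, of M N \<tau>] M N \<open>\<tau> \<in> module_homs K D M N\<close>
      by (simp add: left_modules_simps corner_functor_simps)
    then show ?thesis
      using \<sigma> cM
      by (rule module_homs_eqI)
        (simp add: corner_functor_simps corner_module_simps \<tau>_def corner_spaceD[OF M] eq)
  qed
  ultimately show ?thesis by blast
qed

end

section \<open>Change of universe\<close>

text \<open>An infinite set is in bijection with its square, so by induction its finite powers embed
  into it.\<close>

lemma ex_inj_on_PiE:
  assumes "infinite (UNIV :: 'v set)" "finite J"
  shows "\<exists>enc :: ('j \<Rightarrow> 'v) \<Rightarrow> 'v. inj_on enc (\<Pi>\<^sub>E j\<in>J. UNIV)"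
  using assms(2)
proof (induction J rule: finite_induct)
  case empty
  then show ?case by (auto simp: inj_on_def)
next
  case (insert a J)
  then obtain enc :: "('j \<Rightarrow> 'v) \<Rightarrow> 'v" where enc: "inj_on enc (\<Pi>\<^sub>E j\<in>J. UNIV)" by blast
  obtain p :: "'v \<times> 'v \<Rightarrow> 'v" where "bij_betw p (UNIV \<times> UNIV) UNIV"
    using iffD2[OF card_of_ordIso card_of_Times_same_infinite[OF assms(1)]] by blast
  then have p: "inj p" by (simp add: bij_betw_def)
  have "inj_on (\<lambda>v. p (v a, enc (restrict v J))) (\<Pi>\<^sub>E j\<in>insert a J. UNIV)"
  proof (rule inj_onI)
    fix u v :: "'j \<Rightarrow> 'v"
    assume u: "u \<in> (\<Pi>\<^sub>E j\<in>insert a J. UNIV)" and v: "v \<in> (\<Pi>\<^sub>E j\<in>insert a J. UNIV)"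
      and "p (u a, enc (restrict u J)) = p (v a, enc (restrict v J))"
    then have a: "u a = v a" and "enc (restrict u J) = enc (restrict v J)"
      using injD[OF p] by blast+
    then have "restrict u J = restrict v J"
      using inj_onD[OF enc] by auto
    then have "u j = v j" if "j \<in> J" for j
      using that by (metis restrict_apply')
    with a show "u = v"
      using u v by (intro PiE_ext[OF u v]) auto
  qed
  then show ?case by blast
qed

text \<open>Transport of structure that changes only the type of the vectors, from \<open>'w\<close>
  to \<open>'v\<close>. One encoding serves all objects and is injective on each space separately;
  the spaces themselves may overlap.\<close>

lemma left_module_transport:
  fixes M :: "('k, 'o, 'm, 'w) cmod" and enc :: "'w \<Rightarrow> 'v"
  assumes C: "k_category K C" and M: "left_module K C M"
    and inj: "\<And>x. x \<in> Obj C \<Longrightarrow> inj_on enc (carrier (FObj M x))"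
  obtains N :: "('k, 'o, 'm, 'v) cmod" where "left_module K C N"
    and "\<And>x. x \<in> Obj C \<Longrightarrow> carrier (FObj N x) = enc ` carrier (FObj M x)"
    and "\<And>x. x \<in> Obj C \<Longrightarrow> enc \<in> linear_maps K (FObj M x) (FObj N x)"
    and "\<And>x y f v. \<lbrakk>x \<in> Obj C; y \<in> Obj C; f \<in> carrier (Mor C y x); v \<in> carrier (FObj M x)\<rbrakk>
      \<Longrightarrow> FMor N y x f (enc v) = enc (FMor M y x f v)"
proof -
  interpret M: category_module K C M
    by (rule k_category.category_moduleI[OF C M])
  define dec where "dec x = inv_into (carrier (FObj M x)) enc" for x
  have dec[simp]: "dec x (enc v) = v" if "x \<in> Obj C" "v \<in> carrier (FObj M x)" for x v
    unfolding dec_def by (rule inv_into_f_f[OF inj[OF that(1)] that(2)])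
  define N :: "('k, 'o, 'm, 'v) cmod" where
    "N = \<lparr>FObj = (\<lambda>x. \<lparr>carrier = enc ` carrier (FObj M x), mult = undefined, one = undefined,
        zero = enc \<zero>\<^bsub>FObj M x\<^esub>, add = (\<lambda>a b. enc (dec x a \<oplus>\<^bsub>FObj M x\<^esub> dec x b)),
        smult = (\<lambda>c a. enc (c \<odot>\<^bsub>FObj M x\<^esub> dec x a))\<rparr>),
      FMor = (\<lambda>y x f. \<lambda>a\<in>enc ` carrier (FObj M x). enc (FMor M y x f (dec x a)))\<rparr>"
  have car: "carrier (FObj N x) = enc ` carrier (FObj M x)" for x by (simp add: N_def)
  have lin: "enc \<in> linear_maps K (FObj M x) (FObj N x)" if "x \<in> Obj C" for x
    by (rule linear_mapsI) (simp_all add: N_def that)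
  have act: "FMor N y x f (enc v) = enc (FMor M y x f v)" if "x \<in> Obj C" "v \<in> carrier (FObj M x)" for x
      y f v
    using that by (simp add: N_def)
  have md: "module K (FObj N x)" if x: "x \<in> Obj C" for x
    by (rule module_surj_image[OF M.space[OF x] car])
      (simp_all add: N_def x)
  have "left_module K C N"
  proof (rule left_moduleI)
    show "k_category K C" by fact
  next
    fix x y f assume *[simp]: "x \<in> Obj C" "y \<in> Obj C" "f \<in> carrier (Mor C y x)"
    interpret V: module K "FObj M x" by (rule M.space[OF *(1)])
    note lx = lin[OF *(1)] and ly = lin[OF *(2)]
    show "FMor N y x f \<in> linear_maps K (FObj N x) (FObj N y)"
      by (rule linear_mapsI)
        (auto simp: car act M.act_closed linear_maps_add[OF lx, symmetric]
            linear_maps_smult[OF lx, symmetric]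
          linear_maps_add[OF ly, symmetric] linear_maps_smult[OF ly, symmetric] M.act_add M.act_smult)
    show "FMor N y x f \<in> extensional (carrier (FObj N x))"
      by (simp add: N_def)
  next
    fix x y w assume *: "x \<in> Obj C" "y \<in> Obj C" "w \<in> carrier (FObj N x)"
    then obtain v where w: "w = enc v" and [simp]: "v \<in> carrier (FObj M x)" by (auto simp: car)
    note ly = lin[OF *(2)]
    show "(\<lambda>f. FMor N y x f w) \<in> linear_maps K (Mor C y x) (FObj N y)"
      using *(1,2) by (intro linear_mapsI)
        (auto simp: w car act M.act_closed M.act_Mor_add M.act_Mor_smult
          linear_maps_add[OF ly, symmetric] linear_maps_smult[OF ly, symmetric])
  qed (auto simp: md car act M.act_Idt M.act_Cmp M.act_closed)
  then show thesis using car lin act by (rule that)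
qed

section \<open>Induced modules and essential surjectivity\<close>

context full_matrix_presentation
begin

text \<open>Column vectors under the matrix product. The vectors have type
  \<open>'j \<Rightarrow> 'v\<close>, so this is not yet a module in the universe
  \<open>'v\<close>.\<close>

definition induced_module ::
    "('k, 'o, 'm, 'v) cmod
      \<Rightarrow> ('p, 'n, ('k, 'j \<Rightarrow> 'v) module, ('j \<Rightarrow> 'v) \<Rightarrow> 'j \<Rightarrow> 'v) kfun" where
  "induced_module N = \<lparr>FObj = (\<lambda>X. direct_sum J (\<lambda>i. FObj N (ob X i))),
     FMor = (\<lambda>Y X f. \<lambda>v\<in>carrier (direct_sum J (\<lambda>i. FObj N (ob X i))).
       \<lambda>j\<in>J. \<Oplus>\<^bsub>FObj N (ob Y j)\<^esub>i\<in>J. FMor N (ob Y j) (ob X i) (ent Y X j i f) (v i))\<rparr>"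

context
  fixes N :: "('k, 'o, 'm, 'v) cmod"
  assumes N: "left_module K C N"
begin

interpretation N: category_module K C N
  by (rule category_moduleI[OF N])

lemma induced_module_simps:
  "carrier (FObj (induced_module N) X) = (\<Pi>\<^sub>E i\<in>J. carrier (FObj N (ob X i)))"
  "\<zero>\<^bsub>FObj (induced_module N) X\<^esub> = (\<lambda>i\<in>J. \<zero>\<^bsub>FObj N (ob X i)\<^esub>)"
  "u \<oplus>\<^bsub>FObj (induced_module N) X\<^esub> v = (\<lambda>i\<in>J. u i \<oplus>\<^bsub>FObj N (ob X i)\<^esub> v i)"
  "c \<odot>\<^bsub>FObj (induced_module N) X\<^esub> v = (\<lambda>i\<in>J. c \<odot>\<^bsub>FObj N (ob X i)\<^esub> v i)"
  "v \<in> (\<Pi>\<^sub>E i\<in>J. carrier (FObj N (ob X i))) \<Longrightarrow> FMor (induced_module N) Y X f v =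
     (\<lambda>j\<in>J. \<Oplus>\<^bsub>FObj N (ob Y j)\<^esub>i\<in>J. FMor N (ob Y j) (ob X i) (ent Y X j i f) (v i))"
  by (simp_all add: induced_module_def carrier_direct_sum_finite finite_J direct_sum_simps(2-4))

text \<open>Compatibility with composition is associativity of matrices acting on columns, again an
  interchange of two finite sums.\<close>

lemma induced_module_functor: "left_module K D (induced_module N)"
proof (rule left_moduleI)
  show "k_category K D" ..
  note [simp] = ob_closed ent_closed N.act_closed finite_J
  have am: "abelian_monoid (FObj N (ob X i))" if "X \<in> Obj D" "i \<in> J" for X i
    by (rule N.space_am) (simp add: that)
  have act_cl: "FMor (induced_module N) Y X f v \<in> carrier (FObj (induced_module N) Y)"
    if "X \<in> Obj D" "Y \<in> Obj D" "f \<in> carrier (Mor D Y X)" "v \<in> carrier (FObj (induced_module N) X)" for X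
        Y f v
    using that by (auto simp: induced_module_simps intro!: abelian_monoid.finsum_closed[OF am] dest:
        PiE_mem)
  show "module K (FObj (induced_module N) X)" if "X \<in> Obj D" for X
    using that by (simp add: induced_module_def direct_sum_module is_cring N.space)
  show "FMor (induced_module N) Y X f \<in> extensional (carrier (FObj (induced_module N) X))" for X Y f
    by (simp add: induced_module_def)
  show "FMor (induced_module N) Y X f \<in> linear_maps K (FObj (induced_module N) X)
      (FObj (induced_module N) Y)"
    if XY[simp]: "X \<in> Obj D" "Y \<in> Obj D" "f \<in> carrier (Mor D Y X)" for X Y f
    unfolding induced_module_def kfun.simps
    by (intro linear_maps_restrict direct_sum_tuple_linear linear_maps_sum
        linear_maps_comp[OF direct_sum_proj_linear]
        N.act_linear N.space direct_sum_module is_cring) simp_all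
  show "(\<lambda>f. FMor (induced_module N) Y X f v) \<in> linear_maps K (Mor D Y X) (FObj (induced_module N) Y)"
    if XY[simp]: "X \<in> Obj D" "Y \<in> Obj D" and v: "v \<in> carrier (FObj (induced_module N) X)" for X Y v
  proof -
    have "(\<lambda>f. \<lambda>j\<in>J. \<Oplus>\<^bsub>FObj N (ob Y j)\<^esub>i\<in>J. FMor N (ob Y j) (ob X i) (ent Y X j i f) (v i))
      \<in> linear_maps K (Mor D Y X) (direct_sum J (\<lambda>i. FObj N (ob Y i)))"
      using v by (intro direct_sum_tuple_linear linear_maps_sum linear_maps_comp[OF ent_linear]
          N.act_linear_Mor N.space)
        (auto simp: induced_module_simps)
    then show ?thesis using v by (simp add: induced_module_def)
  qed
  show "FMor (induced_module N) X X (Idt D X) v = v"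
    if X[simp]: "X \<in> Obj D" and v: "v \<in> carrier (FObj (induced_module N) X)" for X v
  proof -
    have [simp]: "v i \<in> carrier (FObj N (ob X i))" if "i \<in> J" for i
      using v that by (auto simp: induced_module_simps)
    have "(\<Oplus>\<^bsub>FObj N (ob X j)\<^esub>i\<in>J. FMor N (ob X j) (ob X i) (ent X X j i (Idt D X)) (v i)) = v j" if
        [simp]: "j \<in> J" for j
    proof -
      interpret A: abelian_monoid "FObj N (ob X j)" by (rule am) simp_all
      have "(\<Oplus>\<^bsub>FObj N (ob X j)\<^esub>i\<in>J. FMor N (ob X j) (ob X i) (ent X X j i (Idt D X)) (v i)) =
        FMor N (ob X j) (ob X j) (ent X X j j (Idt D X)) (v j)"
        by (rule A.finsum_single) (auto simp: ent_Idt N.act_Idt N.act_Mor_zero)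
      then show ?thesis by (simp add: ent_Idt N.act_Idt)
    qed
    then show ?thesis
      using v by (auto simp: induced_module_simps fun_eq_iff PiE_def extensional_def)
  qed
  show "FMor (induced_module N) Z X (Cmp D Z Y X g f) v = FMor (induced_module N) Z Y g
      (FMor (induced_module N) Y X f v)"
    if [simp]: "X \<in> Obj D" "Y \<in> Obj D" "Z \<in> Obj D" "g \<in> carrier (Mor D Z Y)" "f \<in> carrier (Mor D Y X)"
      and v: "v \<in> carrier (FObj (induced_module N) X)" for X Y Z g f v
  proof -
    have [simp]: "v i \<in> carrier (FObj N (ob X i))" if "i \<in> J" for i
      using v that by (auto simp: induced_module_simps)
    have "(\<Oplus>\<^bsub>FObj N (ob Z k)\<^esub>i\<in>J. FMor N (ob Z k) (ob X i) (ent Z X k i (Cmp D Z Y X g f)) (v i)) =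
      (\<Oplus>\<^bsub>FObj N (ob Z k)\<^esub>j\<in>J. FMor N (ob Z k) (ob Y j) (ent Z Y k j g)
        (\<Oplus>\<^bsub>FObj N (ob Y j)\<^esub>i\<in>J. FMor N (ob Y j) (ob X i) (ent Y X j i f) (v i)))" if [simp]: "k \<in> J" for
            k
    proof -
      interpret A: abelian_monoid "FObj N (ob Z k)" by (rule am) simp_all
      have "(\<Oplus>\<^bsub>FObj N (ob Z k)\<^esub>i\<in>J. FMor N (ob Z k) (ob X i) (ent Z X k i (Cmp D Z Y X g f)) (v i)) =
        (\<Oplus>\<^bsub>FObj N (ob Z k)\<^esub>i\<in>J. \<Oplus>\<^bsub>FObj N (ob Z k)\<^esub>j\<in>J. FMor N (ob Z k) (ob Y j) (ent Z Y k j g)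
          (FMor N (ob Y j) (ob X i) (ent Y X j i f) (v i)))"
        by (rule A.finsum_cong')
          (auto simp: ent_Cmp N.act_Mor_finsum Cmp_closed N.act_Cmp intro!: A.finsum_closed
              A.finsum_cong')
      also have "\<dots> = (\<Oplus>\<^bsub>FObj N (ob Z k)\<^esub>j\<in>J. \<Oplus>\<^bsub>FObj N (ob Z k)\<^esub>i\<in>J. FMor N (ob Z k) (ob Y j)
          (ent Z Y k j g)
          (FMor N (ob Y j) (ob X i) (ent Y X j i f) (v i)))"
        by (rule A.finsum_swap) auto
      also have "\<dots> = (\<Oplus>\<^bsub>FObj N (ob Z k)\<^esub>j\<in>J. FMor N (ob Z k) (ob Y j) (ent Z Y k j g)
        (\<Oplus>\<^bsub>FObj N (ob Y j)\<^esub>i\<in>J. FMor N (ob Y j) (ob X i) (ent Y X j i f) (v i)))"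
        by (rule A.finsum_cong') (auto simp: N.act_finsum intro!: A.finsum_closed)
      finally show ?thesis .
    qed
    moreover have "FMor (induced_module N) Y X f v \<in> (\<Pi>\<^sub>E i\<in>J. carrier (FObj N (ob Y i)))"
      using act_cl[of X Y f v] v by (simp add: induced_module_simps)
    ultimately show ?thesis
      using v
      by (simp add: induced_module_simps cong: restrict_cong)
        (auto intro!: restrict_ext abelian_monoid.finsum_cong'[OF am] N.act_closed
            abelian_monoid.finsum_closed[OF am])
  qed
qed

text \<open>A matrix unit reads one coordinate and writes one coordinate; in particular the
  idempotent of a corner acts as a coordinate projection.\<close>

lemma induced_module_single:
  assumes [simp]: "X \<in> Obj D" "Y \<in> Obj D" "i \<in> J" "j \<in> J" "f \<in> carrier (Mor C (ob Y j) (ob X i))"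
    and v: "v \<in> carrier (FObj (induced_module N) X)"
  shows "FMor (induced_module N) Y X (single Y j X i f) v =
    (\<lambda>j'\<in>J. if j' = j then FMor N (ob Y j) (ob X i) f (v i) else \<zero>\<^bsub>FObj N (ob Y j')\<^esub>)"
proof -
  note [simp] = ob_closed N.act_closed finite_J
  have [simp]: "v i \<in> carrier (FObj N (ob X i))" if "i \<in> J" for i
    using v that by (auto simp: induced_module_simps)
  have "(\<Oplus>\<^bsub>FObj N (ob Y j')\<^esub>i'\<in>J. FMor N (ob Y j') (ob X i') (ent Y X j' i' (single Y j X i f)) (v i'))
      =
    (if j' = j then FMor N (ob Y j) (ob X i) f (v i) else \<zero>\<^bsub>FObj N (ob Y j')\<^esub>)" if [simp]: "j' \<in> J" for
        j'
  proof -
    interpret A: abelian_monoid "FObj N (ob Y j')" by (rule N.space_am) simp_all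
    have "(\<Oplus>\<^bsub>FObj N (ob Y j')\<^esub>i'\<in>J. FMor N (ob Y j') (ob X i') (ent Y X j' i' (single Y j X i f))
        (v i')) =
      FMor N (ob Y j') (ob X i) (ent Y X j' i (single Y j X i f)) (v i)"
      by (rule A.finsum_single) (auto simp: ent_single N.act_Mor_zero)
    then show ?thesis by (auto simp: ent_single N.act_Mor_zero)
  qed
  then show ?thesis
    using v by (auto simp: induced_module_simps intro!: restrict_ext)
qed

text \<open>The universe \<open>'v\<close> is infinite, hence it contains a copy of the finite direct sums
  of which \<open>induced_module N\<close> consists.\<close>

lemma corner_functor_essentially_surjective:
  assumes "infinite (UNIV :: 'v set)"
  shows "\<exists>M. left_module K D M \<and> isomorphic_in (left_modules K C) (corner_module M) N"
proof -
  let ?I = "induced_module N"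
  note I = induced_module_functor
  obtain enc :: "('j \<Rightarrow> 'v) \<Rightarrow> 'v" where enc: "inj_on enc (\<Pi>\<^sub>E j\<in>J. UNIV)"
    using ex_inj_on_PiE[OF assms finite_J] by blast
  have sub: "carrier (FObj ?I X) \<subseteq> (\<Pi>\<^sub>E j\<in>J. UNIV)" for X
    by (auto simp: induced_module_simps)
  have inj: "inj_on enc (carrier (FObj ?I X))" for X
    using inj_on_subset[OF enc sub] .
  obtain M :: "('k, 'p, 'n, 'v) cmod" where M: "left_module K D M"
    and car: "\<And>X. X \<in> Obj D \<Longrightarrow> carrier (FObj M X) = enc ` carrier (FObj ?I X)"
    and lin: "\<And>X. X \<in> Obj D \<Longrightarrow> enc \<in> linear_maps K (FObj ?I X) (FObj M X)"
    and act: "\<And>X Y f v. \<lbrakk>X \<in> Obj D; Y \<in> Obj D; f \<in> carrier (Mor D Y X); v \<in> carrier (FObj ?I X)\<rbrakk>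
      \<Longrightarrow> FMor M Y X f (enc v) = enc (FMor ?I Y X f v)"
    by (rule left_module_transport[OF D.k_category_axioms I inj]) (rule that)
  have act_corner: "FMor ?I (rX c') (rX c) (corner c' c f) v =
      (\<lambda>j\<in>J. if j = rI c' then FMor N c' c f (v (rI c)) else \<zero>\<^bsub>FObj N (ob (rX c') j)\<^esub>)"
    if "c \<in> Obj C" "c' \<in> Obj C" "f \<in> carrier (Mor C c' c)" "v \<in> carrier (FObj ?I (rX c))" for c c' f v
    using induced_module_single[of "rX c" "rX c'" "rI c" "rI c'" f v] that by
        (simp add: corner_def cong: if_cong)
  \<comment> \<open>The tuple concentrated in coordinate \<open>rI c\<close>. Up to
    \<open>enc\<close>, these tuples form the image of the idempotent of \<open>c\<close>, that is,
    the corner.\<close>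
  define pt where "pt c w = (\<lambda>j\<in>J. if j = rI c then w else \<zero>\<^bsub>FObj N (ob (rX c) j)\<^esub>)" for c w
  have zc: "\<zero>\<^bsub>FObj N c\<^esub> \<in> carrier (FObj N c)" if "c \<in> Obj C" for c
    using N.space[OF that] abelian_monoid.zero_closed[OF module_abelian_monoid] by blast
  have pt_c: "pt c w \<in> carrier (FObj ?I (rX c))" if "c \<in> Obj C" "w \<in> carrier (FObj N c)" for c w
    using that by (auto simp: pt_def induced_module_simps zc ob_closed)
  have pt_rI: "pt c w (rI c) = w" if "c \<in> Obj C" for c w
    using that by (simp add: pt_def)
  have fix_pt: "FMor M (rX c) (rX c) (corner c c (Idt C c)) (enc v) = enc (pt c (v (rI c)))"
    if c: "c \<in> Obj C" and v: "v \<in> carrier (FObj ?I (rX c))" for c v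
  proof -
    have "v (rI c) \<in> carrier (FObj N c)" using v c
        PiE_mem[of v J "\<lambda>i. carrier (FObj N (ob (rX c) i))" "rI c"] by (simp add: induced_module_simps)
    then show ?thesis
      using c v by (simp add: act corner_closed Idt_closed act_corner pt_def N.act_Idt cong: if_cong)
  qed
  have space: "carrier (corner_space M c) = (\<lambda>w. enc (pt c w)) ` carrier (FObj N c)" if c: "c \<in> Obj C"
      for c
  proof (intro equalityI subsetI)
    fix a assume "a \<in> carrier (corner_space M c)"
    then have a: "a \<in> carrier (FObj M (rX c))" "FMor M (rX c) (rX c) (corner c c (Idt C c)) a = a"
      by (simp_all add: corner_space_simps)
    then obtain v where v: "v \<in> carrier (FObj ?I (rX c))" "a = enc v" using car c by auto
    have "v (rI c) \<in> carrier (FObj N c)" using v c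
        PiE_mem[of v J "\<lambda>i. carrier (FObj N (ob (rX c) i))" "rI c"] by (simp add: induced_module_simps)
    then show "a \<in> (\<lambda>w. enc (pt c w)) ` carrier (FObj N c)"
      using a(2) fix_pt[OF c v(1)] v(2) by (intro image_eqI[of _ _ "v (rI c)"]) simp_all
  next
    fix a assume "a \<in> (\<lambda>w. enc (pt c w)) ` carrier (FObj N c)"
    then obtain w where w: "w \<in> carrier (FObj N c)" "a = enc (pt c w)" by blast
    show "a \<in> carrier (corner_space M c)"
      using fix_pt[OF c pt_c[OF c w(1)]] pt_c[OF c w(1)] c by
          (simp add: corner_space_simps w(2) pt_rI car)
  qed
  \<comment> \<open>The inverse is taken on all extensional tuples rather than on the individual
    spaces, so that one decoder serves every object.\<close>
  define dec where "dec = inv_into (\<Pi>\<^sub>E j\<in>J. UNIV) enc"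
  have dec: "dec (enc (pt c w)) (rI c) = w" if "c \<in> Obj C" for c w
  proof -
    have "pt c w \<in> (\<Pi>\<^sub>E j\<in>J. UNIV)" by (auto simp: pt_def)
    then show ?thesis using that unfolding dec_def by (simp add: inv_into_f_f[OF enc] pt_rI)
  qed
  define \<kappa> where "\<kappa> = (\<lambda>c\<in>Obj C. \<lambda>a\<in>carrier (corner_space M c). dec a (rI c))"
  have \<kappa>: "\<kappa> c (enc (pt c w)) = w" if "c \<in> Obj C" "w \<in> carrier (FObj N c)" for c w
    using that by (simp add: \<kappa>_def space dec)
  have \<kappa>_hom: "\<kappa> \<in> module_homs K C (corner_module M) N"
  proof (rule module_homsI)
    fix c assume c: "c \<in> Obj C"
    interpret Nc: module K "FObj N c" by (rule N.space[OF c])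
    note l = lin[OF rX_rI(1)[OF c]]
    have add: "pt c u \<oplus>\<^bsub>FObj ?I (rX c)\<^esub> pt c w = pt c (u \<oplus>\<^bsub>FObj N c\<^esub> w)" for u w
      using c abelian_monoid.l_zero[OF N.space_am zc] ob_closed
      by (auto simp: pt_def induced_module_simps intro!: restrict_ext)
    have smult: "a \<odot>\<^bsub>FObj ?I (rX c)\<^esub> pt c w = pt c (a \<odot>\<^bsub>FObj N c\<^esub> w)" if "a \<in> carrier K" for a w
      using c that module.smult_r_null[OF N.space] ob_closed
      by (auto simp: pt_def induced_module_simps intro!: restrict_ext)
    show "\<kappa> c \<in> linear_maps K (FObj (corner_module M) c) (FObj N c)"
      using c
      by (intro linear_mapsI)
        (auto simp: corner_module_simps space \<kappa> corner_space_simps(3,4) linear_maps_add[OF l, symmetric]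
          linear_maps_smult[OF l, symmetric] pt_c add smult)
  next
    fix c c' f a assume *: "c \<in> Obj C" "c' \<in> Obj C" "f \<in> carrier (Mor C c' c)" "a \<in> carrier
        (FObj (corner_module M) c)"
    then obtain w where w: "w \<in> carrier (FObj N c)" "a = enc (pt c w)" by
        (auto simp: corner_module_simps space)
    have "FMor (corner_module M) c' c f a = enc (pt c' (FMor N c' c f w))"
      using * w by (simp add: corner_module_simps act corner_closed pt_c act_corner pt_rI cong: if_cong)
        (simp add: pt_def)
    then show "\<kappa> c' (FMor (corner_module M) c' c f a) = FMor N c' c f (\<kappa> c a)"
      using * w by (simp add: \<kappa> N.act_closed)
  qed (simp_all add: \<kappa>_def corner_module_simps)
  have "isomorphic_in (left_modules K C) (corner_module M) N"
  proof (rule left_modules_isomorphicI[OF field_axioms corner_module_functor[OF M] N \<kappa>_hom])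
    fix c assume c: "c \<in> Obj C"
    show "bij_betw (\<kappa> c) (carrier (FObj (corner_module M) c)) (carrier (FObj N c))"
      by (rule bij_betwI[of _ _ _ "\<lambda>w. enc (pt c w)"]) (auto simp: corner_module_simps space c \<kappa>)
  qed
  then show ?thesis using M by blast
qed

end

theorem morita_equivalent_D_C:
  assumes "infinite (UNIV :: 'v set)"
  shows "morita_equivalent TYPE('v) K D C"
proof -
  let ?F = "corner_functor :: (('k, 'p, 'n, 'v) cmod, 'p \<Rightarrow> 'v \<Rightarrow> 'v,
      ('k, 'o, 'm, 'v) cmod, 'o \<Rightarrow> 'v \<Rightarrow> 'v) kfun"
  have "k_equivalent K
       (left_modules K D :: ('k, 'p, 'n, 'v) cmods)
       (left_modules K C :: ('k, 'o, 'm, 'v) cmods)"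
  proof (rule k_equivalent_if_fully_faithful[OF left_modules_k_category[OF field_axioms]
        left_modules_k_category[OF field_axioms] corner_functor_functor])
    fix M N :: "('k, 'p, 'n, 'v) cmod"
    assume "M \<in> Obj (left_modules K D)" "N \<in> Obj (left_modules K D)"
    then have M: "left_module K D M" and N: "left_module K D N"
      by (simp_all add: left_modules_simps)
    have "FMor ?F N M ` module_homs K D M N = module_homs K C (corner_module M) (corner_module N)"
    proof (intro equalityI subsetI)
      fix \<sigma> assume "\<sigma> \<in> module_homs K C (corner_module M) (corner_module N)"
      then show "\<sigma> \<in> FMor ?F N M ` module_homs K D M N"
        using corner_functor_full[OF M N] by blast
    next
      fix \<sigma> assume "\<sigma> \<in> FMor ?F N M ` module_homs K D M N"
      then show "\<sigma> \<in> module_homs K C (corner_module M) (corner_module N)"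
        using k_functorD(5)[OF corner_functor_functor, of M N] M N
        by (auto simp: left_modules_simps corner_functor_simps(1))
    qed
    then show "bij_betw (FMor ?F N M) (carrier (Mor (left_modules K D) N M))
        (carrier (Mor (left_modules K C) (FObj ?F N) (FObj ?F M)))"
      using corner_functor_faithful[OF M N]
      by (auto simp: left_modules_simps corner_functor_simps(1) bij_betw_def inj_on_def)
  next
    fix N :: "('k, 'o, 'm, 'v) cmod"
    assume "N \<in> Obj (left_modules K C)"
    then show "\<exists>M\<in>Obj (left_modules K D). isomorphic_in (left_modules K C) (FObj ?F M) N"
      using corner_functor_essentially_surjective[OF _ assms, of N]
      by (auto simp: left_modules_simps corner_functor_simps)
  qed
  then show ?thesis
    unfolding morita_equivalent_def using D.k_category_axioms k_category_axioms by blast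
qed

end

section \<open>Quotients by free actions\<close>

locale galois_data = free_G_k_category K G C \<phi> \<psi>
  for K :: "('k, 'r) ring_scheme" and G :: "('g, 'q) monoid_scheme" (structure)
    and C :: "('k, 'o, 'm) kcat" and \<phi> :: "'g \<Rightarrow> 'o \<Rightarrow> 'o"
    and \<psi> :: "'g \<Rightarrow> 'o \<Rightarrow> 'o \<Rightarrow> 'm \<Rightarrow> 'm" +
  fixes x :: "'o set \<Rightarrow> 'o"
  assumes finite_G: "finite (carrier G)"
    and x_in: "X \<in> orbits G (Obj C) \<phi> \<Longrightarrow> x X \<in> X"
begin

section \<open>Group words, orbits and labels of their points\<close>

lemma grp: "group G" using group_hom by (simp add: group_hom_def)

lemma g_closed [simp]:
  "\<lbrakk>s \<in> carrier G; t \<in> carrier G\<rbrakk> \<Longrightarrow> s \<otimes> t \<in> carrier G"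
  "s \<in> carrier G \<Longrightarrow> inv s \<in> carrier G"
  "\<one> \<in> carrier G"
  using grp by (simp_all add: group.is_monoid monoid.m_closed)

lemma g_simps [simp]:
  assumes "s \<in> carrier G"
  shows "\<one> \<otimes> s = s" "s \<otimes> \<one> = s" "inv s \<otimes> s = \<one>"
    "s \<otimes> inv s = \<one>" "inv (inv s) = s"
  using group.is_monoid[OF grp] group.l_inv[OF grp assms] group.r_inv[OF grp assms]
      group.inv_inv[OF grp assms]
    assms
  by (simp_all add: monoid.l_one monoid.r_one)

lemma g_inv_one [simp]: "inv \<one> = \<one>"
  using grp by (simp add: group.is_monoid monoid.inv_one)

lemma g_assoc:
  "\<lbrakk>s \<in> carrier G; t \<in> carrier G; u \<in> carrier G\<rbrakk> \<Longrightarrow> s \<otimes> t \<otimes> u = s \<otimes> (t \<otimes> u)"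
  using grp by (simp add: group.is_monoid monoid.m_assoc)

lemma g_cancel:
  assumes "s \<in> carrier G" "t \<in> carrier G"
  shows "inv s \<otimes> (s \<otimes> t) = t" "s \<otimes> (inv s \<otimes> t) = t"
    "inv (s \<otimes> t) = inv t \<otimes> inv s"
  using assms by (simp_all add: g_assoc[symmetric] group.inv_mult_group[OF grp])

text \<open>Oriented rules for words in \<open>G\<close>: brackets go to the right, inverses move to
  single letters, and adjacent inverse pairs cancel.\<close>

lemmas g_norm = g_assoc g_cancel

lemma bij_left: "s \<in> carrier G \<Longrightarrow> bij_betw (\<lambda>r. s \<otimes> r) (carrier G) (carrier G)"
  by (rule bij_betwI[of _ _ _ "\<lambda>r. inv s \<otimes> r"]) (auto simp: g_norm)

lemma bij_right: "s \<in> carrier G \<Longrightarrow> bij_betw (\<lambda>r. r \<otimes> s) (carrier G) (carrier G)"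
  by (rule bij_betwI[of _ _ _ "\<lambda>r. r \<otimes> inv s"]) (auto simp: g_norm)

lemma phi_closed [simp]: "\<lbrakk>s \<in> carrier G; a \<in> Obj C\<rbrakk> \<Longrightarrow> \<phi> s a \<in> Obj C"
  using element_image by blast

lemma phi_phi: "\<lbrakk>s \<in> carrier G; t \<in> carrier G; a \<in> Obj C\<rbrakk> \<Longrightarrow> \<phi> s (\<phi> t a) = \<phi> (s \<otimes> t) a"
  using composition_rule by simp

lemma phi_one [simp]: "a \<in> Obj C \<Longrightarrow> \<phi> \<one> a = a"
  using fun_cong[OF id_eq_one, of a] by simp

lemma phi_eq_iff: "\<lbrakk>s \<in> carrier G; t \<in> carrier G; a \<in> Obj C\<rbrakk> \<Longrightarrow> \<phi> s a = \<phi> t a \<longleftrightarrow> s = t"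
proof
  assume *: "s \<in> carrier G" "t \<in> carrier G" "a \<in> Obj C" and "\<phi> s a = \<phi> t a"
  then have "\<phi> (inv t) (\<phi> s a) = \<phi> (inv t) (\<phi> t a)" by simp
  then have "\<phi> (inv t \<otimes> s) a = a" using * by (simp add: phi_phi)
  then have "inv t \<otimes> s = \<one>" using free * by simp
  then have "t \<otimes> (inv t \<otimes> s) = t" using * by simp
  then show "s = t" using * by (simp add: g_norm)
qed simp

abbreviation orbs :: "'o set set" where "orbs \<equiv> orbits G (Obj C) \<phi>"

lemma orbs_sub: "\<lbrakk>X \<in> orbs; a \<in> X\<rbrakk> \<Longrightarrow> a \<in> Obj C"
  by (auto simp: orbits_def orbit_def)

lemma orbs_eq: "\<lbrakk>X \<in> orbs; a \<in> X\<rbrakk> \<Longrightarrow> X = (\<lambda>s. \<phi> s a) ` carrier G"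
proof -
  assume "X \<in> orbs" "a \<in> X"
  then obtain b t where b: "b \<in> Obj C" "X = (\<lambda>s. \<phi> s b) ` carrier G" "t \<in> carrier G" "a = \<phi> t b"
    by (auto simp: orbits_def orbit_def)
  have "(\<lambda>s. \<phi> s b) ` carrier G = (\<lambda>s. \<phi> (s \<otimes> t) b) ` carrier G"
    using arg_cong[OF bij_betw_imp_surj_on[OF bij_right[OF b(3)]], of "\<lambda>A. (\<lambda>s. \<phi> s b) ` A"]
    unfolding image_image by (rule sym)
  then show ?thesis using b by (simp add: phi_phi cong: image_cong)
qed

lemma orbs_closed: "\<lbrakk>X \<in> orbs; a \<in> X; s \<in> carrier G\<rbrakk> \<Longrightarrow> \<phi> s a \<in> X"
  using orbs_eq by blast

lemma orbs_finite: "X \<in> orbs \<Longrightarrow> finite X"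
  by (subst orbs_eq[OF _ x_in]) (simp_all add: finite_G)

text \<open>The inverse lets \<open>G\<close> act on labels by right translation, which preserves
  \<open>s \<otimes> inv t\<close>, and it makes the label of a column agree with the index of the
  matching basis element \<delta>.\<close>

definition pos :: "'o set \<Rightarrow> 'g \<Rightarrow> 'o" where
  "pos X t = \<phi> (inv t) (x X)"

lemma x_Obj [simp]: "X \<in> orbs \<Longrightarrow> x X \<in> Obj C"
  using orbs_sub x_in by blast

lemma pos_in [simp]: "\<lbrakk>X \<in> orbs; t \<in> carrier G\<rbrakk> \<Longrightarrow> pos X t \<in> X"
  by (simp add: pos_def orbs_closed x_in)

lemma pos_Obj [simp]: "\<lbrakk>X \<in> orbs; t \<in> carrier G\<rbrakk> \<Longrightarrow> pos X t \<in> Obj C"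
  using orbs_sub pos_in by blast

lemma pos_one: "X \<in> orbs \<Longrightarrow> pos X \<one> = x X"
  by (simp add: pos_def)

lemma phi_pos: "\<lbrakk>X \<in> orbs; r \<in> carrier G; t \<in> carrier G\<rbrakk> \<Longrightarrow> \<phi> r (pos X t) = pos X (t \<otimes> inv r)"
  by (simp add: pos_def phi_phi g_norm)

lemma pos_eq_iff: "\<lbrakk>X \<in> orbs; s \<in> carrier G; t \<in> carrier G\<rbrakk> \<Longrightarrow> pos X s = pos X t \<longleftrightarrow> s = t"
  unfolding pos_def
  by (simp add: phi_eq_iff) (rule inj_on_eq_iff[OF group.inv_inj[OF grp]]; simp)

lemma bij_pos: "X \<in> orbs \<Longrightarrow> bij_betw (pos X) (carrier G) X"
proof -
  assume a: "X \<in> orbs"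
  have "X = (\<lambda>s. \<phi> s (x X)) ` carrier G" using orbs_eq[OF a x_in[OF a]] .
  also have "\<dots> \<subseteq> pos X ` carrier G"
  proof (rule image_subsetI)
    fix s assume "s \<in> carrier G"
    then show "\<phi> s (x X) \<in> pos X ` carrier G"
      by (intro image_eqI[of _ _ "inv s"]) (simp_all add: pos_def)
  qed
  finally show ?thesis using a pos_in by (auto simp: bij_betw_def inj_on_def pos_eq_iff)
qed

lemma psi_closed: "\<lbrakk>s \<in> carrier G; a \<in> Obj C; b \<in> Obj C; f \<in> carrier (Mor C b a)\<rbrakk>
    \<Longrightarrow> \<psi> s b a f \<in> carrier (Mor C (\<phi> s b) (\<phi> s a))"
  by (rule linear_maps_closed[OF act_linear])

lemma psi_zero: "\<lbrakk>s \<in> carrier G; a \<in> Obj C; b \<in> Obj C\<rbrakk>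
    \<Longrightarrow> \<psi> s b a \<zero>\<^bsub>Mor C b a\<^esub> = \<zero>\<^bsub>Mor C (\<phi> s b) (\<phi> s a)\<^esub>"
  by (rule linear_maps_zero[OF act_linear Mor_ag Mor_ag]) simp_all

lemma psi_finsum: "\<lbrakk>s \<in> carrier G; a \<in> Obj C; b \<in> Obj C; finite A; \<And>i. i \<in> A \<Longrightarrow> f i \<in> carrier
    (Mor C b a)\<rbrakk>
    \<Longrightarrow> \<psi> s b a (\<Oplus>\<^bsub>Mor C b a\<^esub>i\<in>A. f i) = (\<Oplus>\<^bsub>Mor C (\<phi> s b) (\<phi> s a)\<^esub>i\<in>A. \<psi> s b a (f i))"
  by (rule linear_maps_finsum[OF act_linear Mor_ag Mor_ag]) simp_all

text \<open>Follows from invertibility of the action: \<open>?i\<close> is a preimage of the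
  identity of \<open>\<phi> r a\<close>, and a multiplicative map with the identity in its image
  preserves identities.\<close>

lemma psi_Idt:
  assumes "r \<in> carrier G" "a \<in> Obj C"
  shows "\<psi> r a a (Idt C a) = Idt C (\<phi> r a)"
proof -
  let ?i = "\<psi> (inv r) (\<phi> r a) (\<phi> r a) (Idt C (\<phi> r a))"
  have i: "?i \<in> carrier (Mor C a a)"
    using psi_closed[of "inv r" "\<phi> r a" "\<phi> r a" "Idt C (\<phi> r a)"] assms by (simp add: phi_phi Idt_closed)
  have ri: "\<psi> r a a ?i = Idt C (\<phi> r a)"
    using act_mult[of "inv r" r "\<phi> r a" "\<phi> r a" "Idt C (\<phi> r a)"] assms
    by (simp add: phi_phi Idt_closed act_one)
  have "\<psi> r a a (Idt C a) = Cmp C (\<phi> r a) (\<phi> r a) (\<phi> r a) (\<psi> r a a (Idt C a)) (\<psi> r a a ?i)"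
    using assms by (simp add: ri Idt_right psi_closed Idt_closed)
  also have "\<dots> = \<psi> r a a (Cmp C a a a (Idt C a) ?i)"
    using assms i by (simp add: act_Cmp Idt_closed)
  finally show ?thesis using assms i by (simp add: Idt_left ri)
qed

section \<open>Orbit sums, translates and norms\<close>

abbreviation V :: "'o set \<Rightarrow> 'o set \<Rightarrow> ('k, 'o \<times> 'o \<Rightarrow> 'm) module" where
  "V Y X \<equiv> orbit_sum C Y X"

lemma V_carrier: "\<lbrakk>Y \<in> orbs; X \<in> orbs\<rbrakk>
    \<Longrightarrow> carrier (V Y X) = (\<Pi>\<^sub>E p\<in>Y \<times> X. carrier (Mor C (fst p) (snd p)))"
  unfolding orbit_sum_def by (simp add: carrier_direct_sum_finite orbs_finite case_prod_beta)

lemma V_mem: "\<lbrakk>Y \<in> orbs; X \<in> orbs; F \<in> carrier (V Y X); b \<in> Y; a \<in> X\<rbrakk> \<Longrightarrow> F (b, a) \<in> carrier (Mor C b a)"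
  using PiE_mem[of F "Y \<times> X" "\<lambda>p. carrier (Mor C (fst p) (snd p))" "(b, a)"] by (simp add: V_carrier)

lemma V_module: "\<lbrakk>Y \<in> orbs; X \<in> orbs\<rbrakk> \<Longrightarrow> module K (V Y X)"
  unfolding orbit_sum_def
  by (rule direct_sum_module) (auto simp: is_cring orbs_finite orbs_sub Mor_module)

lemma V_eqI: "\<lbrakk>Y \<in> orbs; X \<in> orbs; F \<in> carrier (V Y X); F' \<in> carrier (V Y X);
    \<And>b a. \<lbrakk>b \<in> Y; a \<in> X\<rbrakk> \<Longrightarrow> F (b, a) = F' (b, a)\<rbrakk> \<Longrightarrow> F = F'"
  by (rule PiE_ext[of F "Y \<times> X" "\<lambda>p. carrier (Mor C (fst p) (snd p))" F']) (auto simp: V_carrier)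

lemma V_eval_linear: "\<lbrakk>b \<in> Y; a \<in> X\<rbrakk> \<Longrightarrow> (\<lambda>F. F (b, a)) \<in> linear_maps K (V Y X) (Mor C b a)"
  using direct_sum_proj_linear[of "(b, a)" "Y \<times> X" K "\<lambda>(b, a). Mor C b a"] by (simp add: orbit_sum_def)

lemma V_zero: "\<lbrakk>b \<in> Y; a \<in> X\<rbrakk> \<Longrightarrow> \<zero>\<^bsub>V Y X\<^esub> (b, a) = \<zero>\<^bsub>Mor C b a\<^esub>"
  by (simp add: orbit_sum_def direct_sum_simps)

lemma V_intro: "\<lbrakk>Y \<in> orbs; X \<in> orbs; \<And>b a. \<lbrakk>b \<in> Y; a \<in> X\<rbrakk> \<Longrightarrow> F b a \<in> carrier (Mor C b a)\<rbrakk>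
    \<Longrightarrow> (\<lambda>(b, a)\<in>Y \<times> X. F b a) \<in> carrier (V Y X)"
  by (auto simp: V_carrier)

definition trn :: "'g \<Rightarrow> 'o \<Rightarrow> 'o \<Rightarrow> ('o \<times> 'o \<Rightarrow> 'm) \<Rightarrow> 'm" where
  "trn r b a F = \<psi> r (\<phi> (inv r) b) (\<phi> (inv r) a) (F (\<phi> (inv r) b, \<phi> (inv r) a))"

text \<open>The component at \<open>(b, a)\<close> of the norm of \<open>F\<close>, since
  \<open>trn r b a F\<close> is the component of the translate of \<open>F\<close> by
  \<open>r\<close>.\<close>

definition nrm :: "'o \<Rightarrow> 'o \<Rightarrow> ('o \<times> 'o \<Rightarrow> 'm) \<Rightarrow> 'm" where
  "nrm b a F = (\<Oplus>\<^bsub>Mor C b a\<^esub>r\<in>carrier G. trn r b a F)"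

abbreviation orbit_act :: "'o set \<Rightarrow> 'o set \<Rightarrow> 'g \<Rightarrow> ('o \<times> 'o \<Rightarrow> 'm) \<Rightarrow> 'o \<times> 'o \<Rightarrow> 'm" where
  "orbit_act \<equiv> orbit_sum_act G \<phi> \<psi>"

lemma orbit_act_apply: "\<lbrakk>b \<in> Y; a \<in> X\<rbrakk> \<Longrightarrow> orbit_act Y X r F (b, a) = trn r b a F"
  by (simp add: orbit_sum_act_def trn_def)

lemma phi_inv_cancel [simp]: "\<lbrakk>r \<in> carrier G; a \<in> Obj C\<rbrakk> \<Longrightarrow> \<phi> r (\<phi> (inv r) a) = a"
  "\<lbrakk>r \<in> carrier G; a \<in> Obj C\<rbrakk> \<Longrightarrow> \<phi> (inv r) (\<phi> r a) = a"
  by (simp_all add: phi_phi)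

context
  fixes Y X
  assumes Y: "Y \<in> orbs" and X: "X \<in> orbs"
begin

lemma trn_linear:
  assumes r: "r \<in> carrier G" and b: "b \<in> Y" and a: "a \<in> X"
  shows "trn r b a \<in> linear_maps K (V Y X) (Mor C b a)"
proof -
  have [simp]: "b \<in> Obj C" "a \<in> Obj C" using assms X Y orbs_sub by blast+
  let ?b = "\<phi> (inv r) b" and ?a = "\<phi> (inv r) a"
  have ba: "?b \<in> Y" "?a \<in> X" using assms X Y by (simp_all add: orbs_closed)
  show ?thesis
    using r linear_maps_comp[OF V_eval_linear[OF ba] act_linear[of r ?a ?b]] by
        (simp add: trn_def[abs_def])
qed

lemma trn_closed: "\<lbrakk>r \<in> carrier G; b \<in> Y; a \<in> X; F \<in> carrier (V Y X)\<rbrakk> \<Longrightarrow> trn r b a F \<in> carrier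
    (Mor C b a)"
  using linear_maps_closed[OF trn_linear] by blast

lemma orbit_act_closed: "\<lbrakk>r \<in> carrier G; F \<in> carrier (V Y X)\<rbrakk> \<Longrightarrow> orbit_act Y X r F \<in> carrier (V Y X)"
  using V_intro[OF Y X, of "\<lambda>b a. trn r b a F"] trn_closed
  by (simp add: orbit_sum_act_def trn_def)

lemma nrm_linear: "\<lbrakk>b \<in> Y; a \<in> X\<rbrakk> \<Longrightarrow> nrm b a \<in> linear_maps K (V Y X) (Mor C b a)"
  unfolding nrm_def[abs_def] using X Y
  by (intro linear_maps_sum Mor_module trn_linear finite_G) (simp_all add: orbs_sub)

lemma nrm_closed: "\<lbrakk>b \<in> Y; a \<in> X; F \<in> carrier (V Y X)\<rbrakk> \<Longrightarrow> nrm b a F \<in> carrier (Mor C b a)"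
  using linear_maps_closed[OF nrm_linear] by blast

lemma psi_trn:
  assumes u: "u \<in> carrier G" and r: "r \<in> carrier G" and b: "b \<in> Y" and a: "a \<in> X" and F: "F \<in> carrier
      (V Y X)"
  shows "\<psi> u b a (trn r b a F) = trn (u \<otimes> r) (\<phi> u b) (\<phi> u a) F"
proof -
  have [simp]: "b \<in> Obj C" "a \<in> Obj C" using assms X Y orbs_sub by blast+
  let ?b = "\<phi> (inv r) b" and ?a = "\<phi> (inv r) a"
  have ba: "?b \<in> Y" "?a \<in> X" using assms X Y by (simp_all add: orbs_closed)
  show ?thesis
    using act_mult[of r u ?a ?b "F (?b, ?a)"] u r V_mem[OF Y X F ba]
    by (simp add: trn_def phi_phi g_norm)
qed

text \<open>The norm is an invariant matrix: applying \<open>u\<close> replaces the summation index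
  \<open>r\<close> by \<open>u \<otimes> r\<close>.\<close>

lemma psi_nrm:
  assumes u: "u \<in> carrier G" and b: "b \<in> Y" and a: "a \<in> X" and F: "F \<in> carrier (V Y X)"
  shows "\<psi> u b a (nrm b a F) = nrm (\<phi> u b) (\<phi> u a) F"
proof -
  have [simp]: "b \<in> Obj C" "a \<in> Obj C" using assms X Y orbs_sub by blast+
  interpret M: abelian_monoid "Mor C (\<phi> u b) (\<phi> u a)" by (rule Mor_am) (simp_all add: u)
  have ub: "\<phi> u b \<in> Y" "\<phi> u a \<in> X" using assms X Y by (simp_all add: orbs_closed)
  have "\<psi> u b a (nrm b a F) = (\<Oplus>\<^bsub>Mor C (\<phi> u b) (\<phi> u a)\<^esub>r\<in>carrier G. \<psi> u b a (trn r b a F))"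
    unfolding nrm_def using assms finite_G by (intro psi_finsum) (simp_all add: trn_closed)
  also have "\<dots> = (\<Oplus>\<^bsub>Mor C (\<phi> u b) (\<phi> u a)\<^esub>r\<in>carrier G. trn (u \<otimes> r) (\<phi> u b) (\<phi> u a) F)"
    by (rule M.finsum_cong') (auto simp: psi_trn assms trn_closed ub)
  also have "\<dots> = nrm (\<phi> u b) (\<phi> u a) F"
    unfolding nrm_def
    by (rule M.finsum_bij[OF bij_left[OF u], symmetric]) (simp add: trn_closed ub F)
  finally show ?thesis .
qed

text \<open>Translating the argument replaces the summation index \<open>r\<close> by
  \<open>r \<otimes> s\<close>. Hence the norm kills the generators of the coinvariant
  relations.\<close>

lemma nrm_orbit_act:
  assumes s: "s \<in> carrier G" and b: "b \<in> Y" and a: "a \<in> X" and F: "F \<in> carrier (V Y X)"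
  shows "nrm b a (orbit_act Y X s F) = nrm b a F"
proof -
  have [simp]: "b \<in> Obj C" "a \<in> Obj C" using assms X Y orbs_sub by blast+
  interpret M: abelian_monoid "Mor C b a" by (rule Mor_am) simp_all
  have "trn r b a (orbit_act Y X s F) = trn (r \<otimes> s) b a F" if r: "r \<in> carrier G" for r
  proof -
    let ?b = "\<phi> (inv r) b" and ?a = "\<phi> (inv r) a"
    have ba: "?b \<in> Y" "?a \<in> X" using assms r X Y by (simp_all add: orbs_closed)
    have "trn r b a (orbit_act Y X s F) = \<psi> r ?b ?a (trn s ?b ?a F)"
      unfolding trn_def[of r] by (simp add: orbit_act_apply ba)
    also have "\<dots> = trn (r \<otimes> s) b a F"
      using psi_trn[OF r s ba F] r by simp
    finally show ?thesis .
  qed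
  then have "nrm b a (orbit_act Y X s F) = (\<Oplus>\<^bsub>Mor C b a\<^esub>r\<in>carrier G. trn (r \<otimes> s) b a F)"
    unfolding nrm_def by (intro M.finsum_cong') (auto simp: trn_closed assms)
  also have "\<dots> = nrm b a F"
    unfolding nrm_def
    by (rule M.finsum_bij[OF bij_right[OF s], symmetric]) (simp add: trn_closed assms)
  finally show ?thesis .
qed

lemma orbit_incl_closed: "\<lbrakk>b0 \<in> Y; a0 \<in> X; f \<in> carrier (Mor C b0 a0)\<rbrakk> \<Longrightarrow> orbit_incl C Y X b0 a0 f \<in>
    carrier (V Y X)"
  using X Y by (auto simp: orbit_incl_def direct_sum_incl_def V_carrier Mor_zero orbs_sub)

lemma orbit_incl_apply: "\<lbrakk>b \<in> Y; a \<in> X\<rbrakk>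
    \<Longrightarrow> orbit_incl C Y X b0 a0 f (b, a) = (if b = b0 \<and> a = a0 then f else \<zero>\<^bsub>Mor C b a\<^esub>)"
  by (auto simp: orbit_incl_def direct_sum_incl_def)

text \<open>By freeness \<open>r\<close> is the only group element that carries row
  \<open>b0\<close> to row \<open>\<phi> r b0\<close>, so a single summand of the norm
  survives.\<close>

lemma nrm_orbit_incl:
  assumes r: "r \<in> carrier G" and b0: "b0 \<in> Y" and a0: "a0 \<in> X" and f: "f \<in> carrier (Mor C b0 a0)" and a:
      "a \<in> X"
  shows "nrm (\<phi> r b0) a (orbit_incl C Y X b0 a0 f) =
      (if a = \<phi> r a0 then \<psi> r b0 a0 f else \<zero>\<^bsub>Mor C (\<phi> r b0) a\<^esub>)"
proof -
  have [simp]: "b0 \<in> Obj C" "a \<in> Obj C" "a0 \<in> Obj C" using assms X Y orbs_sub by blast+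
  interpret M: abelian_monoid "Mor C (\<phi> r b0) a" by (rule Mor_am) (simp_all add: r)
  have rb: "\<phi> r b0 \<in> Y" using Y b0 r by (simp add: orbs_closed)
  have t: "trn s (\<phi> r b0) a (orbit_incl C Y X b0 a0 f) =
      (if s = r \<and> a = \<phi> r a0 then \<psi> r b0 a0 f else \<zero>\<^bsub>Mor C (\<phi> r b0) a\<^esub>)" if s: "s \<in> carrier G" for s
  proof -
    have e1: "\<phi> (inv s) (\<phi> r b0) = b0 \<longleftrightarrow> s = r"
    proof
      assume "\<phi> (inv s) (\<phi> r b0) = b0"
      then have "\<phi> s b0 = \<phi> s (\<phi> (inv s) (\<phi> r b0))" by simp
      then show "s = r" using s r phi_eq_iff[of s r b0] by simp
    qed (simp add: r)
    have e2: "\<phi> (inv r) a = a0 \<longleftrightarrow> a = \<phi> r a0" using r by auto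
    have "\<phi> (inv s) (\<phi> r b0) \<in> Y" "\<phi> (inv s) a \<in> X"
      using X Y rb a s by (simp_all add: orbs_closed)
    then show ?thesis
      using s r e1 e2 psi_zero[of s "\<phi> (inv s) a" "\<phi> (inv s) (\<phi> r b0)"]
      by (auto simp: trn_def orbit_incl_apply)
  qed
  have "nrm (\<phi> r b0) a (orbit_incl C Y X b0 a0 f) = trn r (\<phi> r b0) a (orbit_incl C Y X b0 a0 f)"
    unfolding nrm_def
    using trn_closed[OF r rb a orbit_incl_closed[OF b0 a0 f]] r finite_G
    by (intro M.finsum_single) (auto simp: t)
  then show ?thesis using t[OF r] by simp
qed

end

section \<open>Coinvariants and the kernel of the norm\<close>

abbreviation rel :: "'o set \<Rightarrow> 'o set \<Rightarrow> ('o \<times> 'o \<Rightarrow> 'm) set" where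
  "rel Y X \<equiv> coinvariant_relations K G (V Y X) (orbit_act Y X)"

abbreviation cls :: "'o set \<Rightarrow> 'o set \<Rightarrow> ('o \<times> 'o \<Rightarrow> 'm) \<Rightarrow> ('o \<times> 'o \<Rightarrow> 'm) set" where
  "cls \<equiv> orbit_class K G C \<phi> \<psi>"

abbreviation B :: "('k, 'o set, ('o \<times> 'o \<Rightarrow> 'm) set) kcat" where
  "B \<equiv> quotient_category K G C \<phi> \<psi>"

text \<open>\<open>F\<close> is the sum of its rows \<open>R s\<close> indexed by \<open>pos Y s\<close>, and \<open>s\<close> moves \<open>R s\<close> to the row of \<open>x Y\<close>,
  where the translated rows add up to the norm of \<open>F\<close>. Hence modulo the relations \<open>F\<close> is determined
  by its norm.\<close>

lemma kernel_nrm_subset_rel: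
  assumes Y: "Y \<in> orbs" and X: "X \<in> orbs" and F: "F \<in> carrier (V Y X)"
    and 0: "\<And>a. a \<in> X \<Longrightarrow> nrm (x Y) a F = \<zero>\<^bsub>Mor C (x Y) a\<^esub>"
    and N: "submodule N K (V Y X)"
    and gen: "\<And>s F. \<lbrakk>s \<in> carrier G; F \<in> carrier (V Y X)\<rbrakk> \<Longrightarrow> orbit_act Y X s F \<ominus>\<^bsub>V Y X\<^esub> F \<in> N"
  shows "F \<in> N"
proof -
  interpret V: module K "V Y X" by (rule V_module[OF Y X])
  define R where "R s = (\<lambda>(b, a)\<in>Y \<times> X. if b = pos Y s then F (b, a) else \<zero>\<^bsub>Mor C b a\<^esub>)" for s
  have Ob: "b \<in> Obj C" if "b \<in> Y" for b using that Y orbs_sub by blast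
  have Oa: "a \<in> Obj C" if "a \<in> X" for a using that X orbs_sub by blast
  have R: "R s \<in> carrier (V Y X)" for s
    unfolding R_def by (rule V_intro[OF Y X]) (auto simp: V_mem[OF Y X F] Mor_zero Ob Oa)
  note ev = V_eval_linear
  have fs: "(\<Oplus>\<^bsub>V Y X\<^esub>s\<in>carrier G. g s) (b, a) = (\<Oplus>\<^bsub>Mor C b a\<^esub>s\<in>carrier G. g s (b, a))"
    if "b \<in> Y" "a \<in> X" "\<And>s. s \<in> carrier G \<Longrightarrow> g s \<in> carrier (V Y X)" for b a g
    by (rule linear_maps_finsum[OF ev[OF that(1,2)] V.abelian_group_axioms Mor_ag finite_G])
      (simp_all add: that Ob Oa)
  have sumR: "(\<Oplus>\<^bsub>V Y X\<^esub>s\<in>carrier G. R s) = F"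
  proof (rule V_eqI[OF Y X _ F])
    fix b a assume ba: "b \<in> Y" "a \<in> X"
    interpret M: abelian_monoid "Mor C b a" by (rule Mor_am[OF Oa[OF ba(2)] Ob[OF ba(1)]])
    obtain s where s: "s \<in> carrier G" "b = pos Y s"
      using bij_betw_imp_surj_on[OF bij_pos[OF Y]] ba(1) by blast
    have "(\<Oplus>\<^bsub>V Y X\<^esub>s\<in>carrier G. R s) (b, a) = (\<Oplus>\<^bsub>Mor C b a\<^esub>s\<in>carrier G. R s (b, a))"
      by (rule fs[OF ba]) (rule R)
    also have "\<dots> = R s (b, a)"
      by (rule M.finsum_single) (use s ba V_mem[OF Y X F ba] in \<open>auto simp: finite_G R_def
          pos_eq_iff[OF Y]\<close>)
    finally show "(\<Oplus>\<^bsub>V Y X\<^esub>s\<in>carrier G. R s) (b, a) = F (b, a)" using s ba by (simp add: R_def)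
  qed (rule V.finsum_closed, use R in auto)
  have sum0: "(\<Oplus>\<^bsub>V Y X\<^esub>s\<in>carrier G. orbit_act Y X s (R s)) = \<zero>\<^bsub>V Y X\<^esub>"
  proof (rule V_eqI[OF Y X])
    fix b a assume ba: "b \<in> Y" "a \<in> X"
    interpret M: abelian_monoid "Mor C b a" by (rule Mor_am[OF Oa[OF ba(2)] Ob[OF ba(1)]])
    have "(\<Oplus>\<^bsub>V Y X\<^esub>s\<in>carrier G. orbit_act Y X s (R s)) (b, a) =
        (\<Oplus>\<^bsub>Mor C b a\<^esub>s\<in>carrier G. orbit_act Y X s (R s) (b, a))"
      by (rule fs[OF ba]) (simp add: orbit_act_closed[OF Y X] R)
    also have "\<dots> = (\<Oplus>\<^bsub>Mor C b a\<^esub>s\<in>carrier G. if b = x Y then trn s b a F else \<zero>\<^bsub>Mor C b a\<^esub>)"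
    proof (rule M.finsum_cong'[OF refl])
      fix s assume s: "s \<in> carrier G"
      have m: "\<phi> (inv s) b \<in> Y" "\<phi> (inv s) a \<in> X"
        using X Y ba s by (simp_all add: orbs_closed)
      have e: "\<phi> (inv s) b = pos Y s \<longleftrightarrow> b = x Y"
      proof
        assume "\<phi> (inv s) b = pos Y s"
        then have "\<phi> s (\<phi> (inv s) b) = \<phi> s (pos Y s)" by simp
        then show "b = x Y" using s Ob[OF ba(1)] Y by (simp add: pos_def)
      qed (simp add: pos_def)
      show "orbit_act Y X s (R s) (b, a) = (if b = x Y then trn s b a F else \<zero>\<^bsub>Mor C b a\<^esub>)"
        using s ba m e psi_zero[of s "\<phi> (inv s) a" "\<phi> (inv s) b"] Oa[OF ba(2)] Ob[OF ba(1)]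
        by (auto simp: orbit_act_apply trn_def R_def)
    qed (use ba F in \<open>auto simp: trn_closed[OF Y X]\<close>)
    also have "\<dots> = \<zero>\<^bsub>Mor C b a\<^esub>"
      using 0[OF ba(2)] by (cases "b = x Y") (auto simp: nrm_def)
    finally show "(\<Oplus>\<^bsub>V Y X\<^esub>s\<in>carrier G. orbit_act Y X s (R s)) (b, a) = \<zero>\<^bsub>V Y X\<^esub> (b, a)"
      using ba by (simp add: V_zero)
  qed (auto intro!: V.finsum_closed orbit_act_closed[OF Y X] R)
  have N': "abelian_subgroup N (V Y X)"
    by (rule abelian_subgroupI3[OF additive_subgroup.intro[OF submodule.axioms(1)[OF N]]
        V.abelian_group_axioms])
  interpret N: abelian_subgroup N "V Y X" by (rule N')
  note q = quotient_module_module[OF V.module_axioms N]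
  note q_sum = linear_maps_finsum[OF q(2) V.abelian_group_axioms module_abelian_group[OF q(1)] finite_G]
  have q_osa: "N +>\<^bsub>V Y X\<^esub> orbit_act Y X s (R s) = N +>\<^bsub>V Y X\<^esub> R s" if s: "s \<in> carrier G" for s
  proof -
    have eq: "(orbit_act Y X s (R s) \<ominus>\<^bsub>V Y X\<^esub> R s) \<oplus>\<^bsub>V Y X\<^esub> R s = orbit_act Y X s (R s)"
      using R[of s] orbit_act_closed[OF Y X s R] by (simp add: V.minus_eq V.a_assoc V.l_neg)
    have "orbit_act Y X s (R s) \<in> N +>\<^bsub>V Y X\<^esub> R s"
      using V.a_rcosI[OF gen[OF s R[of s]] N.a_subset R[of s]] unfolding eq .
    then show ?thesis using N.a_repr_independence'[OF _ R[of s]] by simp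
  qed
  \<comment> \<open>Modulo \<open>N\<close>, the matrix \<open>F\<close> is the sum of its rows,
    hence of their translates, hence zero. Here \<open>N\<close> is arbitrary because the relations
    are an intersection of such submodules.\<close>
  have "N +>\<^bsub>V Y X\<^esub> F = (\<Oplus>\<^bsub>quotient_module (V Y X) N\<^esub>s\<in>carrier G. N +>\<^bsub>V Y X\<^esub> R s)"
    unfolding sumR[symmetric] using R by (intro q_sum) auto
  also have "\<dots> = (\<Oplus>\<^bsub>quotient_module (V Y X) N\<^esub>s\<in>carrier G. N +>\<^bsub>V Y X\<^esub> orbit_act Y X s (R s))"
    by (rule abelian_monoid.finsum_cong'[OF module_abelian_monoid[OF q(1)]])
        (use R in \<open>auto simp: q_osa q(3)\<close>)
  also have "\<dots> = N +>\<^bsub>V Y X\<^esub> \<zero>\<^bsub>V Y X\<^esub>"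
    unfolding sum0[symmetric] using R by (intro q_sum[symmetric]) (simp add: orbit_act_closed[OF Y X])
  also have "\<dots> = N"
    by (rule V.a_coset_join2[OF V.zero_closed N.a_subgroup N.zero_closed])
  finally show ?thesis using N.a_rcos_self[OF F] by simp
qed

text \<open>The kernel of the norm contains the generators, so it is among the submodules being
  intersected; by \<open>kernel_nrm_subset_rel\<close> it lies in each of them.\<close>

lemma rel_eq:
  assumes Y: "Y \<in> orbs" and X: "X \<in> orbs"
  shows "rel Y X = {F \<in> carrier (V Y X). \<forall>b\<in>Y. \<forall>a\<in>X. nrm b a F = \<zero>\<^bsub>Mor C b a\<^esub>}" (is "_ = ?k")
    and "submodule (rel Y X) K (V Y X)"
proof -
  interpret V: module K "V Y X" by (rule V_module[OF Y X])
  have Ob: "b \<in> Obj C" if "b \<in> Y" for b using that Y orbs_sub by blast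
  have Oa: "a \<in> Obj C" if "a \<in> X" for a using that X orbs_sub by blast
  note l = nrm_linear[OF Y X]
  have m: "module K (Mor C b a)" if "b \<in> Y" "a \<in> X" for b a using Mor_module Ob Oa that by blast
  have k: "submodule ?k K (V Y X)"
    using submodule_kernel[OF V.module_axioms, of "Y \<times> X" "\<lambda>p. Mor C (fst p) (snd p)" "\<lambda>p. nrm (fst p)
        (snd p)"]
    by (auto simp: m l)
  have gen: "orbit_act Y X s F \<ominus>\<^bsub>V Y X\<^esub> F \<in> ?k" if s: "s \<in> carrier G" and F: "F \<in> carrier (V Y X)" for s
      F
    using s F linear_maps_neg[OF l V.module_axioms m] abelian_group.r_neg[OF module_abelian_group[OF m]]
    by (auto simp: V.minus_eq linear_maps_add[OF l] orbit_act_closed[OF Y X] nrm_orbit_act[OF Y X]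
        nrm_closed[OF Y X])
  show eq: "rel Y X = ?k"
  proof
    show "rel Y X \<subseteq> ?k"
      unfolding coinvariant_relations_def spanned_submodule_def
      by (rule Inter_lower) (use k gen in auto)
    show "?k \<subseteq> rel Y X"
      unfolding coinvariant_relations_def spanned_submodule_def
    proof (intro Inter_greatest subsetI)
      fix N F
      assume N: "N \<in> {N. submodule N K (V Y X) \<and> {orbit_act Y X s v \<ominus>\<^bsub>V Y X\<^esub> v |s v. s \<in> carrier G \<and> v \<in>
          carrier (V Y X)} \<subseteq> N}"
        and F: "F \<in> ?k"
      show "F \<in> N"
        by (rule kernel_nrm_subset_rel[OF Y X]) (use N F x_in[OF Y] in auto)
    qed
  qed
  show "submodule (rel Y X) K (V Y X)" unfolding eq by (rule k)
qed

section \<open>Morphisms of the quotient category as invariant matrices\<close>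

lemma B_simps:
  "Obj B = orbs"
  "Mor B Y X = quotient_module (V Y X) (rel Y X)"
  "Cmp B Z Y X P Q = (\<Union>g\<in>P. \<Union>f\<in>Q. cls Z X (orbit_sum_Cmp G C \<phi> \<psi> Z Y X g f))"
  "Idt B X = (\<Union>a\<in>X. cls X X (orbit_incl C X X a a (Idt C a)))"
  by (simp_all add: quotient_category_def coinvariants_def)

lemma B_module: "\<lbrakk>Y \<in> orbs; X \<in> orbs\<rbrakk> \<Longrightarrow> module K (Mor B Y X)"
  unfolding B_simps by (rule quotient_module_module(1)[OF V_module rel_eq(2)])

lemma cls_linear: "\<lbrakk>Y \<in> orbs; X \<in> orbs\<rbrakk> \<Longrightarrow> cls Y X \<in> linear_maps K (V Y X) (Mor B Y X)"
  unfolding B_simps orbit_class_def[abs_def] by (rule quotient_module_module(2)[OF V_module rel_eq(2)])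

lemma cls_surj: "\<lbrakk>Y \<in> orbs; X \<in> orbs\<rbrakk> \<Longrightarrow> carrier (Mor B Y X) = cls Y X ` carrier (V Y X)"
  unfolding B_simps orbit_class_def[abs_def] by (rule quotient_module_module(3)[OF V_module rel_eq(2)])

text \<open>Classes are the fibres of the norm. Independence of representatives thereby becomes a
  comparison of norms.\<close>

lemma cls_eq:
  assumes Y: "Y \<in> orbs" and X: "X \<in> orbs" and F: "F \<in> carrier (V Y X)"
  shows "cls Y X F = {F' \<in> carrier (V Y X). \<forall>b\<in>Y. \<forall>a\<in>X. nrm b a F' = nrm b a F}"
proof -
  interpret V: module K "V Y X" by (rule V_module[OF Y X])
  note l = nrm_linear[OF Y X]
  have m: "module K (Mor C b a)" if "b \<in> Y" "a \<in> X" for b a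
    using Mor_module orbs_sub[OF Y] orbs_sub[OF X] that by blast
  show ?thesis
  proof (intro equalityI subsetI)
    fix F' assume "F' \<in> cls Y X F"
    then obtain n where n: "n \<in> rel Y X" "F' = n \<oplus>\<^bsub>V Y X\<^esub> F"
      by (auto simp: orbit_class_def a_r_coset_def')
    have nk: "n \<in> carrier (V Y X)" "\<And>b a. \<lbrakk>b \<in> Y; a \<in> X\<rbrakk> \<Longrightarrow> nrm b a n = \<zero>\<^bsub>Mor C b a\<^esub>"
      using n(1) by (auto simp: rel_eq(1)[OF Y X])
    have "nrm b a F' = nrm b a F" if ba: "b \<in> Y" "a \<in> X" for b a
    proof -
      interpret M: module K "Mor C b a" by (rule m[OF ba])
      show ?thesis using F ba nk by (simp add: n(2) linear_maps_add[OF l] nrm_closed[OF Y X])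
    qed
    then show "F' \<in> {F' \<in> carrier (V Y X). \<forall>b\<in>Y. \<forall>a\<in>X. nrm b a F' = nrm b a F}"
      using n(2) nk(1) F by auto
  next
    fix F' assume F': "F' \<in> {F' \<in> carrier (V Y X). \<forall>b\<in>Y. \<forall>a\<in>X. nrm b a F' = nrm b a F}"
    let ?n = "F' \<ominus>\<^bsub>V Y X\<^esub> F"
    have nV: "?n \<in> carrier (V Y X)" using F F' by simp
    have n: "?n \<oplus>\<^bsub>V Y X\<^esub> F = F'" using F F' by (simp add: V.minus_eq V.a_assoc V.l_neg)
    have "nrm b a ?n = \<zero>\<^bsub>Mor C b a\<^esub>" if ba: "b \<in> Y" "a \<in> X" for b a
    proof -
      interpret M: module K "Mor C b a" by (rule m[OF ba])
      have "nrm b a ?n \<oplus>\<^bsub>Mor C b a\<^esub> nrm b a F = nrm b a F'"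
        using linear_maps_add[OF l[OF ba] nV F] n by simp
      then show ?thesis using F F' ba nV by (simp add: nrm_closed[OF Y X])
    qed
    then have "?n \<in> rel Y X" using F F' by (auto simp: rel_eq(1)[OF Y X])
    then show "F' \<in> cls Y X F" using n by (force simp: orbit_class_def a_r_coset_def')
  qed
qed

lemma cls_eqI:
  assumes Y: "Y \<in> orbs" and X: "X \<in> orbs" and F: "F \<in> carrier (V Y X)" and F': "F' \<in> carrier (V Y X)"
    and "\<And>b a. \<lbrakk>b \<in> Y; a \<in> X\<rbrakk> \<Longrightarrow> nrm b a F = nrm b a F'"
  shows "cls Y X F = cls Y X F'"
  using assms(5) by (auto simp: cls_eq[OF Y X F] cls_eq[OF Y X F'])

text \<open>Entry \<open>(s, t)\<close> of the norm of a representative; by \<open>cls_eq\<close>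
  every representative gives the same value.\<close>

definition eB :: "'o set \<Rightarrow> 'o set \<Rightarrow> 'g \<Rightarrow> 'g \<Rightarrow> ('o \<times> 'o \<Rightarrow> 'm) set \<Rightarrow> 'm" where
  "eB Y X s t P = nrm (pos Y s) (pos X t) (SOME F. F \<in> P)"

lemma eB_cls:
  assumes "Y \<in> orbs" "X \<in> orbs" "F \<in> carrier (V Y X)" "s \<in> carrier G" "t \<in> carrier G"
  shows "eB Y X s t (cls Y X F) = nrm (pos Y s) (pos X t) F"
proof -
  have "F \<in> cls Y X F" using assms by (simp add: cls_eq)
  then have "(SOME F'. F' \<in> cls Y X F) \<in> cls Y X F"
    by (rule someI[of "\<lambda>F'. F' \<in> cls Y X F"])
  then show ?thesis using assms by (simp add: eB_def cls_eq)
qed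

lemma B_obtain:
  assumes "Y \<in> orbs" "X \<in> orbs" "P \<in> carrier (Mor B Y X)"
  obtains F where "F \<in> carrier (V Y X)" "P = cls Y X F"
  using assms by (auto simp: cls_surj)

lemma eB_linear:
  assumes Y: "Y \<in> orbs" and X: "X \<in> orbs" and s: "s \<in> carrier G" and t: "t \<in> carrier G"
  shows "eB Y X s t \<in> linear_maps K (Mor B Y X) (Mor C (pos Y s) (pos X t))"
proof -
  interpret V: module K "V Y X" by (rule V_module[OF Y X])
  note l = nrm_linear[OF Y X pos_in[OF Y s] pos_in[OF X t]] and c = cls_linear[OF Y X]
  have e: "eB Y X s t (cls Y X F) = nrm (pos Y s) (pos X t) F" if "F \<in> carrier (V Y X)" for F
    using eB_cls[OF Y X that s t] .
  show ?thesis
    by (rule linear_mapsI)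
      (auto simp: cls_surj[OF Y X] e linear_maps_closed[OF l] linear_maps_add[OF c, symmetric]
        linear_maps_smult[OF c, symmetric] linear_maps_add[OF l] linear_maps_smult[OF l])
qed

lemma eB_inj:
  assumes Y: "Y \<in> orbs" and X: "X \<in> orbs" and P: "P \<in> carrier (Mor B Y X)" and Q: "Q \<in> carrier
      (Mor B Y X)"
    and eq: "\<And>s t. \<lbrakk>s \<in> carrier G; t \<in> carrier G\<rbrakk> \<Longrightarrow> eB Y X s t P = eB Y X s t Q"
  shows "P = Q"
proof -
  obtain F where F: "F \<in> carrier (V Y X)" "P = cls Y X F" using B_obtain[OF Y X P] .
  obtain F' where F': "F' \<in> carrier (V Y X)" "Q = cls Y X F'" using B_obtain[OF Y X Q] .
  have "nrm b a F = nrm b a F'" if ba: "b \<in> Y" "a \<in> X" for b a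
  proof -
    obtain s t where "s \<in> carrier G" "b = pos Y s" "t \<in> carrier G" "a = pos X t"
      using bij_betw_imp_surj_on[OF bij_pos[OF Y]] bij_betw_imp_surj_on[OF bij_pos[OF X]] ba by blast
    then show ?thesis using eq[of s t] F F' by (simp add: eB_cls X Y)
  qed
  then show ?thesis using cls_eqI[OF Y X F(1) F'(1)] F F' by simp
qed

text \<open>Equivariance under simultaneous right translation of both labels; it is the reason why
  one row or one column determines the whole matrix.\<close>

lemma psi_eB:
  assumes Y: "Y \<in> orbs" and X: "X \<in> orbs" and P: "P \<in> carrier (Mor B Y X)"
    and s: "s \<in> carrier G" and t: "t \<in> carrier G" and r: "r \<in> carrier G"
  shows "\<psi> r (pos Y s) (pos X t) (eB Y X s t P) = eB Y X (s \<otimes> inv r) (t \<otimes> inv r) P"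
proof -
  obtain F where F: "F \<in> carrier (V Y X)" "P = cls Y X F" using B_obtain[OF Y X P] .
  show ?thesis using assms F by (simp add: eB_cls psi_nrm[OF Y X] phi_pos)
qed

text \<open>An invariant matrix is the norm of any one of its rows, extended by zero; the row
  labelled \<open>\<one>\<close> is used.\<close>

lemma eB_surj:
  assumes Y: "Y \<in> orbs" and X: "X \<in> orbs"
    and m: "\<And>s t. \<lbrakk>s \<in> carrier G; t \<in> carrier G\<rbrakk> \<Longrightarrow> m s t \<in> carrier (Mor C (pos Y s) (pos X t))"
    and inv: "\<And>r s t. \<lbrakk>r \<in> carrier G; s \<in> carrier G; t \<in> carrier G\<rbrakk>
      \<Longrightarrow> \<psi> r (pos Y s) (pos X t) (m s t) = m (s \<otimes> inv r) (t \<otimes> inv r)"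
  shows "\<exists>P\<in>carrier (Mor B Y X). \<forall>s\<in>carrier G. \<forall>t\<in>carrier G. eB Y X s t P = m s t"
proof -
  define ix where "ix = inv_into (carrier G) (pos X)"
  have ix: "ix (pos X t) = t" if "t \<in> carrier G" for t
    unfolding ix_def using bij_pos[OF X] that by (auto simp: bij_betw_def)
  have ix': "ix a \<in> carrier G" "pos X (ix a) = a" if "a \<in> X" for a
    using bij_pos[OF X] that unfolding ix_def bij_betw_def
    by (auto intro: inv_into_into f_inv_into_f)
  define F where "F = (\<lambda>(b, a)\<in>Y \<times> X. if b = x Y then m \<one> (ix a) else \<zero>\<^bsub>Mor C b a\<^esub>)"
  have m1: "m \<one> (ix a) \<in> carrier (Mor C (x Y) a)" if "a \<in> X" for a
    using m[of "\<one>" "ix a"] ix'[OF that] by (simp add: pos_one[OF Y])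
  have Ob: "b \<in> Obj C" if "b \<in> Y" for b using that Y orbs_sub by blast
  have Oa: "a \<in> Obj C" if "a \<in> X" for a using that X orbs_sub by blast
  have F: "F \<in> carrier (V Y X)"
    unfolding F_def by (rule V_intro[OF Y X]) (auto simp: m1 Mor_zero Ob Oa)
  have "nrm (pos Y s) (pos X t) F = m s t" if s: "s \<in> carrier G" and t: "t \<in> carrier G" for s t
  proof -
    interpret M: abelian_monoid "Mor C (pos Y s) (pos X t)" using s t X Y by (intro Mor_am) simp_all
    \<comment> \<open>The translate by \<open>r\<close> at row \<open>pos Y s\<close> reads row
      \<open>s \<otimes> r\<close> of \<open>F\<close>, which is zero unless
      \<open>s \<otimes> r\<close> is \<open>\<one>\<close>.\<close>
    have tr: "trn r (pos Y s) (pos X t) F = (if r = inv s then m s t else \<zero>\<^bsub>Mor C (pos Y s) (pos X t)\<^esub>)"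
      if r: "r \<in> carrier G" for r
    proof -
      have e: "pos Y (s \<otimes> r) = x Y \<longleftrightarrow> r = inv s"
      proof
        assume "pos Y (s \<otimes> r) = x Y"
        then have "s \<otimes> r = \<one>" using pos_eq_iff[OF Y, of "s \<otimes> r" "\<one>"] s r by (simp add: pos_one[OF Y])
        then have "inv s \<otimes> (s \<otimes> r) = inv s" using s by simp
        then show "r = inv s" using s r by (simp add: g_norm)
      qed (use s in \<open>simp add: pos_one[OF Y]\<close>)
      show ?thesis
      proof (cases "r = inv s")
        case True
        then show ?thesis
          using s t inv[of "inv s" "\<one>" "t \<otimes> inv s"] X Y
          by (simp add: trn_def phi_pos F_def pos_one ix x_in g_norm)
      next
        case False
        then show ?thesis
          using s t r e psi_zero[of r "pos X (t \<otimes> r)" "pos Y (s \<otimes> r)"] X Y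
          by (simp add: trn_def phi_pos F_def g_norm)
      qed
    qed
    have "nrm (pos Y s) (pos X t) F = trn (inv s) (pos Y s) (pos X t) F"
      unfolding nrm_def by (rule M.finsum_single) (use s t m in \<open>auto simp: finite_G tr\<close>)
    then show ?thesis using s by (simp add: tr)
  qed
  then show ?thesis
    using F X Y by (intro bexI[of _ "cls Y X F"]) (auto simp: eB_cls cls_surj)
qed

section \<open>Composition and identities of the quotient category\<close>

abbreviation orbit_cmp where "orbit_cmp \<equiv> orbit_sum_Cmp G C \<phi> \<psi>"

context
  fixes Z Y X g f
  assumes Z: "Z \<in> orbs" and Y: "Y \<in> orbs" and X: "X \<in> orbs"
    and g: "g \<in> carrier (V Z Y)" and f: "f \<in> carrier (V Y X)"
begin

text \<open>By linearity the inner sum over \<open>s\<close> assembles the norm of \<open>f\<close>,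
  so the composite is the matrix product of \<open>g\<close> with the norm of
  \<open>f\<close>.\<close>

lemma orbit_cmp_apply:
  assumes d: "d \<in> Z" and a: "a \<in> X"
  shows "orbit_cmp Z Y X g f (d, a) = (\<Oplus>\<^bsub>Mor C d a\<^esub>c\<in>Y. Cmp C d c a (g (d, c)) (nrm c a f))"
proof -
  have O: "d \<in> Obj C" "a \<in> Obj C" "\<And>c. c \<in> Y \<Longrightarrow> c \<in> Obj C"
    using d a X Y Z orbs_sub by blast+
  interpret M: abelian_monoid "Mor C d a" by (rule Mor_am[OF O(2,1)])
  have "orbit_cmp Z Y X g f (d, a) =
    (\<Oplus>\<^bsub>Mor C d a\<^esub>c\<in>Y. \<Oplus>\<^bsub>Mor C d a\<^esub>s\<in>carrier G. Cmp C d c a (g (d, c)) (trn s c a f))"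
    using d a by (simp add: orbit_sum_Cmp_def trn_def)
  also have "\<dots> = (\<Oplus>\<^bsub>Mor C d a\<^esub>c\<in>Y. Cmp C d c a (g (d, c)) (nrm c a f))"
    unfolding nrm_def
    by (rule M.finsum_cong')
      (use d a O in \<open>auto simp: Cmp_finsum_right finite_G trn_closed[OF Y X _ _ _ f] V_mem[OF Z Y g]
          Cmp_closed
        intro!: M.finsum_closed\<close>)
  finally show ?thesis .
qed

lemma orbit_cmp_closed: "orbit_cmp Z Y X g f \<in> carrier (V Z X)"
proof -
  have "orbit_cmp Z Y X g f (d, a) \<in> carrier (Mor C d a)" if "d \<in> Z" "a \<in> X" for d a
    using that orbs_sub[OF X] orbs_sub[OF Y] orbs_sub[OF Z]
    by (simp add: orbit_cmp_apply Mor_finsum Cmp_closed V_mem[OF Z Y g] nrm_closed[OF Y X _ _ f])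
  moreover have "orbit_cmp Z Y X g f \<in> extensional (Z \<times> X)"
    by (simp add: orbit_sum_Cmp_def)
  ultimately show ?thesis by (auto simp: V_carrier[OF Z X] PiE_def Pi_def)
qed

text \<open>Translating the product by \<open>r\<close> translates \<open>g\<close> and leaves the
  invariant norm of \<open>f\<close> alone; summing over \<open>r\<close> then turns
  \<open>g\<close> into its norm. So the norm is multiplicative.\<close>

lemma nrm_orbit_cmp:
  assumes d: "d \<in> Z" and a: "a \<in> X"
  shows "nrm d a (orbit_cmp Z Y X g f) = (\<Oplus>\<^bsub>Mor C d a\<^esub>c\<in>Y. Cmp C d c a (nrm d c g) (nrm c a f))"
proof -
  have O: "d \<in> Obj C" "a \<in> Obj C" and Oc: "\<And>c. c \<in> Y \<Longrightarrow> c \<in> Obj C"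
    using d a X Y Z orbs_sub by blast+
  interpret M: abelian_monoid "Mor C d a" by (rule Mor_am[OF O(2,1)])
  have tc: "Cmp C d c a (trn r d c g) (nrm c a f) \<in> carrier (Mor C d a)" if "r \<in> carrier G" "c \<in> Y" for
      r c
    using that d a O Oc by (simp add: Cmp_closed trn_closed[OF Z Y _ _ _ g] nrm_closed[OF Y X _ _ f])
  have "trn r d a (orbit_cmp Z Y X g f) = (\<Oplus>\<^bsub>Mor C d a\<^esub>c\<in>Y. Cmp C d c a (trn r d c g) (nrm c a f))"
    if r: "r \<in> carrier G" for r
  proof -
    let ?d = "\<phi> (inv r) d" and ?a = "\<phi> (inv r) a"
    have da: "?d \<in> Z" "?a \<in> X" using d a r Z X by (simp_all add: orbs_closed)
    have rc: "\<phi> (inv r) c \<in> Y" if "c \<in> Y" for c using that r Y by (simp add: orbs_closed)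
    have bij: "bij_betw (\<phi> (inv r)) Y Y"
      by (rule bij_betwI[of _ _ _ "\<phi> r"]) (use r Y Oc in \<open>auto simp: orbs_closed\<close>)
    interpret M': abelian_monoid "Mor C ?d ?a" by (rule Mor_am) (simp_all add: r O)
    have t1: "Cmp C ?d c ?a (g (?d, c)) (nrm c ?a f) \<in> carrier (Mor C ?d ?a)" if "c \<in> Y" for c
      using that da r O Oc by (simp add: Cmp_closed V_mem[OF Z Y g] nrm_closed[OF Y X _ _ f])
    have "trn r d a (orbit_cmp Z Y X g f) = \<psi> r ?d ?a
        (\<Oplus>\<^bsub>Mor C ?d ?a\<^esub>c\<in>Y. Cmp C ?d c ?a (g (?d, c)) (nrm c ?a f))"
      unfolding trn_def by (simp add: orbit_cmp_apply da)
    \<comment> \<open>Reindexing by \<open>\<phi> (inv r)\<close> makes the action of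
      \<open>r\<close> return the middle object to \<open>c\<close>.\<close>
    also have "\<dots> = \<psi> r ?d ?a (\<Oplus>\<^bsub>Mor C ?d ?a\<^esub>c\<in>Y.
        Cmp C ?d (\<phi> (inv r) c) ?a (g (?d, \<phi> (inv r) c)) (nrm (\<phi> (inv r) c) ?a f))"
      by (rule arg_cong[where f = "\<psi> r ?d ?a"], rule M'.finsum_bij[OF bij]) (rule t1)
    also have "\<dots> = (\<Oplus>\<^bsub>Mor C (\<phi> r ?d) (\<phi> r ?a)\<^esub>c\<in>Y.
        \<psi> r ?d ?a (Cmp C ?d (\<phi> (inv r) c) ?a (g (?d, \<phi> (inv r) c)) (nrm (\<phi> (inv r) c) ?a f)))"
      by (rule psi_finsum) (simp_all add: r O orbs_finite[OF Y] t1 rc)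
    also have "\<dots> = (\<Oplus>\<^bsub>Mor C d a\<^esub>c\<in>Y.
        \<psi> r ?d ?a (Cmp C ?d (\<phi> (inv r) c) ?a (g (?d, \<phi> (inv r) c)) (nrm (\<phi> (inv r) c) ?a f)))"
      using r O by simp
    also have "\<dots> = (\<Oplus>\<^bsub>Mor C d a\<^esub>c\<in>Y. Cmp C d c a (trn r d c g) (nrm c a f))"
    proof (rule M.finsum_cong'[OF refl])
      fix c assume c: "c \<in> Y"
      show "\<psi> r ?d ?a (Cmp C ?d (\<phi> (inv r) c) ?a (g (?d, \<phi> (inv r) c)) (nrm (\<phi> (inv r) c) ?a f)) =
          Cmp C d c a (trn r d c g) (nrm c a f)"
        using r O Oc[OF c] rc[OF c] da
          act_Cmp[of r ?a "\<phi> (inv r) c" ?d "g (?d, \<phi> (inv r) c)" "nrm (\<phi> (inv r) c) ?a f"]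
          psi_nrm[OF Y X r rc[OF c] da(2) f]
        by (simp add: trn_def V_mem[OF Z Y g] nrm_closed[OF Y X _ _ f])
    qed (use tc r in auto)
    finally show ?thesis .
  qed
  then have "nrm d a (orbit_cmp Z Y X g f) = (\<Oplus>\<^bsub>Mor C d a\<^esub>r\<in>carrier G. \<Oplus>\<^bsub>Mor C d a\<^esub>c\<in>Y. Cmp C d c a
      (trn r d c g) (nrm c a f))"
    unfolding nrm_def[of d a] by (intro M.finsum_cong') (auto intro!: M.finsum_closed tc)
  also have "\<dots> = (\<Oplus>\<^bsub>Mor C d a\<^esub>c\<in>Y. \<Oplus>\<^bsub>Mor C d a\<^esub>r\<in>carrier G. Cmp C d c a (trn r d c g) (nrm c a f))"
    by (rule M.finsum_swap) (auto simp: finite_G orbs_finite[OF Y] tc)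
  also have "\<dots> = (\<Oplus>\<^bsub>Mor C d a\<^esub>c\<in>Y. Cmp C d c a (nrm d c g) (nrm c a f))"
    unfolding nrm_def[of d]
    by (rule M.finsum_cong')
      (use d a O Oc in \<open>auto simp: Cmp_finsum_left finite_G trn_closed[OF Z Y _ _ _ g]
          nrm_closed[OF Y X _ _ f] Cmp_closed
        intro!: M.finsum_closed\<close>)
  finally show ?thesis .
qed

end

text \<open>The composite is a union over all pairs of representatives. The norm of a product
  depends only on the norms of its factors, so all members of the union coincide.\<close>

lemma B_Cmp_cls:
  assumes Z: "Z \<in> orbs" and Y: "Y \<in> orbs" and X: "X \<in> orbs"
    and g: "g \<in> carrier (V Z Y)" and f: "f \<in> carrier (V Y X)"
  shows "Cmp B Z Y X (cls Z Y g) (cls Y X f) = cls Z X (orbit_cmp Z Y X g f)"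
proof -
  have eq: "cls Z X (orbit_cmp Z Y X g' f') = cls Z X (orbit_cmp Z Y X g f)"
    if g': "g' \<in> cls Z Y g" and f': "f' \<in> cls Y X f" for g' f'
  proof -
    have G': "g' \<in> carrier (V Z Y)" "\<And>d c. \<lbrakk>d \<in> Z; c \<in> Y\<rbrakk> \<Longrightarrow> nrm d c g' = nrm d c g"
      using g' by (simp_all add: cls_eq[OF Z Y g])
    have F': "f' \<in> carrier (V Y X)" "\<And>c a. \<lbrakk>c \<in> Y; a \<in> X\<rbrakk> \<Longrightarrow> nrm c a f' = nrm c a f"
      using f' by (simp_all add: cls_eq[OF Y X f])
    show ?thesis
    proof (rule cls_eqI[OF Z X orbit_cmp_closed[OF Z Y X G'(1) F'(1)] orbit_cmp_closed[OF Z Y X g f]])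
      fix d a assume da: "d \<in> Z" "a \<in> X"
      show "nrm d a (orbit_cmp Z Y X g' f') = nrm d a (orbit_cmp Z Y X g f)"
        unfolding nrm_orbit_cmp[OF Z Y X G'(1) F'(1) da] nrm_orbit_cmp[OF Z Y X g f da]
        using da orbs_sub[OF X] orbs_sub[OF Y] orbs_sub[OF Z]
        by (intro abelian_monoid.finsum_cong'[OF Mor_am])
          (auto simp: G'(2) F'(2) Cmp_closed nrm_closed[OF Z Y _ _ g] nrm_closed[OF Y X _ _ f])
    qed
  qed
  have "g \<in> cls Z Y g" "f \<in> cls Y X f" by (simp_all add: cls_eq[OF Z Y g] cls_eq[OF Y X f] f g)
  then show ?thesis unfolding B_simps using eq by blast
qed

lemma B_Cmp_closed: "\<lbrakk>Z \<in> orbs; Y \<in> orbs; X \<in> orbs; Q \<in> carrier (Mor B Z Y); P \<in> carrier (Mor B Y X)\<rbrakk>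
    \<Longrightarrow> Cmp B Z Y X Q P \<in> carrier (Mor B Z X)"
  by (auto simp: cls_surj B_Cmp_cls orbit_cmp_closed)

lemma eB_Cmp:
  assumes Z: "Z \<in> orbs" and Y: "Y \<in> orbs" and X: "X \<in> orbs"
    and Q: "Q \<in> carrier (Mor B Z Y)" and P: "P \<in> carrier (Mor B Y X)" and s: "s \<in> carrier G" and t: "t \<in>
        carrier G"
  shows "eB Z X s t (Cmp B Z Y X Q P) = (\<Oplus>\<^bsub>Mor C (pos Z s) (pos X t)\<^esub>r\<in>carrier G.
    Cmp C (pos Z s) (pos Y r) (pos X t) (eB Z Y s r Q) (eB Y X r t P))"
proof -
  obtain g where g: "g \<in> carrier (V Z Y)" "Q = cls Z Y g" using B_obtain[OF Z Y Q] .
  obtain f where f: "f \<in> carrier (V Y X)" "P = cls Y X f" using B_obtain[OF Y X P] .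
  interpret M: abelian_monoid "Mor C (pos Z s) (pos X t)" using s t X Z by (intro Mor_am) simp_all
  have c: "Cmp C (pos Z s) c (pos X t) (nrm (pos Z s) c g) (nrm c (pos X t) f) \<in> carrier
      (Mor C (pos Z s) (pos X t))"
    if "c \<in> Y" for c
    using that s t X Z orbs_sub[OF Y] by (simp add: Cmp_closed nrm_closed[OF Z Y _ _ g(1)]
        nrm_closed[OF Y X _ _ f(1)])
  have "eB Z X s t (Cmp B Z Y X Q P) = nrm (pos Z s) (pos X t) (orbit_cmp Z Y X g f)"
    using assms g f by (simp add: B_Cmp_cls eB_cls orbit_cmp_closed)
  also have "\<dots> = (\<Oplus>\<^bsub>Mor C (pos Z s) (pos X t)\<^esub>c\<in>Y. Cmp C (pos Z s) c (pos X t) (nrm (pos Z s) c g)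
      (nrm c (pos X t) f))"
    using s t X Z by (intro nrm_orbit_cmp[OF Z Y X g(1) f(1)]) simp_all
  also have "\<dots> = (\<Oplus>\<^bsub>Mor C (pos Z s) (pos X t)\<^esub>r\<in>carrier G.
      Cmp C (pos Z s) (pos Y r) (pos X t) (nrm (pos Z s) (pos Y r) g) (nrm (pos Y r) (pos X t) f))"
    by (rule M.finsum_bij[OF bij_pos[OF Y] c])
  also have "\<dots> = (\<Oplus>\<^bsub>Mor C (pos Z s) (pos X t)\<^esub>r\<in>carrier G.
    Cmp C (pos Z s) (pos Y r) (pos X t) (eB Z Y s r Q) (eB Y X r t P))"
    by (rule M.finsum_cong') (use s t c Y in \<open>auto simp: g f eB_cls[OF Z Y g(1)] eB_cls[OF Y X f(1)]\<close>)
  finally show ?thesis .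
qed

text \<open>The translates of one identity morphism are the identities of all objects of the orbit,
  so the norm is the identity matrix whatever \<open>a0\<close> is.\<close>

lemma nrm_incl_Idt:
  assumes X: "X \<in> orbs" and a0: "a0 \<in> X" and b: "b \<in> X" and a: "a \<in> X"
  shows "nrm b a (orbit_incl C X X a0 a0 (Idt C a0)) = (if b = a then Idt C a else \<zero>\<^bsub>Mor C b a\<^esub>)"
proof -
  obtain r where r: "r \<in> carrier G" "b = \<phi> r a0" using orbs_eq[OF X a0] b by blast
  have a0O: "a0 \<in> Obj C" using orbs_sub[OF X a0] .
  show ?thesis
    using nrm_orbit_incl[OF X X r(1) a0 a0 Idt_closed[OF a0O] a] r psi_Idt[OF r(1) a0O] by auto
qed

lemma B_Idt_cls:
  assumes X: "X \<in> orbs"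
  shows "Idt B X = cls X X (orbit_incl C X X (x X) (x X) (Idt C (x X)))"
proof -
  have "cls X X (orbit_incl C X X a a (Idt C a)) = cls X X (orbit_incl C X X (x X) (x X) (Idt C (x X)))"
    if a: "a \<in> X" for a
    using a x_in[OF X] orbs_sub[OF X]
    by (intro cls_eqI[OF X X]) (simp_all add: orbit_incl_closed[OF X X] Idt_closed nrm_incl_Idt[OF X])
  then show ?thesis unfolding B_simps using x_in[OF X] by blast
qed

lemma B_Idt_closed: "X \<in> orbs \<Longrightarrow> Idt B X \<in> carrier (Mor B X X)"
  by (simp add: B_Idt_cls cls_surj orbit_incl_closed x_in Idt_closed)

lemma eB_Idt: "\<lbrakk>X \<in> orbs; s \<in> carrier G; t \<in> carrier G\<rbrakk>
    \<Longrightarrow> eB X X s t (Idt B X) = (if s = t then Idt C (pos X t) else \<zero>\<^bsub>Mor C (pos X s) (pos X t)\<^esub>)"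
  by (simp add: B_Idt_cls eB_cls orbit_incl_closed x_in Idt_closed nrm_incl_Idt pos_eq_iff)

text \<open>Fullness is not claimed, since entry matrices are invariant; this is enough for the
  category axioms of \<open>B\<close>.\<close>

lemma B_presentation: "matrix_presentation K C B (carrier G) pos eB"
  by (rule matrix_presentation.intro[OF k_category_axioms matrix_presentation_axioms.intro])
    (simp_all add: B_simps(1) finite_G B_module B_Cmp_closed B_Idt_closed eB_linear eB_Cmp eB_Idt
        eB_inj)

lemma B_category: "k_category K B"
  by (rule matrix_presentation.k_category_D[OF B_presentation])

sublocale B: k_category K B by (rule B_category)

lemma eB_closed: "\<lbrakk>Y \<in> orbs; X \<in> orbs; s \<in> carrier G; t \<in> carrier G; P \<in> carrier (Mor B Y X)\<rbrakk>
    \<Longrightarrow> eB Y X s t P \<in> carrier (Mor C (pos Y s) (pos X t))"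
  by (rule linear_maps_closed[OF eB_linear])

lemma eB_finsum: "\<lbrakk>Y \<in> orbs; X \<in> orbs; s \<in> carrier G; t \<in> carrier G; finite A; \<And>i. i \<in> A \<Longrightarrow> P i \<in> carrier
    (Mor B Y X)\<rbrakk>
    \<Longrightarrow> eB Y X s t (\<Oplus>\<^bsub>Mor B Y X\<^esub>i\<in>A. P i) = (\<Oplus>\<^bsub>Mor C (pos Y s) (pos X t)\<^esub>i\<in>A. eB Y X s t (P i))"
  by (rule linear_maps_finsum[OF eB_linear B.Mor_ag Mor_ag]) (simp_all add: B_simps(1))

section \<open>Homogeneous components\<close>

definition of_entries :: "'o set \<Rightarrow> 'o set \<Rightarrow> ('g \<Rightarrow> 'g \<Rightarrow> 'm) \<Rightarrow> ('o \<times> 'o \<Rightarrow> 'm) set" where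
  "of_entries Y X m = (SOME P. P \<in> carrier (Mor B Y X) \<and>
      (\<forall>s\<in>carrier G. \<forall>t\<in>carrier G. eB Y X s t P = m s t))"

lemma of_entries:
  assumes Y: "Y \<in> orbs" and X: "X \<in> orbs"
    and m: "\<And>s t. \<lbrakk>s \<in> carrier G; t \<in> carrier G\<rbrakk> \<Longrightarrow> m s t \<in> carrier (Mor C (pos Y s) (pos X t))"
    and inv: "\<And>r s t. \<lbrakk>r \<in> carrier G; s \<in> carrier G; t \<in> carrier G\<rbrakk>
      \<Longrightarrow> \<psi> r (pos Y s) (pos X t) (m s t) = m (s \<otimes> inv r) (t \<otimes> inv r)"
  shows "of_entries Y X m \<in> carrier (Mor B Y X)"
    and "\<lbrakk>s \<in> carrier G; t \<in> carrier G\<rbrakk> \<Longrightarrow> eB Y X s t (of_entries Y X m) = m s t"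
proof -
  have "\<exists>P. P \<in> carrier (Mor B Y X) \<and> (\<forall>s\<in>carrier G. \<forall>t\<in>carrier G. eB Y X s t P = m s t)"
    using eB_surj[where m = m, OF Y X m inv] by (simp only: Bex_def)
  then have "of_entries Y X m \<in> carrier (Mor B Y X) \<and>
      (\<forall>s\<in>carrier G. \<forall>t\<in>carrier G. eB Y X s t (of_entries Y X m) = m s t)"
    unfolding of_entries_def by (rule someI_ex)
  then show "of_entries Y X m \<in> carrier (Mor B Y X)" "\<lbrakk>s \<in> carrier G; t \<in> carrier G\<rbrakk> \<Longrightarrow> eB Y X s t
      (of_entries Y X m) = m s t"
    by blast+
qed

text \<open>Hence cutting an invariant matrix down to the positions of one degree leaves it
  invariant.\<close>

lemma degree_invariant: "\<lbrakk>r \<in> carrier G; s \<in> carrier G; t \<in> carrier G\<rbrakk>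
    \<Longrightarrow> (s \<otimes> inv r) \<otimes> inv (t \<otimes> inv r) = s \<otimes> inv t"
  by (simp add: g_norm)

text \<open>A morphism \<open>f\<close> from \<open>\<phi> u (x X)\<close> to \<open>x Y\<close>
  sits at position \<open>(\<one>, inv u)\<close>. Its translates fill the positions
  \<open>(s, inv u \<otimes> s)\<close>, which are those with
  \<open>s \<otimes> inv t = u\<close>.\<close>

lemma degree_component_eq:
  assumes Y: "Y \<in> orbs" and X: "X \<in> orbs" and u: "u \<in> carrier G"
  shows "degree_component K G C \<phi> \<psi> x Y X u = {P \<in> carrier (Mor B Y X).
    \<forall>s\<in>carrier G. \<forall>t\<in>carrier G. s \<otimes> inv t \<noteq> u \<longrightarrow> eB Y X s t P = \<zero>\<^bsub>Mor C (pos Y s) (pos X t)\<^esub>}"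
    (is "_ = ?R")
proof -
  let ?a = "\<phi> u (x X)"
  let ?I = "orbit_incl C Y X (x Y) ?a"
  have a: "?a \<in> X" using u X x_in orbs_closed by blast
  have a': "?a = pos X (inv u)" using u by (simp add: pos_def)
  have I: "?I f \<in> carrier (V Y X)" if "f \<in> carrier (Mor C (x Y) ?a)" for f
    by (rule orbit_incl_closed[OF Y X x_in[OF Y] a that])
  have e: "eB Y X s t (cls Y X (?I f)) = (if s \<otimes> inv t = u then \<psi> (inv s) (x Y) ?a f else
      \<zero>\<^bsub>Mor C (pos Y s) (pos X t)\<^esub>)"
    if f: "f \<in> carrier (Mor C (x Y) ?a)" and s: "s \<in> carrier G" and t: "t \<in> carrier G" for f s t
  proof -
    have "pos X t = \<phi> (inv s) ?a \<longleftrightarrow> t = inv u \<otimes> s"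
      unfolding a' using s t u X by (simp add: phi_pos pos_eq_iff)
    also have "\<dots> \<longleftrightarrow> s \<otimes> inv t = u"
    proof
      assume "s \<otimes> inv t = u"
      then show "t = inv u \<otimes> s" using s t by (auto simp: g_norm)
    qed (use s t u in \<open>simp add: g_norm\<close>)
    finally show ?thesis
      using nrm_orbit_incl[OF Y X g_closed(2)[OF s] x_in[OF Y] a f pos_in[OF X t]] I[OF f] s t X Y
      by (simp add: eB_cls pos_def[of Y])
  qed
  show ?thesis
  proof (intro equalityI subsetI)
    fix P assume "P \<in> degree_component K G C \<phi> \<psi> x Y X u"
    then obtain f where f: "f \<in> carrier (Mor C (x Y) ?a)" "P = cls Y X (?I f)"
      by (auto simp: degree_component_def)
    then show "P \<in> ?R" using I[OF f(1)] by (auto simp: e cls_surj[OF Y X])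
  next
    fix P assume P: "P \<in> ?R"
    \<comment> \<open>Position \<open>(\<one>, inv u)\<close> is the one whose row belongs to
      \<open>x Y\<close>; equivariance recovers the other entries of \<open>P\<close> from
      it.\<close>
    let ?f = "eB Y X \<one> (inv u) P"
    have f: "?f \<in> carrier (Mor C (x Y) ?a)"
      using P eB_closed[OF Y X, of "\<one>" "inv u" P] u Y by (simp add: a' pos_one)
    have "P = cls Y X (?I ?f)"
    proof (rule eB_inj[OF Y X])
      fix s t assume s: "s \<in> carrier G" and t: "t \<in> carrier G"
      have "eB Y X s t P = \<psi> (inv s) (x Y) ?a ?f" if "s \<otimes> inv t = u"
        using psi_eB[OF Y X, of P "\<one>" "inv u" "inv s"] P s t u Y that
        by (auto simp: a' pos_one g_norm)
      then show "eB Y X s t P = eB Y X s t (cls Y X (?I ?f))"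
        using P s t by (auto simp: e[OF f])
    qed (use P I[OF f] in \<open>auto simp: cls_surj[OF Y X]\<close>)
    then show "P \<in> degree_component K G C \<phi> \<psi> x Y X u"
      using f by (auto simp: degree_component_def)
  qed
qed

abbreviation hpart :: "'g \<Rightarrow> 'o set \<Rightarrow> 'o set \<Rightarrow> ('o \<times> 'o \<Rightarrow> 'm) set \<Rightarrow> ('o \<times> 'o \<Rightarrow> 'm) set" where
  "hpart \<equiv> grading_act K G C \<phi> \<psi> x"

text \<open>The projection is specified by a definite description, so the homogeneous decomposition
  must be shown to exist and to be unique. Both are visible on entries: position
  \<open>(s, t)\<close> sees only the summand of degree \<open>s \<otimes> inv t\<close>.\<close>

lemma hpart:
  assumes Y: "Y \<in> orbs" and X: "X \<in> orbs" and P: "P \<in> carrier (Mor B Y X)" and u: "u \<in> carrier G"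
  shows "hpart u Y X P \<in> carrier (Mor B Y X)"
    and "\<lbrakk>s \<in> carrier G; t \<in> carrier G\<rbrakk> \<Longrightarrow>
      eB Y X s t (hpart u Y X P) = (if s \<otimes> inv t = u then eB Y X s t P else
          \<zero>\<^bsub>Mor C (pos Y s) (pos X t)\<^esub>)"
proof -
  interpret M: abelian_monoid "Mor B Y X" by (rule B.Mor_am) (simp_all add: B_simps(1) X Y)
  \<comment> \<open>The truncation of the matrix of \<open>P\<close> to degree \<open>v\<close>; it
    is the only candidate for the homogeneous part.\<close>
  define m where "m v s t = (if s \<otimes> inv t = v then eB Y X s t P else \<zero>\<^bsub>Mor C (pos Y s) (pos X t)\<^esub>)" for
      v s t
  have mc: "m v s t \<in> carrier (Mor C (pos Y s) (pos X t))" if "s \<in> carrier G" "t \<in> carrier G" for v s t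
    using that X Y P by (simp add: m_def eB_closed Mor_zero)
  have mi: "\<psi> r (pos Y s) (pos X t) (m v s t) = m v (s \<otimes> inv r) (t \<otimes> inv r)"
    if "r \<in> carrier G" "s \<in> carrier G" "t \<in> carrier G" for r s t v
    using that X Y P psi_zero[of r "pos X t" "pos Y s"]
    by (simp add: m_def degree_invariant psi_eB phi_pos)
  note U = of_entries[where m = "m v" for v, OF Y X mc mi]
  let ?D = "degree_component K G C \<phi> \<psi> x Y X"
  let ?Q = "\<lambda>U. U \<in> (\<Pi>\<^sub>E t\<in>carrier G. ?D t) \<and> P = (\<Oplus>\<^bsub>Mor B Y X\<^esub>t\<in>carrier G. U t)"
  define U0 where "U0 = (\<lambda>v\<in>carrier G. of_entries Y X (m v))"
  have D: "W \<in> carrier (Mor B Y X)" "\<And>s t. \<lbrakk>s \<in> carrier G; t \<in> carrier G; s \<otimes> inv t \<noteq> v\<rbrakk>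
      \<Longrightarrow> eB Y X s t W = \<zero>\<^bsub>Mor C (pos Y s) (pos X t)\<^esub>" if "W \<in> ?D v" "v \<in> carrier G" for W v
    using that by (simp_all add: degree_component_eq[OF Y X])
  \<comment> \<open>Serves existence and uniqueness alike: any family of homogeneous summands can be
    recovered entry by entry from its sum.\<close>
  have sum: "eB Y X s t (\<Oplus>\<^bsub>Mor B Y X\<^esub>v\<in>carrier G. W v) = eB Y X s t (W (s \<otimes> inv t))"
    if W: "\<And>v. v \<in> carrier G \<Longrightarrow> W v \<in> ?D v" and s: "s \<in> carrier G" and t: "t \<in> carrier G" for W s t
  proof -
    interpret N: abelian_monoid "Mor C (pos Y s) (pos X t)" using s t X Y by (intro Mor_am) simp_all
    have "eB Y X s t (\<Oplus>\<^bsub>Mor B Y X\<^esub>v\<in>carrier G. W v) =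
        (\<Oplus>\<^bsub>Mor C (pos Y s) (pos X t)\<^esub>v\<in>carrier G. eB Y X s t (W v))"
      using D(1)[OF W] s t by (intro eB_finsum Y X finite_G) simp_all
    also have "\<dots> = eB Y X s t (W (s \<otimes> inv t))"
    proof (rule N.finsum_single)
      fix v assume "v \<in> carrier G" "v \<noteq> s \<otimes> inv t"
      then show "eB Y X s t (W v) = \<zero>\<^bsub>Mor C (pos Y s) (pos X t)\<^esub>"
        using D(2)[OF W, of v s t] s t by auto
    qed (use s t in \<open>simp_all add: finite_G eB_closed[OF Y X] D(1)[OF W]\<close>)
    finally show ?thesis .
  qed
  have U0D: "U0 v \<in> ?D v" if "v \<in> carrier G" for v
    using that by (auto simp: U0_def degree_component_eq[OF Y X] U m_def)
  have U0: "?Q U0"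
  proof
    show "U0 \<in> (\<Pi>\<^sub>E t\<in>carrier G. ?D t)" using U0D by (auto simp: U0_def)
    show "P = (\<Oplus>\<^bsub>Mor B Y X\<^esub>t\<in>carrier G. U0 t)"
      by (rule eB_inj[OF Y X P])
        (use D(1)[OF U0D] in \<open>auto simp: sum[OF U0D] intro!: M.finsum_closed\<close>, simp add: U0_def U m_def)
  qed
  have uniq: "W = U0" if W: "?Q W" for W
  proof (rule PiE_ext[of W "carrier G" ?D U0])
    fix v assume v: "v \<in> carrier G"
    have WD: "W v \<in> ?D v" if "v \<in> carrier G" for v using W that by auto
    show "W v = U0 v"
    proof (rule eB_inj[OF Y X D(1)[OF WD[OF v] v] D(1)[OF U0D[OF v] v]])
      fix s t assume st: "s \<in> carrier G" "t \<in> carrier G"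
      have "eB Y X s t (W (s \<otimes> inv t)) = eB Y X s t (U0 (s \<otimes> inv t))"
        using sum[OF WD st] sum[OF U0D st] W U0 by metis
      then show "eB Y X s t (W v) = eB Y X s t (U0 v)"
        using D(2)[OF WD[OF v] v st] D(2)[OF U0D[OF v] v st] by (cases "s \<otimes> inv t = v") auto
    qed
  qed (use W U0 in auto)
  have "(THE W. ?Q W) = U0" by (rule the_equality[of ?Q, OF U0 uniq])
  then have h: "hpart u Y X P = U0 u"
    by (simp add: grading_act_def homogeneous_part_def)
  show "hpart u Y X P \<in> carrier (Mor B Y X)" unfolding h by (rule D(1)[OF U0D[OF u] u])
  show "eB Y X s t (hpart u Y X P) = (if s \<otimes> inv t = u then eB Y X s t P else
      \<zero>\<^bsub>Mor C (pos Y s) (pos X t)\<^esub>)"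
    if "s \<in> carrier G" "t \<in> carrier G"
    unfolding h using u that by (simp add: U0_def U m_def)
qed

end

section \<open>Structure constants of the smash categories\<close>

lemma smash_category_simps:
  "Obj (smash_category K H act D) = Obj D"
  "Mor (smash_category K H act D) y x = direct_sum (hbasis H) (\<lambda>_. Mor D y x)"
  "Cmp (smash_category K H act D) z y x F E = (\<lambda>d\<in>hbasis H.
        \<Oplus>\<^bsub>Mor D z x\<^esub>b\<in>hbasis H. \<Oplus>\<^bsub>Mor D z x\<^esub>c\<in>hbasis H.
        \<Oplus>\<^bsub>Mor D z x\<^esub>a\<in>hbasis H. \<Oplus>\<^bsub>Mor D z x\<^esub>a'\<in>hbasis H.
          (hcomult H b a a' \<otimes>\<^bsub>K\<^esub> hmult H a' c d) \<odot>\<^bsub>Mor D z x\<^esub> Cmp D z y x (F b) (act a y x (E c)))"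
  "Idt (smash_category K H act D) x = (\<lambda>b\<in>hbasis H. hunit H b \<odot>\<^bsub>Mor D x x\<^esub> Idt D x)"
  by (simp_all add: smash_category_def pure_tensor_def)

lemma group_algebra_simps:
  "hbasis (group_algebra K G) = carrier G"
  "hmult (group_algebra K G) s t d = (if s \<otimes>\<^bsub>G\<^esub> t = d then \<one>\<^bsub>K\<^esub> else \<zero>\<^bsub>K\<^esub>)"
  "hunit (group_algebra K G) d = (if d = \<one>\<^bsub>G\<^esub> then \<one>\<^bsub>K\<^esub> else \<zero>\<^bsub>K\<^esub>)"
  "hcomult (group_algebra K G) s u v = (if u = s \<and> v = s then \<one>\<^bsub>K\<^esub> else \<zero>\<^bsub>K\<^esub>)"
  by (simp_all add: group_algebra_def)

lemma dual_group_algebra_simps: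
  "hbasis (dual_group_algebra K G) = carrier G"
  "hmult (dual_group_algebra K G) s t d = (if s = t \<and> d = s then \<one>\<^bsub>K\<^esub> else \<zero>\<^bsub>K\<^esub>)"
  "hunit (dual_group_algebra K G) d = \<one>\<^bsub>K\<^esub>"
  "hcomult (dual_group_algebra K G) s u v = (if u \<otimes>\<^bsub>G\<^esub> v = s then \<one>\<^bsub>K\<^esub> else \<zero>\<^bsub>K\<^esub>)"
  by (simp_all add: dual_group_algebra_def)

context galois_data
begin

section \<open>The smash categories\<close>

abbreviation A :: "('k, 'o set, 'g \<Rightarrow> ('o \<times> 'o \<Rightarrow> 'm) set) kcat" where
  "A \<equiv> smash_category K (dual_group_algebra K G) hpart B"

lemma A_Obj: "Obj A = orbs"
  by (simp add: smash_category_simps[of K "dual_group_algebra K G"] B_simps(1))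

lemma A_Mor: "Mor A Y X = direct_sum (carrier G) (\<lambda>_. Mor B Y X)"
  by (simp add: smash_category_simps[of K "dual_group_algebra K G"] dual_group_algebra_simps)

lemma A_carrier: "carrier (Mor A Y X) = (\<Pi>\<^sub>E u\<in>carrier G. carrier (Mor B Y X))"
  by (simp add: A_Mor carrier_direct_sum_finite finite_G)

lemma A_mem: "\<lbrakk>F \<in> carrier (Mor A Y X); u \<in> carrier G\<rbrakk> \<Longrightarrow> F u \<in> carrier (Mor B Y X)"
  by (auto simp: A_carrier)

lemma A_eqI: "\<lbrakk>F \<in> carrier (Mor A Y X); E \<in> carrier (Mor A Y X); \<And>u. u \<in> carrier G \<Longrightarrow> F u = E u\<rbrakk> \<Longrightarrow> F = E"
  unfolding A_carrier by (rule PiE_ext)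

lemma A_Mor_module: "\<lbrakk>Y \<in> orbs; X \<in> orbs\<rbrakk> \<Longrightarrow> module K (Mor A Y X)"
  unfolding A_Mor by (rule direct_sum_module) (simp_all add: is_cring finite_G B_module)

lemma A_eval_linear: "u \<in> carrier G \<Longrightarrow> (\<lambda>F. F u) \<in> linear_maps K (Mor A Y X) (Mor B Y X)"
  unfolding A_Mor by (rule direct_sum_proj_linear)

text \<open>The unit of the dual group algebra is the sum of all basis elements, hence the constant
  family.\<close>

lemma A_Idt: "X \<in> orbs \<Longrightarrow> Idt A X = (\<lambda>u\<in>carrier G. Idt B X)"
  by (simp add: smash_category_simps[of K "dual_group_algebra K G"] dual_group_algebra_simps
      module.smult_one[OF B_module]
      B_Idt_closed cong: restrict_cong)

lemma A_Idt_closed: "X \<in> orbs \<Longrightarrow> Idt A X \<in> carrier (Mor A X X)"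
  by (simp add: A_Idt A_carrier B_Idt_closed)

text \<open>The coproduct of the basis element at \<open>b\<close> has terms \<open>(a, a')\<close>
  with \<open>a \<otimes> a' = b\<close>, and the product of the elements at \<open>a'\<close> and
  \<open>c\<close> contributes at \<open>d\<close> only if \<open>a' = c = d\<close>. Thus
  \<open>c = d\<close> and \<open>a = b \<otimes> inv d\<close>.\<close>

lemma A_Cmp:
  assumes Z: "Z \<in> orbs" and Y: "Y \<in> orbs" and X: "X \<in> orbs"
    and F: "F \<in> carrier (Mor A Z Y)" and E: "E \<in> carrier (Mor A Y X)" and d: "d \<in> carrier G"
  shows "Cmp A Z Y X F E d = (\<Oplus>\<^bsub>Mor B Z X\<^esub>b\<in>carrier G.
    Cmp B Z Y X (F b) (hpart (b \<otimes> inv d) Y X (E d)))"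
proof -
  interpret M: module K "Mor B Z X" by (rule B_module[OF Z X])
  let ?T = "\<lambda>b c a. Cmp B Z Y X (F b) (hpart a Y X (E c))"
  let ?k = "\<lambda>b c a a'. ((if a \<otimes> a' = b then \<one>\<^bsub>K\<^esub> else \<zero>\<^bsub>K\<^esub>) \<otimes>\<^bsub>K\<^esub>
      (if a' = c \<and> d = a' then \<one>\<^bsub>K\<^esub> else \<zero>\<^bsub>K\<^esub>)) \<odot>\<^bsub>Mor B Z X\<^esub> ?T b c a"
  have T[simp]: "?T b c a \<in> carrier (Mor B Z X)" if "b \<in> carrier G" "c \<in> carrier G" "a \<in> carrier G" for
      b c a
    using that by (simp add: B_Cmp_closed[OF Z Y X] A_mem[OF F] A_mem[OF E] hpart(1)[OF Y X])
  have kc[simp]: "?k b c a a' \<in> carrier (Mor B Z X)" if "b \<in> carrier G" "c \<in> carrier G" "a \<in> carrier G"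
      for b c a a'
    using that by simp
  have k0: "?k b c a a' = \<zero>\<^bsub>Mor B Z X\<^esub>" if "b \<in> carrier G" "c \<in> carrier G" "a \<in> carrier G" "\<not>
      (a \<otimes> a' = b \<and> a' = c \<and> c = d)" for b c a a'
    using that by auto
  have "Cmp A Z Y X F E d = (\<Oplus>\<^bsub>Mor B Z X\<^esub>b\<in>carrier G. \<Oplus>\<^bsub>Mor B Z X\<^esub>c\<in>carrier G. \<Oplus>\<^bsub>Mor B Z X\<^esub>a\<in>carrier G.
      \<Oplus>\<^bsub>Mor B Z X\<^esub>a'\<in>carrier G. ?k b c a a')"
    using d by (simp add: smash_category_simps[of K "dual_group_algebra K G"] dual_group_algebra_simps)
  also have "\<dots> = (\<Oplus>\<^bsub>Mor B Z X\<^esub>b\<in>carrier G. ?k b d (b \<otimes> inv d) d)"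
    by (rule M.finsum_collapse[OF finite_G]) (use d in \<open>auto intro!: k0 kc simp: g_norm\<close>)
  also have "\<dots> = (\<Oplus>\<^bsub>Mor B Z X\<^esub>b\<in>carrier G. ?T b d (b \<otimes> inv d))"
    using d by (intro M.finsum_cong') (auto intro!: T simp: g_norm)
  finally show ?thesis .
qed

lemma A_Cmp_closed:
  assumes Z: "Z \<in> orbs" and Y: "Y \<in> orbs" and X: "X \<in> orbs"
    and F: "F \<in> carrier (Mor A Z Y)" and E: "E \<in> carrier (Mor A Y X)"
  shows "Cmp A Z Y X F E \<in> carrier (Mor A Z X)"
proof -
  have "Cmp A Z Y X F E d \<in> carrier (Mor B Z X)" if "d \<in> carrier G" for d
    unfolding A_Cmp[OF assms that]
    using that X Y Z by (intro B.Mor_finsum)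
      (simp_all add: B_simps(1) B_Cmp_closed A_mem[OF F] A_mem[OF E] hpart(1))
  moreover have "Cmp A Z Y X F E \<in> extensional (carrier G)"
    by (simp add: smash_category_simps[of K "dual_group_algebra K G"] dual_group_algebra_simps)
  ultimately show ?thesis by (auto simp: A_carrier PiE_def)
qed

text \<open>Projection to degree \<open>b \<otimes> inv d\<close> keeps the entry at
  \<open>(r, t)\<close> only when \<open>r \<otimes> inv t = b \<otimes> inv d\<close>, which fixes
  \<open>b\<close> for each \<open>r\<close> and removes the sum over \<open>b\<close>.\<close>

lemma eB_A_Cmp:
  assumes Z: "Z \<in> orbs" and Y: "Y \<in> orbs" and X: "X \<in> orbs"
    and F: "F \<in> carrier (Mor A Z Y)" and E: "E \<in> carrier (Mor A Y X)" and d: "d \<in> carrier G"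
    and s: "s \<in> carrier G" and t: "t \<in> carrier G"
  shows "eB Z X s t (Cmp A Z Y X F E d) = (\<Oplus>\<^bsub>Mor C (pos Z s) (pos X t)\<^esub>r\<in>carrier G.
    Cmp C (pos Z s) (pos Y r) (pos X t) (eB Z Y s r (F (r \<otimes> (inv t \<otimes> d)))) (eB Y X r t (E d)))"
proof -
  interpret M: abelian_monoid "Mor C (pos Z s) (pos X t)" using s t X Z by (intro Mor_am) simp_all
  let ?c = "\<lambda>r. Cmp C (pos Z s) (pos Y r) (pos X t)"
  let ?h = "\<lambda>b. hpart (b \<otimes> inv d) Y X (E d)"
  let ?u = "\<lambda>b r. ?c r (eB Z Y s r (F b)) (eB Y X r t (?h b))"
  note [simp] = A_mem[OF F] A_mem[OF E] hpart(1)[OF Y X] X Y Z s t d eB_closed Cmp_closed B_Cmp_closed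
      finite_G
  have "eB Z X s t (Cmp A Z Y X F E d) = (\<Oplus>\<^bsub>Mor C (pos Z s) (pos X t)\<^esub>b\<in>carrier G. eB Z X s t
      (Cmp B Z Y X (F b) (?h b)))"
    unfolding A_Cmp[OF Z Y X F E d] by (rule eB_finsum) simp_all
  also have "\<dots> = (\<Oplus>\<^bsub>Mor C (pos Z s) (pos X t)\<^esub>b\<in>carrier G. \<Oplus>\<^bsub>Mor C (pos Z s) (pos X t)\<^esub>r\<in>carrier G. ?u b
      r)"
    by (rule M.finsum_cong') (auto simp: eB_Cmp intro!: M.finsum_closed)
  also have "\<dots> = (\<Oplus>\<^bsub>Mor C (pos Z s) (pos X t)\<^esub>r\<in>carrier G. \<Oplus>\<^bsub>Mor C (pos Z s) (pos X t)\<^esub>b\<in>carrier G. ?u b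
      r)"
    by (rule M.finsum_swap) simp_all
  also have "\<dots> = (\<Oplus>\<^bsub>Mor C (pos Z s) (pos X t)\<^esub>r\<in>carrier G.
    ?c r (eB Z Y s r (F (r \<otimes> (inv t \<otimes> d)))) (eB Y X r t (E d)))"
  proof (rule M.finsum_cong'[OF refl])
    fix r assume r[simp]: "r \<in> carrier G"
    let ?b = "r \<otimes> (inv t \<otimes> d)"
    have "(\<Oplus>\<^bsub>Mor C (pos Z s) (pos X t)\<^esub>b\<in>carrier G. ?u b r) = ?u ?b r"
    proof (rule M.finsum_single)
      fix b assume b[simp]: "b \<in> carrier G" and ne: "b \<noteq> ?b"
      have "r \<otimes> inv t \<noteq> b \<otimes> inv d"
      proof
        assume "r \<otimes> inv t = b \<otimes> inv d"
        then have "r \<otimes> inv t \<otimes> d = b \<otimes> inv d \<otimes> d" by simp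
        then show False using ne by (simp add: g_norm)
      qed
      then show "?u b r = \<zero>\<^bsub>Mor C (pos Z s) (pos X t)\<^esub>" by (simp add: hpart(2)[OF Y X] Cmp_zero_right)
    qed simp_all
    also have "\<dots> = ?c r (eB Z Y s r (F ?b)) (eB Y X r t (E d))"
      by (simp add: hpart(2)[OF Y X] g_norm)
    finally show "(\<Oplus>\<^bsub>Mor C (pos Z s) (pos X t)\<^esub>b\<in>carrier G. ?u b r) = ?c r (eB Z Y s r (F ?b))
        (eB Y X r t (E d))" .
  qed simp
  finally show ?thesis .
qed

definition eA :: "'o set \<Rightarrow> 'o set \<Rightarrow> 'g \<Rightarrow> 'g \<Rightarrow> ('g \<Rightarrow> ('o \<times> 'o \<Rightarrow> 'm) set) \<Rightarrow> 'm" where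
  "eA Y X s t F = eB Y X s t (F t)"

text \<open>By equivariance a morphism of \<open>B\<close> is determined by any column of its matrix, and every column
  occurs.\<close>

lemma A_presentation: "full_matrix_presentation K C A (carrier G) pos eA"
proof (rule full_matrix_presentation.intro[OF matrix_presentation.intro[OF k_category_axioms
        matrix_presentation_axioms.intro] full_matrix_presentation_axioms.intro], goal_cases)
  case (6 X Y t s)
  then have *: "X \<in> orbs" "Y \<in> orbs" by (simp_all add: A_Obj)
  show ?case
    unfolding eA_def[abs_def] by (rule linear_maps_comp[OF A_eval_linear[OF 6(3)]
        eB_linear[OF *(2,1) 6(4,3)]])
next
  case (7 X Y Z g f t s)
  then have *: "X \<in> orbs" "Y \<in> orbs" "Z \<in> orbs" by (simp_all add: A_Obj)
  show ?case
    \<comment> \<open>Here \<open>d\<close> is the column \<open>t\<close> itself, so the index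
      \<open>r \<otimes> (inv t \<otimes> d)\<close> of the left factor is \<open>r\<close>: its
      entry too is read in the column matching its coefficient.\<close>
    unfolding eA_def eB_A_Cmp[OF *(3,2,1) 7(4,5,6,7,6)]
    by (rule abelian_monoid.finsum_cong'[OF Mor_am])
      (use * 7(6,7) in \<open>auto simp: Cmp_closed eB_closed A_mem[OF 7(4)] A_mem[OF 7(5)]\<close>)
next
  case (9 X Y F E)
  then have X: "X \<in> orbs" and Y: "Y \<in> orbs" by (simp_all add: A_Obj)
  show ?case
  proof (rule A_eqI[OF 9(3,4)])
    fix v assume v: "v \<in> carrier G"
    show "F v = E v"
    proof (rule eB_inj[OF Y X A_mem[OF 9(3) v] A_mem[OF 9(4) v]])
      fix s t assume s: "s \<in> carrier G" and t: "t \<in> carrier G"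
      \<comment> \<open>Position \<open>(?q, v)\<close> lies in the prescribed column
        \<open>v\<close>, and \<open>?r\<close> translates it to \<open>(s, t)\<close>.\<close>
      let ?q = "s \<otimes> inv t \<otimes> v" and ?r = "inv t \<otimes> v"
      have "eB Y X ?q v (F v) = eB Y X ?q v (E v)" using 9(5)[of ?q v] s t v by (simp add: eA_def)
      then have "\<psi> ?r (pos Y ?q) (pos X v) (eB Y X ?q v (F v)) = \<psi> ?r (pos Y ?q) (pos X v)
          (eB Y X ?q v (E v))" by simp
      then show "eB Y X s t (F v) = eB Y X s t (E v)"
        using s t v A_mem[OF 9(3) v] A_mem[OF 9(4) v] by (simp add: psi_eB X Y g_norm)
    qed
  qed
next
  case (10 X Y m)
  then have X: "X \<in> orbs" and Y: "Y \<in> orbs" by (simp_all add: A_Obj)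
  \<comment> \<open>\<open>n v\<close> is the invariant matrix whose column \<open>v\<close> is
    column \<open>v\<close> of \<open>m\<close>; the other columns are its translates.\<close>
  define n where "n v s t = \<psi> (inv t \<otimes> v) (pos Y (s \<otimes> (inv t \<otimes> v))) (pos X v)
    (m (s \<otimes> (inv t \<otimes> v)) v)" for v s t
  have nc: "n v s t \<in> carrier (Mor C (pos Y s) (pos X t))" if "v \<in> carrier G" "s \<in> carrier G" "t \<in>
      carrier G" for v s t
    using psi_closed[of "inv t \<otimes> v" "pos X v" "pos Y (s \<otimes> (inv t \<otimes> v))"
        "m (s \<otimes> (inv t \<otimes> v)) v"] 10(3)[of "s \<otimes> (inv t \<otimes> v)" v] that X Y
    by (simp add: n_def phi_pos g_norm)
  have ni: "\<psi> r (pos Y s) (pos X t) (n v s t) = n v (s \<otimes> inv r) (t \<otimes> inv r)"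
    if "v \<in> carrier G" "r \<in> carrier G" "s \<in> carrier G" "t \<in> carrier G" for v r s t
    using act_mult[of "inv t \<otimes> v" r "pos X v" "pos Y (s \<otimes> (inv t \<otimes> v))"
        "m (s \<otimes> (inv t \<otimes> v)) v"] 10(3)[of "s \<otimes> (inv t \<otimes> v)" v] that X Y
    by (simp add: n_def phi_pos g_norm)
  define F where "F = (\<lambda>v\<in>carrier G. of_entries Y X (n v))"
  have ofn: "of_entries Y X (n v) \<in> carrier (Mor B Y X)"
    "\<And>s t. \<lbrakk>s \<in> carrier G; t \<in> carrier G\<rbrakk> \<Longrightarrow> eB Y X s t (of_entries Y X (n v)) = n v s t" if v: "v \<in>
        carrier G" for v
    by (rule of_entries[OF Y X]; simp add: nc ni v)+
  have "F \<in> carrier (Mor A Y X)" by (simp add: F_def A_carrier ofn)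
  moreover have "eA Y X s t F = m s t" if "s \<in> carrier G" "t \<in> carrier G" for s t
    using that X Y 10(3)[OF that] by (simp add: eA_def F_def ofn n_def act_one)
  ultimately show ?case by blast
next
  case (11 c)
  let ?X = "orbit G \<phi> c"
  have X: "?X \<in> orbs" using 11 by (auto simp: orbits_def)
  have "c \<in> ?X" using orbit_refl[OF 11] .
  then have "c \<in> pos ?X ` carrier G" by (simp only: bij_betw_imp_surj_on[OF bij_pos[OF X]])
  then obtain t where t: "c = pos ?X t" "t \<in> carrier G" by (rule imageE)
  show ?case unfolding A_Obj by (rule bexI[OF _ X], rule bexI[OF _ t(2)], rule t(1)[symmetric])
qed (simp_all add: A_Obj finite_G A_Mor_module A_Cmp_closed A_Idt_closed, simp add: A_Idt eA_def eB_Idt)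

sublocale A: k_category K A
  by (rule matrix_presentation.k_category_D[OF full_matrix_presentation.axioms(1)[OF A_presentation]])

section \<open>The smash category over the group algebra\<close>

abbreviation S :: "('k, 'o set, 'g \<Rightarrow> 'g \<Rightarrow> ('o \<times> 'o \<Rightarrow> 'm) set) kcat" where
  "S \<equiv> smash_category K (group_algebra K G) (translation_act G) A"

lemma S_Obj: "Obj S = orbs"
  by (simp add: smash_category_simps[of K "group_algebra K G"] A_Obj)

lemma S_Mor: "Mor S Y X = direct_sum (carrier G) (\<lambda>_. Mor A Y X)"
  by (simp add: smash_category_simps[of K "group_algebra K G"] group_algebra_simps)

lemma S_carrier: "carrier (Mor S Y X) = (\<Pi>\<^sub>E u\<in>carrier G. carrier (Mor A Y X))"
  by (simp add: S_Mor carrier_direct_sum_finite finite_G)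

lemma S_mem: "\<lbrakk>F \<in> carrier (Mor S Y X); u \<in> carrier G\<rbrakk> \<Longrightarrow> F u \<in> carrier (Mor A Y X)"
  by (auto simp: S_carrier)

lemma S_mem2: "\<lbrakk>F \<in> carrier (Mor S Y X); u \<in> carrier G; w \<in> carrier G\<rbrakk> \<Longrightarrow> F u w \<in> carrier (Mor B Y X)"
  by (rule A_mem[OF S_mem])

lemma S_Mor_module: "\<lbrakk>Y \<in> orbs; X \<in> orbs\<rbrakk> \<Longrightarrow> module K (Mor S Y X)"
  unfolding S_Mor by (rule direct_sum_module) (simp_all add: is_cring finite_G A_Mor_module)

lemma S_eval_linear: "\<lbrakk>u \<in> carrier G; w \<in> carrier G\<rbrakk> \<Longrightarrow> (\<lambda>F. F u w) \<in> linear_maps K (Mor S Y X)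
    (Mor B Y X)"
  unfolding S_Mor by (rule linear_maps_comp[OF direct_sum_proj_linear[where V = "\<lambda>_. Mor A Y X"]
      A_eval_linear])

lemma S_Idt:
  assumes "X \<in> orbs" "u \<in> carrier G" "w \<in> carrier G"
  shows "Idt S X u w = (if u = \<one> then Idt B X else \<zero>\<^bsub>Mor B X X\<^esub>)"
  using assms
  by (simp add: smash_category_simps[of K "group_algebra K G"] group_algebra_simps A_Idt
      A_Mor direct_sum_simps module.smult_one[OF B_module] module.smult_l_null[OF B_module]
          B_Idt_closed)

lemma S_Idt_closed: "X \<in> orbs \<Longrightarrow> Idt S X \<in> carrier (Mor S X X)"
  using A.Idt_closed[of X]
  by (auto simp: smash_category_simps[of K "group_algebra K G"] group_algebra_simps
      carrier_direct_sum_finite finite_G A_Obj intro!: module.smult_closed[OF A_Mor_module])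

lemma translation_closed: "\<lbrakk>F \<in> carrier (Mor A Y X); b \<in> carrier G\<rbrakk>
    \<Longrightarrow> translation_act G b y z F \<in> carrier (Mor A Y X)"
  by (auto simp: translation_act_def A_carrier)

lemma translation_apply: "u \<in> carrier G \<Longrightarrow> translation_act G b y z F u = F (u \<otimes> b)"
  by (simp add: translation_act_def)

text \<open>Group elements are grouplike, so \<open>a = a' = b\<close>, and the product
  \<open>b \<otimes> c = d\<close> gives \<open>c = inv b \<otimes> d\<close>.\<close>

lemma S_Cmp:
  assumes Z: "Z \<in> orbs" and Y: "Y \<in> orbs" and X: "X \<in> orbs"
    and F: "F \<in> carrier (Mor S Z Y)" and E: "E \<in> carrier (Mor S Y X)" and d: "d \<in> carrier G"
  shows "Cmp S Z Y X F E d = (\<Oplus>\<^bsub>Mor A Z X\<^esub>b\<in>carrier G.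
    Cmp A Z Y X (F b) (translation_act G b Y X (E (inv b \<otimes> d))))"
proof -
  interpret M: module K "Mor A Z X" by (rule A_Mor_module[OF Z X])
  let ?T = "\<lambda>b c a. Cmp A Z Y X (F b) (translation_act G a Y X (E c))"
  let ?k = "\<lambda>b c a a'. ((if a = b \<and> a' = b then \<one>\<^bsub>K\<^esub> else \<zero>\<^bsub>K\<^esub>) \<otimes>\<^bsub>K\<^esub>
      (if a' \<otimes> c = d then \<one>\<^bsub>K\<^esub> else \<zero>\<^bsub>K\<^esub>)) \<odot>\<^bsub>Mor A Z X\<^esub> ?T b c a"
  have T[simp]: "?T b c a \<in> carrier (Mor A Z X)" if "b \<in> carrier G" "c \<in> carrier G" "a \<in> carrier G" for
      b c a
    using that by (simp add: A_Cmp_closed[OF Z Y X] S_mem[OF F] S_mem[OF E] translation_closed)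
  have kc[simp]: "?k b c a a' \<in> carrier (Mor A Z X)" if "b \<in> carrier G" "c \<in> carrier G" "a \<in> carrier G"
      for b c a a'
    using that by simp
  have k0: "?k b c a a' = \<zero>\<^bsub>Mor A Z X\<^esub>" if "b \<in> carrier G" "c \<in> carrier G" "a \<in> carrier G" "\<not>
      (a = b \<and> a' = b \<and> b \<otimes> c = d)" for b c a a'
    using that by auto
  have "Cmp S Z Y X F E d = (\<Oplus>\<^bsub>Mor A Z X\<^esub>b\<in>carrier G. \<Oplus>\<^bsub>Mor A Z X\<^esub>c\<in>carrier G. \<Oplus>\<^bsub>Mor A Z X\<^esub>a\<in>carrier G.
      \<Oplus>\<^bsub>Mor A Z X\<^esub>a'\<in>carrier G. ?k b c a a')"
    using d by (simp add: smash_category_simps[of K "group_algebra K G"] group_algebra_simps)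
  also have "\<dots> = (\<Oplus>\<^bsub>Mor A Z X\<^esub>b\<in>carrier G. ?k b (inv b \<otimes> d) b b)"
    by (rule M.finsum_collapse[OF finite_G]) (use d in \<open>auto intro!: k0 kc simp: g_norm\<close>)
  also have "\<dots> = (\<Oplus>\<^bsub>Mor A Z X\<^esub>b\<in>carrier G. ?T b (inv b \<otimes> d) b)"
    using d by (intro M.finsum_cong') (auto intro!: T simp: g_norm)
  finally show ?thesis .
qed

lemma S_Cmp_closed:
  assumes Z: "Z \<in> orbs" and Y: "Y \<in> orbs" and X: "X \<in> orbs"
    and F: "F \<in> carrier (Mor S Z Y)" and E: "E \<in> carrier (Mor S Y X)"
  shows "Cmp S Z Y X F E \<in> carrier (Mor S Z X)"
proof -
  have "Cmp S Z Y X F E d \<in> carrier (Mor A Z X)" if "d \<in> carrier G" for d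
    unfolding S_Cmp[OF assms that]
    using that X Y Z by (intro A.Mor_finsum)
      (simp_all add: A_Obj A_Cmp_closed S_mem[OF F] S_mem[OF E] translation_closed)
  moreover have "Cmp S Z Y X F E \<in> extensional (carrier G)"
    by (simp add: smash_category_simps[of K "group_algebra K G"] group_algebra_simps)
  ultimately show ?thesis by (auto simp: S_carrier PiE_def)
qed

text \<open>Translation by \<open>b\<close> moves the coefficient index of the right factor from
  \<open>w\<close> to \<open>w \<otimes> b\<close>; the rest is \<open>eB_A_Cmp\<close> applied to
  each \<open>b\<close>.\<close>

lemma eB_S_Cmp:
  assumes Z: "Z \<in> orbs" and Y: "Y \<in> orbs" and X: "X \<in> orbs"
    and F: "F \<in> carrier (Mor S Z Y)" and E: "E \<in> carrier (Mor S Y X)" and d: "d \<in> carrier G" and w: "w \<in>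
        carrier G"
    and s: "s \<in> carrier G" and t: "t \<in> carrier G"
  shows "eB Z X s t (Cmp S Z Y X F E d w) =
    (\<Oplus>\<^bsub>Mor C (pos Z s) (pos X t)\<^esub>q\<in>carrier G. \<Oplus>\<^bsub>Mor C (pos Z s) (pos X t)\<^esub>b\<in>carrier G.
      Cmp C (pos Z s) (pos Y q) (pos X t) (eB Z Y s q (F b (q \<otimes> (inv t \<otimes> w))))
        (eB Y X q t (E (inv b \<otimes> d) (w \<otimes> b))))"
proof -
  interpret M: abelian_monoid "Mor C (pos Z s) (pos X t)" using s t X Z by (intro Mor_am) simp_all
  note [simp] = S_mem[OF F] S_mem[OF E] S_mem2[OF F] S_mem2[OF E] translation_closed X Y Z s t d w
      eB_closed Cmp_closed
    A_Cmp_closed finite_G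
  let ?C = "\<lambda>b. Cmp A Z Y X (F b) (translation_act G b Y X (E (inv b \<otimes> d)))"
  let ?u = "\<lambda>b q. Cmp C (pos Z s) (pos Y q) (pos X t) (eB Z Y s q (F b (q \<otimes> (inv t \<otimes> w))))
        (eB Y X q t (E (inv b \<otimes> d) (w \<otimes> b)))"
  have "Cmp S Z Y X F E d w = (\<Oplus>\<^bsub>Mor B Z X\<^esub>b\<in>carrier G. ?C b w)"
    unfolding S_Cmp[OF Z Y X F E d]
    by (rule linear_maps_finsum[OF A_eval_linear[OF w] A.Mor_ag B.Mor_ag finite_G])
      (simp_all add: A_Obj B_simps(1))
  then have "eB Z X s t (Cmp S Z Y X F E d w) =
      (\<Oplus>\<^bsub>Mor C (pos Z s) (pos X t)\<^esub>b\<in>carrier G. eB Z X s t (?C b w))"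
    using A_mem[of "?C b" for b] by (simp add: eB_finsum)
  also have "\<dots> = (\<Oplus>\<^bsub>Mor C (pos Z s) (pos X t)\<^esub>b\<in>carrier G. \<Oplus>\<^bsub>Mor C (pos Z s) (pos X t)\<^esub>q\<in>carrier G. ?u b
      q)"
  proof (rule M.finsum_cong'[OF refl])
    fix b assume b[simp]: "b \<in> carrier G"
    show "eB Z X s t (?C b w) = (\<Oplus>\<^bsub>Mor C (pos Z s) (pos X t)\<^esub>q\<in>carrier G. ?u b q)"
      by (subst eB_A_Cmp) (simp_all add: translation_apply)
  qed (auto intro!: M.finsum_closed)
  also have "\<dots> = (\<Oplus>\<^bsub>Mor C (pos Z s) (pos X t)\<^esub>q\<in>carrier G. \<Oplus>\<^bsub>Mor C (pos Z s) (pos X t)\<^esub>b\<in>carrier G. ?u b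
      q)"
    by (rule M.finsum_swap) simp_all
  finally show ?thesis .
qed

text \<open>
  The element \<open>f \<otimes> \<delta> a \<otimes> v\<close> with \<open>f\<close> of degree \<open>u\<close> corresponds to the matrix unit at position
  \<open>(u a, a v)\<close> with entry \<open>f\<close>.
\<close>

definition eS :: "'o set \<Rightarrow> 'o set \<Rightarrow> 'g \<Rightarrow> 'g \<Rightarrow> ('g \<Rightarrow> 'g \<Rightarrow> ('o \<times> 'o \<Rightarrow> 'm) set) \<Rightarrow> ('o \<times> 'o \<Rightarrow> 'm) set" where
  "eS Y X j i F = of_entries Y X (\<lambda>s t. eB Y X s t
     (F (inv j \<otimes> (s \<otimes> (inv t \<otimes> i))) (t \<otimes> (inv s \<otimes> j))))"

text \<open>Both coefficient indices depend on \<open>(s, t)\<close> only through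
  \<open>s \<otimes> inv t\<close>. The assembled matrix is therefore invariant, and
  \<open>of_entries\<close> yields a morphism of \<open>B\<close>.\<close>

lemma eS:
  assumes "Y \<in> orbs" "X \<in> orbs" "F \<in> carrier (Mor S Y X)" "j \<in> carrier G" "i \<in> carrier G"
  shows "eS Y X j i F \<in> carrier (Mor B Y X)"
    and "\<lbrakk>s \<in> carrier G; t \<in> carrier G\<rbrakk> \<Longrightarrow> eB Y X s t (eS Y X j i F) = eB Y X s t
     (F (inv j \<otimes> (s \<otimes> (inv t \<otimes> i))) (t \<otimes> (inv s \<otimes> j)))"
  unfolding eS_def
  by (rule of_entries[OF assms(1,2)]; use assms in \<open>simp add: eB_closed S_mem2 psi_eB g_norm\<close>)+

lemma S_presentation: "full_matrix_presentation K B S (carrier G) (\<lambda>X _. X) eS"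
proof (rule full_matrix_presentation.intro[OF matrix_presentation.intro[OF B_category
        matrix_presentation_axioms.intro] full_matrix_presentation_axioms.intro], goal_cases)
  case (6 X Y i j)
  then have X: "X \<in> orbs" and Y: "Y \<in> orbs" by (simp_all add: S_Obj)
  show ?case
  proof (rule matrix_presentation.linear_if_ent_linear[OF B_presentation S_Mor_module[OF Y X]])
    fix s t assume st: "s \<in> carrier G" "t \<in> carrier G"
    show "(\<lambda>F. eB Y X s t (eS Y X j i F)) \<in> linear_maps K (Mor S Y X) (Mor C (pos Y s) (pos X t))"
      by (rule linear_maps_cong[OF linear_maps_comp[OF S_eval_linear eB_linear] S_Mor_module])
        (use st 6 in \<open>simp_all add: X Y eS\<close>)
  qed (use 6 in \<open>simp_all add: X Y eS B_simps(1)\<close>)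
next
  case (7 X Y Z F E i k)
  then have X: "X \<in> orbs" and Y: "Y \<in> orbs" and Z: "Z \<in> orbs" by (simp_all add: S_Obj)
  note F = 7(4) and E = 7(5)
  note [simp] = X Y Z 7(6,7) eS[OF Z Y F] eS[OF Y X E] S_mem2[OF F] S_mem2[OF E] eB_closed Cmp_closed
      finite_G
  show ?case
  proof (rule eB_inj[OF Z X])
    fix s t assume st[simp]: "s \<in> carrier G" "t \<in> carrier G"
    interpret M: abelian_monoid "Mor C (pos Z s) (pos X t)" by (rule Mor_am) simp_all
    let ?c = "\<lambda>q. Cmp C (pos Z s) (pos Y q) (pos X t)"
    let ?d = "inv k \<otimes> (s \<otimes> (inv t \<otimes> i))" and ?w = "t \<otimes> (inv s \<otimes> k)"
    let ?u = "\<lambda>q b. ?c q (eB Z Y s q (F b (q \<otimes> (inv t \<otimes> ?w)))) (eB Y X q t (E (inv b \<otimes> ?d) (?w \<otimes> b)))"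
    let ?v = "\<lambda>j q. ?c q (eB Z Y s q (eS Z Y k j F)) (eB Y X q t (eS Y X j i E))"
    have "eB Z X s t (eS Z X k i (Cmp S Z Y X F E)) = eB Z X s t (Cmp S Z Y X F E ?d ?w)"
      by (simp add: eS(2)[OF Z X S_Cmp_closed[OF Z Y X F E]])
    also have "\<dots> = (\<Oplus>\<^bsub>Mor C (pos Z s) (pos X t)\<^esub>q\<in>carrier G. \<Oplus>\<^bsub>Mor C (pos Z s) (pos X t)\<^esub>b\<in>carrier G. ?u
        q b)"
      by (rule eB_S_Cmp[OF Z Y X F E]) simp_all
    also have "\<dots> = (\<Oplus>\<^bsub>Mor C (pos Z s) (pos X t)\<^esub>q\<in>carrier G. \<Oplus>\<^bsub>Mor C (pos Z s) (pos X t)\<^esub>j\<in>carrier G. ?v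
        j q)"
    proof (rule M.finsum_cong'[OF refl])
      fix q assume q[simp]: "q \<in> carrier G"
      \<comment> \<open>For fixed \<open>q\<close>, the substitution
        \<open>b = ?h \<otimes> j\<close> turns summation over the group-algebra index into
        summation over the middle matrix index \<open>j\<close>; all four coefficient indices then
        match those in \<open>eS\<close>.\<close>
      let ?h = "inv k \<otimes> (s \<otimes> inv q)"
      have "(\<Oplus>\<^bsub>Mor C (pos Z s) (pos X t)\<^esub>b\<in>carrier G. ?u q b) =
          (\<Oplus>\<^bsub>Mor C (pos Z s) (pos X t)\<^esub>j\<in>carrier G. ?u q (?h \<otimes> j))"
        by (rule M.finsum_bij[OF bij_left]) simp_all
      also have "\<dots> = (\<Oplus>\<^bsub>Mor C (pos Z s) (pos X t)\<^esub>j\<in>carrier G. ?v j q)"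
        by (rule M.finsum_cong') (simp_all add: g_norm)
      finally show "(\<Oplus>\<^bsub>Mor C (pos Z s) (pos X t)\<^esub>b\<in>carrier G. ?u q b) =
          (\<Oplus>\<^bsub>Mor C (pos Z s) (pos X t)\<^esub>j\<in>carrier G. ?v j q)" .
    qed (auto intro!: M.finsum_closed)
    also have "\<dots> = (\<Oplus>\<^bsub>Mor C (pos Z s) (pos X t)\<^esub>j\<in>carrier G. \<Oplus>\<^bsub>Mor C (pos Z s) (pos X t)\<^esub>q\<in>carrier G. ?v
        j q)"
      by (rule M.finsum_swap) simp_all
    also have "\<dots> = (\<Oplus>\<^bsub>Mor C (pos Z s) (pos X t)\<^esub>j\<in>carrier G. eB Z X s t
        (Cmp B Z Y X (eS Z Y k j F) (eS Y X j i E)))"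
      by (rule M.finsum_cong') (auto simp: eB_Cmp B_Cmp_closed simp del: eS)
    also have "\<dots> = eB Z X s t (\<Oplus>\<^bsub>Mor B Z X\<^esub>j\<in>carrier G. Cmp B Z Y X (eS Z Y k j F) (eS Y X j i E))"
      by (rule eB_finsum[symmetric]) (simp_all add: B_Cmp_closed)
    finally show "eB Z X s t (eS Z X k i (Cmp S Z Y X F E)) =
      eB Z X s t (\<Oplus>\<^bsub>Mor B Z X\<^esub>j\<in>carrier G. Cmp B Z Y X (eS Z Y k j F) (eS Y X j i E))" .
  qed (simp_all add: eS(1)[OF Z X S_Cmp_closed[OF Z Y X F E]] B.Mor_finsum B_simps(1) B_Cmp_closed)
next
  case (8 X i j)
  then have X: "X \<in> orbs" by (simp add: S_Obj)
  note ij[simp] = 8(2,3)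
  have z: "\<zero>\<^bsub>Mor B X X\<^esub> \<in> carrier (Mor B X X)" by (rule B.Mor_zero) (simp_all add: B_simps(1) X)
  show ?case
  proof (rule eB_inj[OF X X])
    fix s t assume st[simp]: "s \<in> carrier G" "t \<in> carrier G"
    have z': "eB X X s t \<zero>\<^bsub>Mor B X X\<^esub> = \<zero>\<^bsub>Mor C (pos X s) (pos X t)\<^esub>"
      if "s \<in> carrier G" "t \<in> carrier G" for s t
      by (rule linear_maps_zero[OF eB_linear B.Mor_ag Mor_ag]) (simp_all add: that X B_simps(1))
    \<comment> \<open>Entries of the identity of \<open>B\<close> vanish unless
      \<open>s = t\<close>, and there the coefficient index becomes
      \<open>inv j \<otimes> i\<close>.\<close>
    have "inv j \<otimes> i = \<one> \<longleftrightarrow> j = i"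
    proof
      assume "inv j \<otimes> i = \<one>"
      then have "j \<otimes> (inv j \<otimes> i) = j" by simp
      then show "j = i" by (simp add: g_norm)
    qed simp
    then show "eB X X s t (eS X X j i (Idt S X)) = eB X X s t (if j = i then Idt B X else \<zero>\<^bsub>Mor B X X\<^esub>)"
      by (auto simp: eS(2)[OF X X S_Idt_closed[OF X]] S_Idt X eB_Idt z' g_norm)
  qed (simp_all add: eS(1)[OF X X S_Idt_closed[OF X]] z B_Idt_closed X)
next
  case (9 X Y F E)
  then have X: "X \<in> orbs" and Y: "Y \<in> orbs" by (simp_all add: S_Obj)
  show ?case
  proof (rule PiE_ext[OF 9(3,4)[unfolded S_carrier]], rule A_eqI[OF S_mem[OF 9(3)] S_mem[OF 9(4)]])
    fix v a assume v: "v \<in> carrier G" and a: "a \<in> carrier G"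
    show "F v a = E v a"
    proof (rule eB_inj[OF Y X S_mem2[OF 9(3) v a] S_mem2[OF 9(4) v a]])
      fix s t assume st: "s \<in> carrier G" "t \<in> carrier G"
      \<comment> \<open>The solution of the two index equations in \<open>eS\<close>: at this
        position its entry \<open>(s, t)\<close> is read from \<open>F v a\<close>.\<close>
      let ?j = "s \<otimes> (inv t \<otimes> a)" and ?i = "a \<otimes> v"
      show "eB Y X s t (F v a) = eB Y X s t (E v a)"
        using arg_cong[OF 9(5)[of ?j ?i], of "eB Y X s t"] st v a
        by (simp add: eS(2)[OF Y X 9(3)] eS(2)[OF Y X 9(4)] g_norm)
    qed
  qed
next
  case (10 X Y m)
  then have X: "X \<in> orbs" and Y: "Y \<in> orbs" by (simp_all add: S_Obj)
  note [simp] = X Y 10(3)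
  \<comment> \<open>For fixed \<open>a\<close> and \<open>v\<close>, entry \<open>(s, t)\<close> is
    taken from the matrix position \<open>(j, i)\<close> that \<open>eS\<close> assigns to degree
    \<open>s \<otimes> inv t\<close>, so reading the entries back recovers \<open>m\<close>.\<close>
  define n where "n v a s t = eB Y X s t (m (s \<otimes> (inv t \<otimes> a)) (a \<otimes> v))" for v a s t
  have ofn: "of_entries Y X (n v a) \<in> carrier (Mor B Y X)"
    "\<And>s t. \<lbrakk>s \<in> carrier G; t \<in> carrier G\<rbrakk> \<Longrightarrow> eB Y X s t (of_entries Y X (n v a)) = n v a s t"
    if "v \<in> carrier G" "a \<in> carrier G" for v a
    by (rule of_entries[OF Y X]; use that in \<open>simp add: n_def eB_closed psi_eB g_norm\<close>)+
  define F where "F = (\<lambda>v\<in>carrier G. \<lambda>a\<in>carrier G. of_entries Y X (n v a))"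
  have F: "F \<in> carrier (Mor S Y X)" by (auto simp: F_def S_carrier A_carrier ofn)
  have "eS Y X j i F = m j i" if ji: "j \<in> carrier G" "i \<in> carrier G" for j i
    by (rule eB_inj[OF Y X]) (use ji in \<open>simp_all add: eS[OF Y X F], simp add: F_def ofn n_def g_norm\<close>)
  then show ?case using F by blast
next
  case (11 X)
  \<comment> \<open>Every family here is constant, so occurrence of an object only requires the
    index set \<open>carrier G\<close> to be nonempty.\<close>
  then show ?case using g_closed(3) unfolding S_Obj B_simps(1) by blast
qed (auto simp: S_Obj B_simps(1) finite_G S_Mor_module S_Cmp_closed S_Idt_closed)

end

theorem theorem4p9:
  fixes K :: "('k, 'r) ring_scheme" and G :: "('g, 'q) monoid_scheme"
    and C :: "('k, 'o, 'm) kcat"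
    and \<phi> :: "'g \<Rightarrow> 'o \<Rightarrow> 'o" and \<psi> :: "'g \<Rightarrow> 'o \<Rightarrow> 'o \<Rightarrow> 'm \<Rightarrow> 'm"
    and B :: "('k, 'o set, ('o \<times> 'o \<Rightarrow> 'm) set) kcat"
    and P :: "('o, 'm, 'o set, ('o \<times> 'o \<Rightarrow> 'm) set) kfun"
    and x :: "'o set \<Rightarrow> 'o"
    and A :: "('k, 'o set, 'g \<Rightarrow> ('o \<times> 'o \<Rightarrow> 'm) set) kcat"
    and S :: "('k, 'o set, 'g \<Rightarrow> 'g \<Rightarrow> ('o \<times> 'o \<Rightarrow> 'm) set) kcat"
    and E :: "('o set, 'g \<Rightarrow> ('o \<times> 'o \<Rightarrow> 'm) set,
               'o set, 'g \<Rightarrow> 'g \<Rightarrow> ('o \<times> 'o \<Rightarrow> 'm) set) kfun"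
  assumes "field K"
    and "group G" and "finite (carrier G)"
    and "galois_covering K G C \<phi> \<psi> B P"
    and "\<forall>\<alpha>\<in>Obj B. x \<alpha> \<in> \<alpha>"
    and "A = smash_category K (dual_group_algebra K G) (grading_act K G C \<phi> \<psi> x) B"
    and "smash_extension K (group_algebra K G) (translation_act G) A S E"
    and "infinite (UNIV :: 'v set)"
  shows "morita_equivalent TYPE('v) K A C \<and> morita_equivalent TYPE('v) K S B"
proof -
  have B: "B = quotient_category K G C \<phi> \<psi>" and free: "free_G_k_category K G C \<phi> \<psi>"
    using assms(4) by (simp_all add: galois_covering_def)
  interpret free_G_k_category K G C \<phi> \<psi> by fact
  interpret galois_data K G C \<phi> \<psi> x
    by unfold_locales (use assms(3,5) in \<open>simp_all add: B quotient_category_def\<close>)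
  have S: "S = smash_category K (group_algebra K G) (translation_act G) A"
    using assms(7) by (simp add: smash_extension_def)
  show ?thesis
    unfolding S assms(6) B
    using full_matrix_presentation.morita_equivalent_D_C[OF A_presentation assms(8)]
      full_matrix_presentation.morita_equivalent_D_C[OF S_presentation assms(8)] by blast
qed

end
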